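(* Let $D$ be a multipole Darboux matrix such that $D$ and $D^{-1}$ have the fractional form $$D=\mathcal N\Big(I+\sum_{k=1}^N\frac{A_k}{\lambda-\lambda_k}\Big),\qquad D^{-1}=\Big(I+\sum_{k=1}^N\frac{B_k}{\lambda-\mu_k}\Big)\mathcal N^{-1},\qquad \det\mathcal N\ne0,$$ as described in the context. Then there exist constant matrices $a_{k0}$ (with $n$ columns and $\operatorname{rk}A_k$ linearly independent rows) and $b_{k0}$ (with $n$ rows and $\operatorname{rk}B_k$ linearly independent columns), $k=1,\dots,N$, such that, putting $$a_k=a_{k0}\Psi^{-1}(\lambda_k),\qquad b_k=\Psi(\mu_k)b_{k0},\qquad M_{kj}=\frac{a_kb_j}{\lambda_k-\mu_j},$$ the block matrix $\hat M=(M_{kj})$ is invertible and, denoting by $K_{jk}$ the blocks of $\hat K=\hat M^{-1}$, $$D(\lambda)=\mathcal N\Big(I+\sum_{k=1}^N\sum_{j=1}^N\frac{b_jK_{jk}a_k}{\lambda-\lambda_k}\Big),\qquad D^{-1}(\lambda)=\Big(I-\sum_{k=1}^N\sum_{j=1}^N\frac{b_jK_{jk}a_k}{\lambda-\mu_j}\Big)\mathcal N^{-1}.$$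
   Context: Let $x=(x^1,\dots,x^m)$ range over a simply connected domain. $\Psi=\Psi(x,\lambda)$ is an invertible $n\times n$ matrix solution of the linear problem $\Psi,_\nu=U_\nu\Psi$ ($\nu=1,\dots,m$), where $U_\nu=U_\nu(x,\lambda)$ is rational in $\lambda$. The spectral parameter is either constant (isospectral case, $L_\nu\equiv0$) or satisfies $\lambda,_\nu=L_\nu(x,\lambda)$ with given $L_\nu$ rational in $\lambda$ (nonisospectral case); derivatives $,_\nu$ of functions of $(x,\lambda)$ take into account the $x$-dependence of $\lambda$. In the fractional form, $\lambda_1,\dots,\lambda_N,\mu_1,\dots,\mu_N$ are pairwise different and satisfy $\lambda_k,_\nu=L_\nu(x,\lambda_k)$, $\mu_k,_\nu=L_\nu(x,\mu_k)$; the matrices $A_k,B_k,\mathcal N$ depend on $x$ but not on $\lambda$; $A_k,B_k$ are nonzero and of constant rank. The matrices $U_\nu$, $L_\nu$ and $\Psi$ are regular at $\lambda=\lambda_k$ and $\lambda=\mu_k$, with $\Psi(\lambda_k),\Psi(\mu_k)$ invertible. That $D$ is a Darboux matrix means that the transformed matrices $\tilde U_\nu=D,_\nu D^{-1}+DU_\nu D^{-1}$ have the same poles as $U_\nu$; in particular they are regular at all $\lambda_k$ and $\mu_k$. *)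

theory Defs
  imports
    "HOL-Complex_Analysis.Complex_Analysis"
    "Jordan_Normal_Form.Determinant"
    "Jordan_Normal_Form.Gauss_Jordan_Elimination"
    "Jordan_Normal_Form.DL_Rank"
begin

text \<open>
  The coordinates x range over a set of type \<^typ>\<open>(real ^ 'm) set\<close>, the directions \<open>\<nu>\<close> are the
  elements of the index type \<^typ>\<open>'m\<close>, and matrices are complex matrices of the AFP type
  \<^typ>\<open>complex mat\<close>, since the sizes of the factors of the residues depend on their ranks. A function
  of x and of the spectral parameter has type \<^typ>\<open>real ^ 'm \<Rightarrow> complex \<Rightarrow> 'a\<close>; values at poles
  in the spectral parameter carry no information.
\<close>

hide_const (open) Finite_Cartesian_Product.mat Determinants.det

definition partial_deriv :: "'m::finite \<Rightarrow> (real ^ 'm \<Rightarrow> complex) \<Rightarrow> real ^ 'm \<Rightarrow> complex" where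
  "partial_deriv \<nu> f x = frechet_derivative f (at x) (axis \<nu> 1)"

text \<open>
  The derivative of a function of x and \<open>\<lambda>\<close> in direction \<open>\<nu>\<close> takes the x-dependence
  \<open>\<lambda>,\<^sub>\<nu> = L \<nu> x \<lambda>\<close> of the spectral parameter into account. By the chain rule it is the joint
  (real) derivative at \<open>(x, \<lambda>)\<close> applied to the vector \<open>(axis \<nu> 1, L \<nu> x \<lambda>)\<close>, that is,
  \<open>\<partial>F/\<partial>x\<^sub>\<nu> + L \<nu> x \<lambda> * \<partial>F/\<partial>\<lambda>\<close> when F is holomorphic in \<open>\<lambda>\<close>.
  The isospectral case is \<open>L = 0\<close>.
\<close>

definition total_deriv ::
  "('m::finite \<Rightarrow> real ^ 'm \<Rightarrow> complex \<Rightarrow> complex) \<Rightarrow> 'm \<Rightarrow> (real ^ 'm \<Rightarrow> complex \<Rightarrow> complex)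
    \<Rightarrow> real ^ 'm \<Rightarrow> complex \<Rightarrow> complex" where
  "total_deriv L \<nu> F x z =
     frechet_derivative (\<lambda>(y, w). F y w) (at (x, z)) (axis \<nu> 1, L \<nu> x z)"

definition mat_total_deriv ::
  "nat \<Rightarrow> ('m::finite \<Rightarrow> real ^ 'm \<Rightarrow> complex \<Rightarrow> complex) \<Rightarrow> 'm
    \<Rightarrow> (real ^ 'm \<Rightarrow> complex \<Rightarrow> complex mat) \<Rightarrow> real ^ 'm \<Rightarrow> complex \<Rightarrow> complex mat" where
  "mat_total_deriv n L \<nu> F x z =
     Matrix.mat n n (\<lambda>(i, j). total_deriv L \<nu> (\<lambda>y w. F y w $$ (i, j)) x z)"

definition mat_differentiable ::
  "nat \<Rightarrow> ('v::real_normed_vector \<Rightarrow> complex mat) \<Rightarrow> 'v \<Rightarrow> bool" where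
  "mat_differentiable n F v \<longleftrightarrow> (\<forall>i<n. \<forall>j<n. (\<lambda>u. F u $$ (i, j)) differentiable (at v))"

definition rational_fun :: "(complex \<Rightarrow> complex) \<Rightarrow> bool" where
  "rational_fun f \<longleftrightarrow>
     (\<exists>p q :: complex poly. q \<noteq> 0 \<and> (\<forall>z. poly q z \<noteq> 0 \<longrightarrow> f z = poly p z / poly q z))"

definition mat_rational :: "nat \<Rightarrow> (complex \<Rightarrow> complex mat) \<Rightarrow> bool" where
  "mat_rational n F \<longleftrightarrow> (\<forall>i<n. \<forall>j<n. rational_fun (\<lambda>z. F z $$ (i, j)))"

definition mat_regular_at :: "nat \<Rightarrow> (complex \<Rightarrow> complex mat) \<Rightarrow> complex \<Rightarrow> bool" where
  "mat_regular_at n F z \<longleftrightarrow> (\<forall>i<n. \<forall>j<n. (\<lambda>w. F w $$ (i, j)) analytic_on {z})"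

definition mat_pole :: "nat \<Rightarrow> (complex \<Rightarrow> complex mat) \<Rightarrow> complex \<Rightarrow> bool" where
  "mat_pole n F z \<longleftrightarrow> (\<exists>i<n. \<exists>j<n. is_pole (\<lambda>w. F w $$ (i, j)) z)"

definition transformed ::
  "nat \<Rightarrow> ('m::finite \<Rightarrow> real ^ 'm \<Rightarrow> complex \<Rightarrow> complex)
    \<Rightarrow> (real ^ 'm \<Rightarrow> complex \<Rightarrow> complex mat) \<Rightarrow> (real ^ 'm \<Rightarrow> complex \<Rightarrow> complex mat)
    \<Rightarrow> ('m \<Rightarrow> real ^ 'm \<Rightarrow> complex \<Rightarrow> complex mat)
    \<Rightarrow> 'm \<Rightarrow> real ^ 'm \<Rightarrow> complex \<Rightarrow> complex mat" where
  "transformed n L D Dinv U \<nu> x z =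
     mat_total_deriv n L \<nu> D x z * Dinv x z + D x z * U \<nu> x z * Dinv x z"

text \<open>Matrices of variable size form no additive monoid, so \<^const>\<open>sum\<close> is used entrywise.\<close>

definition mat_sum :: "nat \<Rightarrow> ('i \<Rightarrow> complex mat) \<Rightarrow> 'i set \<Rightarrow> complex mat" where
  "mat_sum n F I = Matrix.mat n n (\<lambda>(i, j). \<Sum>k\<in>I. F k $$ (i, j))"

text \<open>Junk unless A is invertible; see the library lemma \<open>mat_inverse\<close>.\<close>

abbreviation matinv :: "complex mat \<Rightarrow> complex mat" where
  "matinv A \<equiv> the (mat_inverse A)"

text \<open>
  Block matrices with \<open>N\<close> times \<open>N\<close> blocks, the block \<open>(k, j)\<close> having size \<open>r k\<close> times \<open>s j\<close>.
  The global index p lies in the block \<^term>\<open>block_of r p\<close>, which starts at the global index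
  \<open>block_start r (block_of r p)\<close>.
\<close>

definition block_start :: "(nat \<Rightarrow> nat) \<Rightarrow> nat \<Rightarrow> nat" where
  "block_start r k = (\<Sum>i<k. r i)"

definition block_of :: "(nat \<Rightarrow> nat) \<Rightarrow> nat \<Rightarrow> nat" where
  "block_of r p = (LEAST k. p < block_start r (Suc k))"

definition block_mat ::
  "nat \<Rightarrow> (nat \<Rightarrow> nat) \<Rightarrow> (nat \<Rightarrow> nat) \<Rightarrow> (nat \<Rightarrow> nat \<Rightarrow> complex mat) \<Rightarrow> complex mat" where
  "block_mat N r s M = Matrix.mat (block_start r N) (block_start s N)
     (\<lambda>(p, q). M (block_of r p) (block_of s q) $$
        (p - block_start r (block_of r p), q - block_start s (block_of s q)))"

definition block ::
  "(nat \<Rightarrow> nat) \<Rightarrow> (nat \<Rightarrow> nat) \<Rightarrow> complex mat \<Rightarrow> nat \<Rightarrow> nat \<Rightarrow> complex mat" where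
  "block r s A k j =
     Matrix.mat (r k) (s j) (\<lambda>(p, q). A $$ (block_start r k + p, block_start s j + q))"

text \<open>Linear independence of a family of vectors, hence the requirement \<^const>\<open>distinct\<close>.\<close>

definition independent_vecs :: "nat \<Rightarrow> complex Matrix.vec list \<Rightarrow> bool" where
  "independent_vecs n vs \<longleftrightarrow>
     distinct vs \<and> module.lin_indpt class_ring (module_vec TYPE(complex) n) (set vs)"

end

theory Submission
  imports Defs
begin

text \<open>
  Fix x and write \<open>D = \<N> F\<close>, \<open>D\<^sup>-\<^sup>1 = E \<N>\<^sup>-\<^sup>1\<close>. The residue of \<open>F E = 1\<close> at \<open>\<lambda>\<^sub>k\<close> is
  \<open>A\<^sub>k E(\<lambda>\<^sub>k) = 0\<close>, and \<open>E F = 1\<close> shows that every \<open>V\<close> with \<open>V E(\<lambda>\<^sub>k) = 0\<close> has its rows in the row space of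
  \<open>A\<^sub>k\<close>. Since \<open>D,\<^sub>\<nu> D\<^sup>-\<^sup>1 + D U\<^sub>\<nu> D\<^sup>-\<^sup>1\<close> has no pole at \<open>\<lambda>\<^sub>k\<close>, its residue gives
  \<open>((\<N> A\<^sub>k),\<^sub>\<nu> + \<N> A\<^sub>k U\<^sub>\<nu>(\<lambda>\<^sub>k)) E(\<lambda>\<^sub>k) = 0\<close>, so \<open>G = \<N> A\<^sub>k \<Psi>(\<lambda>\<^sub>k)\<close> satisfies \<open>G,\<^sub>\<nu> = C\<^sub>\<nu> G\<close>. As G has
  constant rank, its row space does not depend on x; a basis of it is \<open>a\<^sub>k\<^sub>0\<close>. Dually, the column space of
  \<open>\<Psi>(\<mu>\<^sub>k)\<^sup>-\<^sup>1 B\<^sub>k\<close> is constant. With the resulting factorizations \<open>A\<^sub>k = P\<^sub>k a\<^sub>k\<close> and \<open>B\<^sub>k = b\<^sub>k Q\<^sub>k\<close> the inverse of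
  \<open>M\<close> is explicit, \<open>K\<^sub>j\<^sub>k = - Q\<^sub>j P\<^sub>k / (\<lambda>\<^sub>k - \<mu>\<^sub>j)\<close>: both products with \<open>M\<close> are evaluated from \<open>E F = 1\<close> by partial
  fractions.
\<close>

section \<open>One-sided inverses and rank factorizations\<close>

text \<open>The formula for K is read off from E(lam_k) A_k = 0. This equation says A_k = - sum_j
  B_j A_k / (lam_k - mu_j); substituting A_k = P_k a_k and B_j = b_j Q_j and comparing with the
  wanted A_k = sum_j b_j K_jk a_k suggests the blocks of K. The obstacle is size. The ranks of the
  A_k and of the B_j are given separately, so the blocks are rectangular and the whole matrix M is
  not known to be square. Both M K = 1 and K M = 1 are therefore proved, and comparing traces shows
  that the total ranks agree. For the same reason full rank is expressed by one-sided inverses. In G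
  the factor \<open>\<N>\<close> is present because \<open>\<N> * A k\<close> is the residue of D,
  the matrix about which the condition on poles speaks; the factor Psi(lam_k) supplies the term with
  U when G is differentiated. The equation for G fixes the row space near each point, and
  connectedness of the domain makes it global. The column side is reduced to the row side by
  transposition. Residues are limits of (z - p) times a function in punctured neighbourhoods of p,
  so arbitrary values at poles do no harm.\<close>

lemma mult_mat_assoc:
  fixes X Y Z :: "'a :: semiring_0 mat"
  assumes "dim_col X = dim_row Y" "dim_col Y = dim_row Z"
  shows "X * Y * Z = X * (Y * Z)"
  using assms by (intro assoc_mult_mat[of X "dim_row X" "dim_row Y" Y "dim_row Z" Z "dim_col Z"]) auto

text \<open>Only \<open>X * Y\<close> has to be the identity, so this also cancels a left inverse of
  a rectangular \<open>Y\<close>. The side conditions are dimension equations, which simplification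
  settles once the carriers are known.\<close>

lemma mult_mat_cancel:
  fixes X Y Z :: "'a :: semiring_1 mat"
  assumes "X * Y = 1\<^sub>m n" "dim_col X = dim_row Y" "dim_col Y = dim_row Z"
  shows "X * (Y * Z) = Z"
proof -
  have "dim_col Y = n" using assms(1) by (metis index_mult_mat(3) index_one_mat(3))
  then show ?thesis using assms by (simp flip: mult_mat_assoc)
qed

lemma mult_inverse_cancel_right:
  fixes X Y Z Z' :: "'a::semiring_1 mat"
  assumes "X \<in> carrier_mat m n" "Y \<in> carrier_mat n p" "Z \<in> carrier_mat p p" "Z' \<in> carrier_mat p p" "Z * Z' = 1\<^sub>m p"
  shows "X * (Y * Z) * Z' = X * Y"
  using assms by (simp add: mult_mat_assoc)

lemma minus_r_inv_zero:
  fixes X :: "'a::group_add mat"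
  assumes "X \<in> carrier_mat m n"
  shows "X - 0\<^sub>m m n = X"
  using assms by (intro eq_matI) auto

text \<open>Full column rank \<open>r\<close>, in the form that makes cancellation and closure under
  products immediate. Together with \<open>has_right_inverse\<close>, full row rank, it takes the
  place of rank computations once \<open>rank_factorization\<close> has been applied.\<close>

definition has_left_inverse :: "nat \<Rightarrow> nat \<Rightarrow> complex mat \<Rightarrow> bool" where
  "has_left_inverse n r P \<longleftrightarrow> P \<in> carrier_mat n r \<and> (\<exists>Q \<in> carrier_mat r n. Q * P = 1\<^sub>m r)"

definition has_right_inverse :: "nat \<Rightarrow> nat \<Rightarrow> complex mat \<Rightarrow> bool" where
  "has_right_inverse r n Q \<longleftrightarrow> Q \<in> carrier_mat r n \<and> (\<exists>R \<in> carrier_mat n r. Q * R = 1\<^sub>m r)"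

lemma has_left_inverseE:
  assumes "has_left_inverse n r P"
  obtains Q where "P \<in> carrier_mat n r" "Q \<in> carrier_mat r n" "Q * P = 1\<^sub>m r"
  using assms unfolding has_left_inverse_def by blast

lemma has_right_inverseE:
  assumes "has_right_inverse r n Q"
  obtains R where "Q \<in> carrier_mat r n" "R \<in> carrier_mat n r" "Q * R = 1\<^sub>m r"
  using assms unfolding has_right_inverse_def by blast

lemma has_left_inverseI:
  "P \<in> carrier_mat n r \<Longrightarrow> Q \<in> carrier_mat r n \<Longrightarrow> Q * P = 1\<^sub>m r \<Longrightarrow> has_left_inverse n r P"
  unfolding has_left_inverse_def by blast

lemma has_right_inverseI:
  "Q \<in> carrier_mat r n \<Longrightarrow> R \<in> carrier_mat n r \<Longrightarrow> Q * R = 1\<^sub>m r \<Longrightarrow> has_right_inverse r n Q"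
  unfolding has_right_inverse_def by blast

lemma left_cancel_zero:
  fixes X Y :: "complex mat"
  assumes "has_left_inverse n r X" "Y \<in> carrier_mat r m" "X * Y = 0\<^sub>m n m"
  shows "Y = 0\<^sub>m r m"
proof -
  obtain Z where Z: "X \<in> carrier_mat n r" "Z \<in> carrier_mat r n" "Z * X = 1\<^sub>m r"
    using assms(1) by (rule has_left_inverseE)
  have "Y = Z * (X * Y)" using Z assms(2) by (simp add: mult_mat_cancel)
  then show ?thesis using Z assms by simp
qed

lemma right_cancel_zero:
  fixes X Y :: "complex mat"
  assumes "has_right_inverse r n X" "Y \<in> carrier_mat m r" "Y * X = 0\<^sub>m m n"
  shows "Y = 0\<^sub>m m r"
proof -
  obtain Z where Z: "X \<in> carrier_mat r n" "Z \<in> carrier_mat n r" "X * Z = 1\<^sub>m r"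
    using assms(1) by (rule has_right_inverseE)
  have "Y = Y * X * Z" using Z assms(2) by (simp add: mult_mat_assoc)
  then show ?thesis using Z assms by simp
qed

lemma has_left_inverse_mult:
  assumes "has_left_inverse m n X" "has_left_inverse n r P"
  shows "has_left_inverse m r (X * P)"
proof -
  obtain Y where X: "X \<in> carrier_mat m n" "Y \<in> carrier_mat n m" "Y * X = 1\<^sub>m n"
    using assms(1) by (rule has_left_inverseE)
  obtain Q where P: "P \<in> carrier_mat n r" "Q \<in> carrier_mat r n" "Q * P = 1\<^sub>m r"
    using assms(2) by (rule has_left_inverseE)
  have "(Q * Y) * (X * P) = Q * ((Y * X) * P)"
    using X(1,2) P(1,2) by (simp add: mult_mat_assoc)
  also have "\<dots> = 1\<^sub>m r" using X P by simp
  finally show ?thesis using X P by (intro has_left_inverseI[of _ _ _ "Q * Y"]) auto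
qed

lemma has_right_inverse_transpose:
  assumes "has_left_inverse n r P"
  shows "has_right_inverse r n (P\<^sup>T)"
proof -
  obtain Q where P: "P \<in> carrier_mat n r" "Q \<in> carrier_mat r n" "Q * P = 1\<^sub>m r"
    using assms by (rule has_left_inverseE)
  then have "P\<^sup>T * Q\<^sup>T = 1\<^sub>m r"
    using transpose_mult[of Q r n P r] by simp
  then show ?thesis using P by (intro has_right_inverseI) auto
qed

lemma has_left_inverse_transpose:
  assumes "has_right_inverse r n Q"
  shows "has_left_inverse n r (Q\<^sup>T)"
proof -
  obtain R where Q: "Q \<in> carrier_mat r n" "R \<in> carrier_mat n r" "Q * R = 1\<^sub>m r"
    using assms by (rule has_right_inverseE)
  then have "R\<^sup>T * Q\<^sup>T = 1\<^sub>m r"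
    using transpose_mult[of Q r n R r] by simp
  then show ?thesis using Q by (intro has_left_inverseI) auto
qed

lemma has_right_inverse_mult:
  assumes "has_right_inverse r n Q" "has_right_inverse n m X"
  shows "has_right_inverse r m (Q * X)"
proof -
  have c: "Q \<in> carrier_mat r n" "X \<in> carrier_mat n m"
    using assms by (auto simp: has_right_inverse_def)
  have "has_left_inverse m r (X\<^sup>T * Q\<^sup>T)"
    by (intro has_left_inverse_mult[of m n] has_left_inverse_transpose assms)
  then have "has_right_inverse r m ((X\<^sup>T * Q\<^sup>T)\<^sup>T)" by (rule has_right_inverse_transpose)
  moreover have "(X\<^sup>T * Q\<^sup>T)\<^sup>T = Q * X" using c by (subst transpose_mult[of _ m n _ r]) auto
  ultimately show ?thesis by simp
qed

lemma has_left_inverse_square: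
  assumes "A \<in> carrier_mat n n" "B \<in> carrier_mat n n" "A * B = 1\<^sub>m n"
  shows "has_left_inverse n n A" "has_right_inverse n n A"
  using assms mat_mult_left_right_inverse[OF assms]
  by (auto intro: has_left_inverseI has_right_inverseI)

section \<open>Full rank, linear independence and rank factorizations\<close>

lemma det_nonzero_inverse:
  fixes A :: "complex mat"
  assumes A: "A \<in> carrier_mat n n" and det: "Determinant.det A \<noteq> 0"
  obtains B where "B \<in> carrier_mat n n" "A * B = 1\<^sub>m n" "B * A = 1\<^sub>m n"
proof
  let ?B = "(1 / Determinant.det A) \<cdot>\<^sub>m adj_mat A"
  show B: "?B \<in> carrier_mat n n" using adj_mat(1)[OF A] by simp
  show AB: "A * ?B = 1\<^sub>m n"
    using adj_mat[OF A] A det by (simp add: mult_smult_distrib[of _ n n _ n]) (intro eq_matI, auto)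
  show "?B * A = 1\<^sub>m n" by (rule mat_mult_left_right_inverse[OF A B AB])
qed

text \<open>\<open>H\<close> is the conjugate transpose of \<open>P\<close>. If the Gram matrix
  \<open>H * P\<close> annihilates v, then the squared norm of P v vanishes, so v = 0. Hence the
  Gram matrix is invertible, and its inverse times \<open>H\<close> is a left inverse of
  \<open>P\<close>.\<close>

lemma left_inverse_of_trivial_kernel:
  fixes P :: "complex mat"
  assumes P: "P \<in> carrier_mat n r"
    and ker: "\<And>v. v \<in> carrier_vec r \<Longrightarrow> P *\<^sub>v v = 0\<^sub>v n \<Longrightarrow> v = 0\<^sub>v r"
  shows "has_left_inverse n r P"
proof -
  define H where "H = Matrix.mat r n (\<lambda>(i, j). cnj (P $$ (j, i)))"
  have H: "H \<in> carrier_mat r n" by (simp add: H_def)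
  have "Determinant.det (H * P) \<noteq> 0"
  proof
    assume "Determinant.det (H * P) = 0"
    then obtain v where v: "v \<in> carrier_vec r" "v \<noteq> 0\<^sub>v r" "(H * P) *\<^sub>v v = 0\<^sub>v r"
      using det_0_iff_vec_prod_zero_field[of "H * P" r] H P by auto
    define w where "w = P *\<^sub>v v"
    have w: "w \<in> carrier_vec n" unfolding w_def using P v by auto
    have Hw: "H *\<^sub>v w = 0\<^sub>v r"
      unfolding w_def using v(3) by (simp add: assoc_mult_mat_vec[OF H P v(1)])
    have Hwj: "(\<Sum>i<n. cnj (P $$ (i, j)) * w $ i) = 0" if "j < r" for j
    proof -
      have "(H *\<^sub>v w) $ j = (\<Sum>i<n. cnj (P $$ (i, j)) * w $ i)"
        using that H w by (simp add: scalar_prod_def H_def atLeast0LessThan)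
      then show ?thesis using Hw that by simp
    qed
    have wi: "w $ i = (\<Sum>j<r. P $$ (i, j) * v $ j)" if "i < n" for i
      using that P v(1) by (auto simp: w_def scalar_prod_def atLeast0LessThan)
    have "(\<Sum>i<n. w $ i * cnj (w $ i)) = (\<Sum>i<n. \<Sum>j<r. cnj (v $ j) * (cnj (P $$ (i, j)) * w $ i))"
      by (intro sum.cong refl) (simp add: wi sum_distrib_left mult_ac)
    also have "\<dots> = (\<Sum>j<r. cnj (v $ j) * (\<Sum>i<n. cnj (P $$ (i, j)) * w $ i))"
      by (subst sum.swap) (simp add: sum_distrib_left)
    also have "\<dots> = 0" by (simp add: Hwj)
    finally have "complex_of_real (\<Sum>i<n. (cmod (w $ i))\<^sup>2) = 0"
      unfolding of_real_sum complex_norm_square .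
    then have "(\<Sum>i<n. (cmod (w $ i))\<^sup>2) = 0" by (simp only: of_real_eq_0_iff)
    then have "\<forall>i<n. w $ i = 0"
      by (subst (asm) sum_nonneg_eq_0_iff) auto
    then have "w = 0\<^sub>v n" using w by (intro eq_vecI) auto
    then show False using ker[OF v(1)] v(2) by (simp add: w_def)
  qed
  then obtain X where Xc: "X \<in> carrier_mat r r" and X: "X * (H * P) = 1\<^sub>m r"
    using det_nonzero_inverse[of "H * P" r] H P by auto
  have "(X * H) * P = 1\<^sub>m r"
    using X Xc H P by (simp add: mult_mat_assoc)
  then show ?thesis using P H Xc by (intro has_left_inverseI[of _ _ _ "X * H"]) auto
qed

lemma left_inverse_kernel:
  fixes P :: "complex mat"
  assumes "has_left_inverse n r P" "v \<in> carrier_vec r" "P *\<^sub>v v = 0\<^sub>v n"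
  shows "v = 0\<^sub>v r"
proof -
  obtain Q where P: "P \<in> carrier_mat n r" "Q \<in> carrier_mat r n" "Q * P = 1\<^sub>m r"
    using assms(1) by (rule has_left_inverseE)
  have "v = (Q * P) *\<^sub>v v" using P assms by simp
  also have "\<dots> = Q *\<^sub>v (P *\<^sub>v v)" using P assms(2) by (intro assoc_mult_mat_vec) auto
  also have "\<dots> = 0\<^sub>v r" using P assms by auto
  finally show ?thesis .
qed

text \<open>A linear relation between the columns is a kernel vector of \<open>P\<close>.
  Distinctness is a separate matter because \<open>set\<close> forgets repetitions: equal columns of
  \<open>P\<close> would be sent by \<open>Q\<close> to equal columns of the identity.\<close>

lemma independent_vecs_cols:
  assumes "has_left_inverse n r P"
  shows "independent_vecs n (cols P)"
proof -
  obtain Q where P: "P \<in> carrier_mat n r" "Q \<in> carrier_mat r n" "Q * P = 1\<^sub>m r"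
    using assms by (rule has_left_inverseE)
  have dist: "distinct (cols P)"
    unfolding distinct_conv_nth
  proof (intro allI impI notI)
    fix i j assume ij: "i < length (cols P)" "j < length (cols P)" "i \<noteq> j" "cols P ! i = cols P ! j"
    then have ij': "i < r" "j < r" using P by auto
    have "col (Q * P) i = Q *\<^sub>v col P i" "col (Q * P) j = Q *\<^sub>v col P j"
      using ij' by (auto intro!: col_mult2[OF P(2,1)])
    moreover have "col P i = col P j" using ij P by simp
    ultimately have "col (1\<^sub>m r :: complex mat) i = col (1\<^sub>m r) j" by (simp add: P(3))
    then have "(1\<^sub>m r :: complex mat) $$ (i, i) = 1\<^sub>m r $$ (i, j)"
      using ij' by (metis index_col index_one_mat(2,3))
    then show False using ij' ij(3) by simp
  qed
  interpret vec_space "TYPE(complex)" n .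
  have "lin_indpt (set (cols P))"
  proof (rule ccontr)
    assume "\<not> lin_indpt (set (cols P))"
    then obtain v where "v \<in> carrier_vec r" "v \<noteq> 0\<^sub>v r" "P *\<^sub>v v = 0\<^sub>v n"
      using lin_depE[OF P(1) _ dist] by blast
    then show False using left_inverse_kernel[OF assms] by blast
  qed
  then show ?thesis unfolding independent_vecs_def using dist by simp
qed

lemma independent_vecs_rows:
  assumes "has_right_inverse r n Q"
  shows "independent_vecs n (rows Q)"
  using independent_vecs_cols[OF has_left_inverse_transpose[OF assms]] by simp

text \<open>\<open>P\<close> collects a maximal independent set of columns of \<open>A\<close>, and
  \<open>Q\<close> the coordinates of all columns of \<open>A\<close> with respect to it.
  \<open>P\<close> has trivial kernel by independence; \<open>Q\<close> has a right inverse because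
  the columns of \<open>P\<close> occur among those of \<open>A\<close>.\<close>

lemma rank_factorization:
  fixes A :: "complex mat"
  assumes A: "A \<in> carrier_mat n m"
  obtains P Q where "has_left_inverse n (vec_space.rank n A) P"
    "has_right_inverse (vec_space.rank n A) m Q" "A = P * Q"
proof -
  interpret vec_space "TYPE(complex)" n .
  define r where "r = rank A"
  have colsA: "set (cols A) \<subseteq> carrier_vec n" using A cols_dim by blast
  obtain S where S: "maximal S (\<lambda>T. T \<subseteq> set (cols A) \<and> lin_indpt T)" "finite S"
    using maximal_exists_superset[of "set (cols A)" "\<lambda>T. T \<subseteq> set (cols A) \<and> lin_indpt T" "{}"]
    by (auto simp: finite_lin_indpt2)
  have SA: "S \<subseteq> set (cols A)" and Sli: "lin_indpt S" using S(1) by (auto simp: maximal_def)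
  have Sc: "S \<subseteq> carrier_vec n" using SA colsA by blast
  have rS: "card S = r" using rank_card_indpt[OF A S(1)] by (simp add: r_def)
  obtain bs where bs: "set bs = S" "distinct bs" using finite_distinct_list[OF S(2)] by blast
  have len: "length bs = r" using bs rS distinct_card by fastforce
  define P where "P = mat_of_cols n bs"
  have P: "P \<in> carrier_mat n r" by (simp add: P_def mat_of_cols_carrier(1)[of n bs, unfolded len])
  have colsP: "cols P = bs" using bs Sc by (simp add: P_def)
  have hl: "has_left_inverse n r P"
  proof (rule left_inverse_of_trivial_kernel[OF P])
    fix v assume "v \<in> carrier_vec r" "P *\<^sub>v v = 0\<^sub>v n"
    then show "v = 0\<^sub>v r" using lin_depI[OF P] Sli bs colsP by metis
  qed
  have ex: "\<exists>q. q \<in> carrier_vec r \<and> P *\<^sub>v q = c" if "c \<in> set (cols A)" for c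
  proof -
    have cc: "c \<in> carrier_vec n" using that colsA by blast
    have "c \<in> span S"
    proof (rule ccontr)
      assume "c \<notin> span S"
      then have "lin_indpt (S \<union> {c})" and "c \<notin> S"
        using Sli Sc cc lin_dep_iff_in_span[of S c] span_mem[of S c] by auto
      then have "S \<union> {c} = S"
        using S(1) that SA unfolding maximal_def by (metis Un_upper1 insert_subset Un_insert_right sup_bot.right_neutral)
      then show False using \<open>c \<notin> S\<close> by blast
    qed
    then obtain a where "c = lincomb a S"
      using finite_span[OF S(2) Sc] by auto
    then have "P *\<^sub>v (vec r (\<lambda>i. a (col P i))) = c"
      using mat_mult_eq_lincomb[OF P, of a] bs colsP by simp
    then show ?thesis by (intro exI[of _ "vec r (\<lambda>i. a (col P i))"]) auto
  qed
  have "\<exists>q. \<forall>j<m. q j \<in> carrier_vec r \<and> P *\<^sub>v q j = col A j"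
  proof -
    have "\<forall>j. j < m \<longrightarrow> (\<exists>q. q \<in> carrier_vec r \<and> P *\<^sub>v q = col A j)"
    proof (intro allI impI)
      fix j assume "j < m"
      then have "col A j \<in> set (cols A)" using A by (auto simp: cols_def)
      then show "\<exists>q. q \<in> carrier_vec r \<and> P *\<^sub>v q = col A j" by (rule ex)
    qed
    then show ?thesis by metis
  qed
  then obtain q where q: "\<And>j. j < m \<Longrightarrow> q j \<in> carrier_vec r" "\<And>j. j < m \<Longrightarrow> P *\<^sub>v q j = col A j"
    by blast
  define Q where "Q = mat_of_cols r (map q [0..<m])"
  have Q: "Q \<in> carrier_mat r m" using mat_of_cols_carrier(1)[of r "map q [0..<m]"] by (simp add: Q_def)
  have AQ: "A = P * Q"
  proof (rule mat_col_eqI)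
    fix j assume "j < dim_col (P * Q)"
    then have j: "j < m" using Q by simp
    have "col Q j = q j" using j q by (simp add: Q_def)
    then show "col A j = col (P * Q) j" unfolding col_mult2[OF P Q j] using q(2)[OF j] by simp
  qed (use A P Q in auto)
  have "\<forall>i. \<exists>j. i < r \<longrightarrow> j < m \<and> col A j = col P i"
  proof (intro allI)
    fix i
    have "col P i \<in> set (cols A)" if "i < r"
      using that SA bs colsP P by (metis carrier_matD(2) cols_length cols_nth nth_mem subsetD)
    then show "\<exists>j. i < r \<longrightarrow> j < m \<and> col A j = col P i"
      using A by (auto simp: cols_def) metis
  qed
  then obtain \<sigma> where \<sigma>: "\<And>i. i < r \<Longrightarrow> \<sigma> i < m" "\<And>i. i < r \<Longrightarrow> col A (\<sigma> i) = col P i"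
    by metis
  \<comment> \<open>\<open>R\<close> selects the columns of \<open>A\<close> that were put into
    \<open>P\<close>, so that \<open>A * R = P\<close>; cancelling \<open>P\<close> from
    \<open>P * Q * R = P\<close> leaves \<open>Q * R = 1\<close>.\<close>
  define R :: "complex mat" where "R = Matrix.mat m r (\<lambda>(p, i). if p = \<sigma> i then 1 else 0)"
  have R: "R \<in> carrier_mat m r" by (simp add: R_def)
  have AR: "A * R = P"
  proof (rule eq_matI)
    fix p i assume "p < dim_row P" "i < dim_col P"
    then have pi: "p < n" "i < r" using P by auto
    have "(A * R) $$ (p, i) = (\<Sum>l<m. A $$ (p, l) * (if l = \<sigma> i then 1 else 0))"
      using pi A R by (simp add: scalar_prod_def R_def atLeast0LessThan)
    also have "\<dots> = A $$ (p, \<sigma> i)" using \<sigma>(1)[OF pi(2)] by (simp add: if_distrib cong: if_cong)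
    also have "\<dots> = P $$ (p, i)" using \<sigma>[OF pi(2)] pi A P by (metis carrier_matD index_col)
    finally show "(A * R) $$ (p, i) = P $$ (p, i)" .
  qed (use A P R in auto)
  obtain L where L: "L \<in> carrier_mat r n" "L * P = 1\<^sub>m r" using hl by (rule has_left_inverseE)
  have "Q * R = (L * P) * (Q * R)" using L Q R by simp
  also have "\<dots> = L * ((P * Q) * R)" using L(1) P Q R by (simp add: mult_mat_assoc)
  also have "\<dots> = 1\<^sub>m r" using AQ AR L by simp
  finally have "has_right_inverse r m Q" using Q R by (intro has_right_inverseI)
  then show thesis using that hl AQ unfolding r_def by blast
qed

text \<open>The traces of \<open>X * Y\<close> and \<open>Y * X\<close> agree, and they are r and s
  in characteristic 0.\<close>

lemma two_sided_inverse_dims: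
  fixes X Y :: "complex mat"
  assumes X: "X \<in> carrier_mat r s" and Y: "Y \<in> carrier_mat s r"
    and XY: "X * Y = 1\<^sub>m r" and YX: "Y * X = 1\<^sub>m s"
  shows "r = s"
proof -
  have "of_nat r = (\<Sum>i<r. (X * Y) $$ (i, i))" by (simp add: XY)
  also have "\<dots> = (\<Sum>i<r. \<Sum>j<s. X $$ (i, j) * Y $$ (j, i))"
    using X Y by (intro sum.cong) (auto simp: scalar_prod_def atLeast0LessThan)
  also have "\<dots> = (\<Sum>j<s. \<Sum>i<r. Y $$ (j, i) * X $$ (i, j))"
    by (subst sum.swap) (simp add: mult.commute)
  also have "\<dots> = (\<Sum>j<s. (Y * X) $$ (j, j))"
    using X Y by (intro sum.cong) (auto simp: scalar_prod_def atLeast0LessThan)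
  also have "\<dots> = (of_nat s :: complex)" by (simp add: YX)
  finally show ?thesis using of_nat_eq_iff[of r s, where ?'a = complex] by simp
qed

text \<open>\<open>mat_inverse\<close> yields \<open>None\<close> only for matrices that are not
  units of the matrix ring. A square matrix with a right inverse is a unit, so \<open>the\<close>
  returns a genuine inverse, and inverses are unique.\<close>

lemma matinv_eq:
  assumes A: "A \<in> carrier_mat n n" and B: "B \<in> carrier_mat n n" and AB: "A * B = 1\<^sub>m n"
  shows "matinv A = B"
proof -
  have BA: "B * A = 1\<^sub>m n" by (rule mat_mult_left_right_inverse[OF A B AB])
  have "A \<in> Units (ring_mat TYPE(complex) n ())"
    using A B AB BA by (auto simp: Units_def ring_mat_def)
  then obtain C where C: "mat_inverse A = Some C"
    using mat_inverse(1)[OF A, of "()"] by (cases "mat_inverse A") auto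
  then have C': "A * C = 1\<^sub>m n" "C * A = 1\<^sub>m n" "C \<in> carrier_mat n n" using mat_inverse(2)[OF A C] by auto
  have "C = C * (A * B)" using AB C' by simp
  also have "\<dots> = B" using A B C' by (simp flip: mult_mat_assoc)
  finally show ?thesis using C by simp
qed

lemma matinv_inverse:
  assumes A: "A \<in> carrier_mat n n" and "invertible_mat A"
  shows "matinv A \<in> carrier_mat n n" "A * matinv A = 1\<^sub>m n" "matinv A * A = 1\<^sub>m n"
proof -
  obtain B where B: "A * B = 1\<^sub>m n" "B * A = 1\<^sub>m (dim_row B)"
    using assms unfolding invertible_mat_def inverts_mat_def by auto
  have Bc: "B \<in> carrier_mat n n"
    using A B by (metis carrier_matD carrier_matI index_mult_mat(2,3) index_one_mat(2,3))
  show "matinv A \<in> carrier_mat n n" "A * matinv A = 1\<^sub>m n" "matinv A * A = 1\<^sub>m n"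
    using matinv_eq[OF A Bc B(1)] Bc B by auto
qed

lemma invertible_det_nonzero:
  fixes A :: "complex mat"
  assumes A: "A \<in> carrier_mat n n" and inv: "invertible_mat A"
  shows "Determinant.det A \<noteq> 0"
proof
  assume 0: "Determinant.det A = 0"
  have "Determinant.det A * Determinant.det (matinv A) = 1"
    using det_mult[OF A matinv_inverse(1)[OF A inv]] matinv_inverse(2)[OF A inv] by simp
  with 0 show False by simp
qed

section \<open>Block matrices\<close>

text \<open>The rectangular version of \<open>mat_sum\<close>: the block (k, l) of a product of
  block matrices is a sum of matrices whose two sizes belong to different blocks.\<close>

definition rect_sum :: "nat \<Rightarrow> nat \<Rightarrow> ('i \<Rightarrow> complex mat) \<Rightarrow> 'i set \<Rightarrow> complex mat" where
  "rect_sum r s F I = Matrix.mat r s (\<lambda>(i, j). \<Sum>k\<in>I. F k $$ (i, j))"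

lemma mat_sum_eq_rect_sum: "mat_sum n F I = rect_sum n n F I"
  by (simp add: mat_sum_def rect_sum_def)

lemma rect_sum_carrier [simp, intro]: "rect_sum r s F I \<in> carrier_mat r s"
  by (simp add: rect_sum_def)

lemma rect_sum_dim [simp]: "dim_row (rect_sum r s F I) = r" "dim_col (rect_sum r s F I) = s"
  by (simp_all add: rect_sum_def)

lemma rect_sum_index [simp]:
  "i < r \<Longrightarrow> j < s \<Longrightarrow> rect_sum r s F I $$ (i, j) = (\<Sum>k\<in>I. F k $$ (i, j))"
  by (simp add: rect_sum_def)

lemma rect_sum_cong:
  assumes "\<And>k i j. k \<in> I \<Longrightarrow> i < r \<Longrightarrow> j < s \<Longrightarrow> F k $$ (i, j) = G k $$ (i, j)"
  shows "rect_sum r s F I = rect_sum r s G I"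
  using assms by (intro eq_matI) auto

lemma mult_rect_sum:
  assumes X: "X \<in> carrier_mat m r" and F: "\<And>k. k \<in> I \<Longrightarrow> F k \<in> carrier_mat r s"
  shows "X * rect_sum r s F I = rect_sum m s (\<lambda>k. X * F k) I"
proof (rule eq_matI)
  fix i j assume "i < dim_row (rect_sum m s (\<lambda>k. X * F k) I)"
    "j < dim_col (rect_sum m s (\<lambda>k. X * F k) I)"
  then have ij: "i < m" "j < s" by auto
  have "(X * rect_sum r s F I) $$ (i, j) = (\<Sum>l<r. X $$ (i, l) * (\<Sum>k\<in>I. F k $$ (l, j)))"
    using ij X by (auto simp: scalar_prod_def atLeast0LessThan)
  also have "\<dots> = (\<Sum>k\<in>I. \<Sum>l<r. X $$ (i, l) * F k $$ (l, j))"
    by (simp add: sum_distrib_left sum.swap[of _ I])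
  also have "\<dots> = (\<Sum>k\<in>I. (X * F k) $$ (i, j))"
    using ij X F by (intro sum.cong refl) (force simp: scalar_prod_def atLeast0LessThan)
  finally show "(X * rect_sum r s F I) $$ (i, j) = rect_sum m s (\<lambda>k. X * F k) I $$ (i, j)"
    using ij by simp
qed (use X in auto)

lemma rect_sum_mult:
  assumes X: "X \<in> carrier_mat s m" and F: "\<And>k. k \<in> I \<Longrightarrow> F k \<in> carrier_mat r s"
  shows "rect_sum r s F I * X = rect_sum r m (\<lambda>k. F k * X) I"
proof (rule eq_matI)
  fix i j assume "i < dim_row (rect_sum r m (\<lambda>k. F k * X) I)"
    "j < dim_col (rect_sum r m (\<lambda>k. F k * X) I)"
  then have ij: "i < r" "j < m" by auto
  have "(rect_sum r s F I * X) $$ (i, j) = (\<Sum>l<s. (\<Sum>k\<in>I. F k $$ (i, l)) * X $$ (l, j))"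
    using ij X by (auto simp: scalar_prod_def atLeast0LessThan)
  also have "\<dots> = (\<Sum>k\<in>I. \<Sum>l<s. F k $$ (i, l) * X $$ (l, j))"
    by (simp add: sum_distrib_right sum.swap[of _ I])
  also have "\<dots> = (\<Sum>k\<in>I. (F k * X) $$ (i, j))"
    using ij X F by (intro sum.cong refl) (force simp: scalar_prod_def atLeast0LessThan)
  finally show "(rect_sum r s F I * X) $$ (i, j) = rect_sum r m (\<lambda>k. F k * X) I $$ (i, j)"
    using ij by simp
qed (use X in auto)

lemma block_start_Suc [simp]: "block_start r (Suc k) = block_start r k + r k"
  by (simp add: block_start_def)

lemma block_start_mono: "k \<le> l \<Longrightarrow> block_start r k \<le> block_start r l"
  unfolding block_start_def by (intro sum_mono2) auto

lemma block_index_less: "k < N \<Longrightarrow> i < r k \<Longrightarrow> block_start r k + i < block_start r N"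
  using block_start_mono[of "Suc k" N r] by simp

text \<open>Every earlier block ends at or before the start of block \<open>k\<close>, so
  \<open>k\<close> is the least candidate. Empty blocks cause no ambiguity, since the
  \<open>LEAST\<close> skips them.\<close>

lemma block_of_block_start:
  assumes "i < r k"
  shows "block_of r (block_start r k + i) = k"
  unfolding block_of_def
proof (rule Least_equality)
  show "block_start r k + i < block_start r (Suc k)" using assms by simp
  fix l assume l: "block_start r k + i < block_start r (Suc l)"
  show "k \<le> l"
  proof (rule ccontr)
    assume "\<not> k \<le> l"
    then have "block_start r (Suc l) \<le> block_start r k" by (intro block_start_mono) simp
    then show False using l by simp
  qed
qed

lemma block_indexE:
  assumes "p < block_start r N"
  obtains k i where "k < N" "i < r k" "p = block_start r k + i"
proof -
  have "\<exists>k<N. \<exists>i<r k. p = block_start r k + i"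
    using assms
  proof (induction N)
    case 0
    then show ?case by (simp add: block_start_def)
  next
    case (Suc N)
    show ?case
    proof (cases "p < block_start r N")
      case True
      then show ?thesis using Suc.IH less_SucI by blast
    next
      case False
      then have "p = block_start r N + (p - block_start r N)" "p - block_start r N < r N"
        using Suc.prems by auto
      then show ?thesis by blast
    qed
  qed
  then show thesis using that by blast
qed

lemma sum_lessThan_add:
  fixes f :: "nat \<Rightarrow> 'a::comm_monoid_add"
  shows "(\<Sum>i<a + b. f i) = (\<Sum>i<a. f i) + (\<Sum>i<b. f (a + i))"
  by (induction b) (auto simp: add.assoc)

lemma sum_blocks:
  fixes f :: "nat \<Rightarrow> 'a::comm_monoid_add"
  shows "(\<Sum>p<block_start s N. f p) = (\<Sum>j<N. \<Sum>q<s j. f (block_start s j + q))"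
proof (induction N)
  case 0
  then show ?case by (simp add: block_start_def)
qed (simp add: sum_lessThan_add)

lemma block_mat_carrier [simp]: "block_mat N r s M \<in> carrier_mat (block_start r N) (block_start s N)"
  by (simp add: block_mat_def)

lemma block_mat_index:
  assumes "k < N" "i < r k" "j < N" "q < s j"
  shows "block_mat N r s M $$ (block_start r k + i, block_start s j + q) = M k j $$ (i, q)"
  using assms by (simp add: block_mat_def block_index_less block_of_block_start)

lemma block_block_mat:
  assumes "k < N" "j < N" "M k j \<in> carrier_mat (r k) (s j)"
  shows "block r s (block_mat N r s M) k j = M k j"
  using assms by (intro eq_matI) (auto simp: block_def block_mat_index)

text \<open>The sizes \<open>r\<close> and \<open>s\<close> are unrelated, so the lemma can be
  applied to both orders of the factors before squareness is known. Writing each global index as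
  block start plus offset turns the inner sum into a sum over blocks and offsets.\<close>

lemma block_mat_mult_eq_one:
  assumes M: "\<And>k j. k < N \<Longrightarrow> j < N \<Longrightarrow> M k j \<in> carrier_mat (r k) (s j)"
    and T: "\<And>k j. k < N \<Longrightarrow> j < N \<Longrightarrow> T j k \<in> carrier_mat (s j) (r k)"
    and one: "\<And>k l. k < N \<Longrightarrow> l < N \<Longrightarrow>
      rect_sum (r k) (r l) (\<lambda>j. M k j * T j l) {..<N} = (if k = l then 1\<^sub>m (r k) else 0\<^sub>m (r k) (r l))"
  shows "block_mat N r s M * block_mat N s r T = 1\<^sub>m (block_start r N)"
proof (rule eq_matI)
  fix p p' assume "p < dim_row (1\<^sub>m (block_start r N) :: complex mat)"
    "p' < dim_col (1\<^sub>m (block_start r N) :: complex mat)"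
  then have pp: "p < block_start r N" "p' < block_start r N" by auto
  obtain k i where k: "k < N" "i < r k" "p = block_start r k + i" using pp(1) by (rule block_indexE)
  obtain l i' where l: "l < N" "i' < r l" "p' = block_start r l + i'" using pp(2) by (rule block_indexE)
  have "(block_mat N r s M * block_mat N s r T) $$ (p, p')
      = (\<Sum>q<block_start s N. block_mat N r s M $$ (p, q) * block_mat N s r T $$ (q, p'))"
    using pp by (simp add: scalar_prod_def atLeast0LessThan carrier_matD[OF block_mat_carrier])
  also have "\<dots> = (\<Sum>j<N. \<Sum>q<s j. M k j $$ (i, q) * T j l $$ (q, i'))"
    unfolding sum_blocks using k l by (simp add: block_mat_index)
  also have "\<dots> = (\<Sum>j<N. (M k j * T j l) $$ (i, i'))"
  proof (intro sum.cong refl)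
    fix j assume "j \<in> {..<N}"
    then have "M k j \<in> carrier_mat (r k) (s j)" "T j l \<in> carrier_mat (s j) (r l)"
      using k l M T by auto
    then show "(\<Sum>q<s j. M k j $$ (i, q) * T j l $$ (q, i')) = (M k j * T j l) $$ (i, i')"
      using k l by (simp add: scalar_prod_def atLeast0LessThan)
  qed
  also have "\<dots> = rect_sum (r k) (r l) (\<lambda>j. M k j * T j l) {..<N} $$ (i, i')"
    using k l by (simp only: rect_sum_index)
  also have "\<dots> = (if k = l \<and> i = i' then 1 else 0)"
    unfolding one[OF k(1) l(1)] using k(2) l(2) by auto
  also have "\<dots> = 1\<^sub>m (block_start r N) $$ (p, p')"
  proof -
    have "p = p' \<longleftrightarrow> k = l \<and> i = i'"
    proof
      assume "p = p'"
      then have "k = l" using k l by (metis block_of_block_start)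
      then show "k = l \<and> i = i'" using \<open>p = p'\<close> k l by simp
    qed (use k l in auto)
    then show ?thesis using pp by simp
  qed
  finally show "(block_mat N r s M * block_mat N s r T) $$ (p, p') = 1\<^sub>m (block_start r N) $$ (p, p')" .
qed (simp_all add: carrier_matD[OF block_mat_carrier])

section \<open>Limits of matrix-valued functions\<close>

text \<open>The size of the values is required only eventually: this suffices to expand products
  entrywise, and it leaves the value at the limit point itself free.\<close>

definition mat_tendsto ::
  "nat \<Rightarrow> nat \<Rightarrow> ('a \<Rightarrow> complex mat) \<Rightarrow> complex mat \<Rightarrow> 'a filter \<Rightarrow> bool" where
  "mat_tendsto r c F A fl \<longleftrightarrow> A \<in> carrier_mat r c \<and> (\<forall>\<^sub>F z in fl. F z \<in> carrier_mat r c) \<and>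
     (\<forall>i<r. \<forall>j<c. ((\<lambda>z. F z $$ (i, j)) \<longlongrightarrow> A $$ (i, j)) fl)"

lemma mat_tendstoI:
  assumes "A \<in> carrier_mat r c" "\<forall>\<^sub>F z in fl. F z \<in> carrier_mat r c"
    "\<And>i j. i < r \<Longrightarrow> j < c \<Longrightarrow> ((\<lambda>z. F z $$ (i, j)) \<longlongrightarrow> A $$ (i, j)) fl"
  shows "mat_tendsto r c F A fl"
  using assms by (simp add: mat_tendsto_def)

lemma mat_tendsto_cong:
  assumes "mat_tendsto r c F A fl" "\<forall>\<^sub>F z in fl. F z = G z"
  shows "mat_tendsto r c G A fl"
proof (rule mat_tendstoI)
  show "A \<in> carrier_mat r c" using assms by (simp add: mat_tendsto_def)
  have "\<forall>\<^sub>F z in fl. F z \<in> carrier_mat r c" using assms by (simp add: mat_tendsto_def)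
  then show "\<forall>\<^sub>F z in fl. G z \<in> carrier_mat r c"
    using assms(2) by eventually_elim simp
  fix i j assume "i < r" "j < c"
  then have "((\<lambda>z. F z $$ (i, j)) \<longlongrightarrow> A $$ (i, j)) fl" using assms by (simp add: mat_tendsto_def)
  moreover have "\<forall>\<^sub>F z in fl. F z $$ (i, j) = G z $$ (i, j)"
    using assms(2) by eventually_elim simp
  ultimately show "((\<lambda>z. G z $$ (i, j)) \<longlongrightarrow> A $$ (i, j)) fl" by (rule Lim_transform_eventually)
qed

lemma mat_tendsto_const: "A \<in> carrier_mat r c \<Longrightarrow> mat_tendsto r c (\<lambda>_. A) A fl"
  by (simp add: mat_tendsto_def)

lemma mat_tendsto_unique:
  assumes "mat_tendsto r c F A fl" "mat_tendsto r c F B fl" "fl \<noteq> bot"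
  shows "A = B"
proof (rule eq_matI)
  have AB: "A \<in> carrier_mat r c" "B \<in> carrier_mat r c" using assms by (auto simp: mat_tendsto_def)
  fix i j assume "i < dim_row B" "j < dim_col B"
  then have "((\<lambda>z. F z $$ (i, j)) \<longlongrightarrow> A $$ (i, j)) fl" "((\<lambda>z. F z $$ (i, j)) \<longlongrightarrow> B $$ (i, j)) fl"
    using AB assms by (auto simp: mat_tendsto_def)
  then show "A $$ (i, j) = B $$ (i, j)" by (rule tendsto_unique[OF assms(3)])
qed (use assms in \<open>auto simp: mat_tendsto_def\<close>)

lemma mat_tendsto_smult:
  assumes "(f \<longlongrightarrow> a) fl" "mat_tendsto r c F A fl"
  shows "mat_tendsto r c (\<lambda>z. f z \<cdot>\<^sub>m F z) (a \<cdot>\<^sub>m A) fl"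
proof (rule mat_tendstoI)
  have ev: "\<forall>\<^sub>F z in fl. F z \<in> carrier_mat r c" using assms by (simp add: mat_tendsto_def)
  then show "\<forall>\<^sub>F z in fl. f z \<cdot>\<^sub>m F z \<in> carrier_mat r c" by eventually_elim simp
  fix i j assume ij: "i < r" "j < c"
  then have "((\<lambda>z. f z * F z $$ (i, j)) \<longlongrightarrow> a * A $$ (i, j)) fl"
    using assms by (intro tendsto_mult) (auto simp: mat_tendsto_def)
  moreover have "\<forall>\<^sub>F z in fl. f z * F z $$ (i, j) = (f z \<cdot>\<^sub>m F z) $$ (i, j)"
    using ev by eventually_elim (use ij in auto)
  ultimately show "((\<lambda>z. (f z \<cdot>\<^sub>m F z) $$ (i, j)) \<longlongrightarrow> (a \<cdot>\<^sub>m A) $$ (i, j)) fl"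
    using assms ij by (auto simp: mat_tendsto_def intro: Lim_transform_eventually)
qed (use assms in \<open>auto simp: mat_tendsto_def\<close>)

lemma mat_tendsto_add:
  assumes "mat_tendsto r c F A fl" "mat_tendsto r c G B fl"
  shows "mat_tendsto r c (\<lambda>z. F z + G z) (A + B) fl"
proof (rule mat_tendstoI)
  have ev: "\<forall>\<^sub>F z in fl. F z \<in> carrier_mat r c" "\<forall>\<^sub>F z in fl. G z \<in> carrier_mat r c"
    using assms by (auto simp: mat_tendsto_def)
  then show "\<forall>\<^sub>F z in fl. F z + G z \<in> carrier_mat r c" by eventually_elim simp
  fix i j assume ij: "i < r" "j < c"
  then have "((\<lambda>z. F z $$ (i, j) + G z $$ (i, j)) \<longlongrightarrow> A $$ (i, j) + B $$ (i, j)) fl"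
    using assms by (intro tendsto_add) (auto simp: mat_tendsto_def)
  moreover have "\<forall>\<^sub>F z in fl. F z $$ (i, j) + G z $$ (i, j) = (F z + G z) $$ (i, j)"
    using ev by eventually_elim (use ij in auto)
  ultimately show "((\<lambda>z. (F z + G z) $$ (i, j)) \<longlongrightarrow> (A + B) $$ (i, j)) fl"
    using assms ij by (auto simp: mat_tendsto_def intro: Lim_transform_eventually)
qed (use assms in \<open>auto simp: mat_tendsto_def\<close>)

lemma mat_tendsto_mult:
  assumes "mat_tendsto r m F A fl" "mat_tendsto m c G B fl"
  shows "mat_tendsto r c (\<lambda>z. F z * G z) (A * B) fl"
proof (rule mat_tendstoI)
  have AB: "A \<in> carrier_mat r m" "B \<in> carrier_mat m c" using assms by (auto simp: mat_tendsto_def)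
  then show "A * B \<in> carrier_mat r c" by auto
  have ev: "\<forall>\<^sub>F z in fl. F z \<in> carrier_mat r m" "\<forall>\<^sub>F z in fl. G z \<in> carrier_mat m c"
    using assms by (auto simp: mat_tendsto_def)
  then show "\<forall>\<^sub>F z in fl. F z * G z \<in> carrier_mat r c" by eventually_elim auto
  fix i j assume ij: "i < r" "j < c"
  have "((\<lambda>z. \<Sum>l<m. F z $$ (i, l) * G z $$ (l, j)) \<longlongrightarrow> (\<Sum>l<m. A $$ (i, l) * B $$ (l, j))) fl"
    using assms ij by (intro tendsto_sum tendsto_mult) (auto simp: mat_tendsto_def)
  moreover have "\<forall>\<^sub>F z in fl. (\<Sum>l<m. F z $$ (i, l) * G z $$ (l, j)) = (F z * G z) $$ (i, j)"
    using ev by eventually_elim (use ij in \<open>auto simp: scalar_prod_def atLeast0LessThan\<close>)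
  moreover have "(\<Sum>l<m. A $$ (i, l) * B $$ (l, j)) = (A * B) $$ (i, j)"
    using AB ij by (auto simp: scalar_prod_def atLeast0LessThan)
  ultimately show "((\<lambda>z. (F z * G z) $$ (i, j)) \<longlongrightarrow> (A * B) $$ (i, j)) fl"
    by (auto intro: Lim_transform_eventually)
qed

section \<open>Mutually inverse sums of simple poles\<close>

definition pole_sum :: "nat \<Rightarrow> nat \<Rightarrow> (nat \<Rightarrow> complex mat) \<Rightarrow> (nat \<Rightarrow> complex) \<Rightarrow> complex \<Rightarrow> complex mat" where
  "pole_sum n N A lam z = 1\<^sub>m n + mat_sum n (\<lambda>k. (1 / (z - lam k)) \<cdot>\<^sub>m A k) {..<N}"

lemma pole_sum_carrier [simp, intro]: "pole_sum n N A lam z \<in> carrier_mat n n"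
  by (simp add: pole_sum_def mat_sum_eq_rect_sum)

lemma pole_sum_dim [simp]:
  "dim_row (pole_sum n N A lam z) = n" "dim_col (pole_sum n N A lam z) = n"
  using pole_sum_carrier[of n N A lam z] by (blast dest: carrier_matD)+

lemma pole_sum_index:
  assumes "\<And>k. k < N \<Longrightarrow> A k \<in> carrier_mat n n" "i < n" "j < n"
  shows "pole_sum n N A lam z $$ (i, j) =
    (if i = j then 1 else 0) + (\<Sum>k<N. A k $$ (i, j) / (z - lam k))"
proof -
  have "((1 / (z - lam k)) \<cdot>\<^sub>m A k) $$ (i, j) = A k $$ (i, j) / (z - lam k)" if "k < N" for k
    using assms(1)[OF that] assms(2,3) by auto
  then show ?thesis using assms(2,3) by (simp add: pole_sum_def mat_sum_eq_rect_sum)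
qed

lemma pole_sum_transpose:
  assumes "\<And>k. k < N \<Longrightarrow> A k \<in> carrier_mat n n"
  shows "pole_sum n N (\<lambda>k. (A k)\<^sup>T) lam z = (pole_sum n N A lam z)\<^sup>T"
proof (rule eq_matI)
  fix i j assume "i < dim_row ((pole_sum n N A lam z)\<^sup>T)" "j < dim_col ((pole_sum n N A lam z)\<^sup>T)"
  then have ij: "i < n" "j < n" by auto
  have "(A k)\<^sup>T $$ (i, j) = A k $$ (j, i)" if "k < N" for k
    using assms[OF that] ij by auto
  then show "pole_sum n N (\<lambda>k. (A k)\<^sup>T) lam z $$ (i, j) = (pole_sum n N A lam z)\<^sup>T $$ (i, j)"
    using ij assms by (simp add: pole_sum_index)
qed auto

text \<open>Multiplying a sum of simple poles by \<open>z - p\<close> turns each term into such a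
  ratio; the limit is a Kronecker delta that picks out the residue at \<open>p\<close>.\<close>

lemma tendsto_ratio_at_pole:
  fixes p q :: complex
  shows "((\<lambda>z. (z - p) / (z - q)) \<longlongrightarrow> (if p = q then 1 else 0)) (at p)"
proof (cases "p = q")
  case True
  have "\<forall>\<^sub>F z in at p. z \<noteq> p" by (rule eventually_neq_at_within)
  then have "\<forall>\<^sub>F z in at p. 1 = (z - p) / (z - q)"
    by eventually_elim (use True in auto)
  then show ?thesis using True by (auto intro: Lim_transform_eventually[OF tendsto_const])
next
  case False
  have "((\<lambda>z. (z - p) / (z - q)) \<longlongrightarrow> (p - p) / (p - q)) (at p)"
    using False by (intro tendsto_intros) auto
  then show ?thesis using False by simp
qed

lemma pole_sum_tendsto_pole:
  assumes A: "\<And>k. k < N \<Longrightarrow> A k \<in> carrier_mat n n" and inj: "inj_on lam {..<N}" and l: "l < N"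
  shows "mat_tendsto n n (\<lambda>z. (z - lam l) \<cdot>\<^sub>m pole_sum n N A lam z) (A l) (at (lam l))"
proof (rule mat_tendstoI)
  fix i j assume ij: "i < n" "j < n"
  have "((\<lambda>z. (z - lam l) * (if i = j then 1 else 0) + (\<Sum>k<N. A k $$ (i, j) * ((z - lam l) / (z - lam k))))
      \<longlongrightarrow> (lam l - lam l) * (if i = j then 1 else 0) + (\<Sum>k<N. A k $$ (i, j) * (if lam l = lam k then 1 else 0)))
      (at (lam l))"
    by (intro tendsto_intros tendsto_ratio_at_pole)
  also have "(\<Sum>k<N. A k $$ (i, j) * (if lam l = lam k then 1 else 0)) = (\<Sum>k<N. if k = l then A k $$ (i, j) else 0)"
    using inj l by (intro sum.cong refl) (auto simp: inj_on_def)
  also have "\<dots> = A l $$ (i, j)" using l by simp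
  finally show "((\<lambda>z. ((z - lam l) \<cdot>\<^sub>m pole_sum n N A lam z) $$ (i, j)) \<longlongrightarrow> A l $$ (i, j)) (at (lam l))"
    using ij A by (simp add: pole_sum_index distrib_left sum_distrib_left mult_ac)
qed (use A l in auto)

lemma pole_sum_tendsto_regular:
  assumes A: "\<And>k. k < N \<Longrightarrow> A k \<in> carrier_mat n n" and w: "\<And>k. k < N \<Longrightarrow> w \<noteq> lam k"
  shows "mat_tendsto n n (pole_sum n N A lam) (pole_sum n N A lam w) (at w)"
proof (rule mat_tendstoI)
  fix i j assume ij: "i < n" "j < n"
  have "((\<lambda>z. (if i = j then 1 else 0) + (\<Sum>k<N. A k $$ (i, j) / (z - lam k)))
      \<longlongrightarrow> (if i = j then 1 else 0) + (\<Sum>k<N. A k $$ (i, j) / (w - lam k))) (at w)"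
    using w by (intro tendsto_intros) auto
  then show "((\<lambda>z. pole_sum n N A lam z $$ (i, j)) \<longlongrightarrow> pole_sum n N A lam w $$ (i, j)) (at w)"
    using ij A by (simp add: pole_sum_index)
qed auto

lemma eventually_not_in_finite_range:
  fixes f :: "nat \<Rightarrow> complex"
  shows "\<forall>\<^sub>F z in at p. \<forall>k<N. z \<noteq> f k"
proof -
  have "\<forall>\<^sub>F z in at p. \<forall>k\<in>{..<N}. z \<noteq> f k"
    by (intro eventually_ball_finite) (auto intro: eventually_neq_at_within)
  then show ?thesis by (rule eventually_mono) auto
qed

text \<open>The situation at one point x after cancelling \<open>\<N>\<close>: \<open>F\<close> and
  \<open>E\<close> are the pole sums of D and of its inverse, and they are mutually inverse away
  from all poles.\<close>

locale pole_sum_pair =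
  fixes n N :: nat and A B :: "nat \<Rightarrow> complex mat" and lam mu :: "nat \<Rightarrow> complex"
  assumes A: "\<And>k. k < N \<Longrightarrow> A k \<in> carrier_mat n n"
    and B: "\<And>k. k < N \<Longrightarrow> B k \<in> carrier_mat n n"
    and inj: "inj_on lam {..<N}" "inj_on mu {..<N}"
    and lam_mu: "\<And>k j. k < N \<Longrightarrow> j < N \<Longrightarrow> lam k \<noteq> mu j"
    and inverse: "\<And>z. \<forall>k<N. z \<noteq> lam k \<and> z \<noteq> mu k \<Longrightarrow> pole_sum n N A lam z * pole_sum n N B mu z = 1\<^sub>m n"
      "\<And>z. \<forall>k<N. z \<noteq> lam k \<and> z \<noteq> mu k \<Longrightarrow> pole_sum n N B mu z * pole_sum n N A lam z = 1\<^sub>m n"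
begin

abbreviation "F \<equiv> pole_sum n N A lam"
abbreviation "E \<equiv> pole_sum n N B mu"

lemma eventually_regular: "\<forall>\<^sub>F z in at p. \<forall>k<N. z \<noteq> lam k \<and> z \<noteq> mu k"
  using eventually_conj[OF eventually_not_in_finite_range[of N lam p] eventually_not_in_finite_range[of N mu p]]
  by (rule eventually_mono) auto

text \<open>Transposition reverses products, so a statement about the rows of \<open>A\<close> at
  \<open>lam\<close> becomes one about the columns of \<open>B\<close> at \<open>mu\<close>.\<close>

lemma dual: "pole_sum_pair n N (\<lambda>k. (B k)\<^sup>T) (\<lambda>k. (A k)\<^sup>T) mu lam"
proof
  fix z assume z: "\<forall>k<N. z \<noteq> mu k \<and> z \<noteq> lam k"
  then have *: "F z * E z = 1\<^sub>m n" "E z * F z = 1\<^sub>m n" by (auto intro!: inverse)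
  show "pole_sum n N (\<lambda>k. (B k)\<^sup>T) mu z * pole_sum n N (\<lambda>k. (A k)\<^sup>T) lam z = 1\<^sub>m n"
    using arg_cong[OF *(1), of transpose_mat] transpose_mult[of "F z" n n "E z" n]
    by (simp add: pole_sum_transpose A B)
  show "pole_sum n N (\<lambda>k. (A k)\<^sup>T) lam z * pole_sum n N (\<lambda>k. (B k)\<^sup>T) mu z = 1\<^sub>m n"
    using arg_cong[OF *(2), of transpose_mat] transpose_mult[of "E z" n n "F z" n]
    by (simp add: pole_sum_transpose A B)
qed (use A B inj lam_mu in \<open>auto dest: sym\<close>)

text \<open>\<open>E\<close> is regular at \<open>lam l\<close>, where \<open>F\<close> has a simple
  pole with residue \<open>A l\<close>. Multiplied by \<open>z - lam l\<close>, the products F E and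
  E F tend to the two left-hand sides, while the identity tends to 0.\<close>

lemma residue_mult_zero:
  assumes l: "l < N"
  shows "A l * E (lam l) = 0\<^sub>m n n" "E (lam l) * A l = 0\<^sub>m n n"
proof -
  have F: "mat_tendsto n n (\<lambda>z. (z - lam l) \<cdot>\<^sub>m F z) (A l) (at (lam l))"
    using A inj(1) l by (rule pole_sum_tendsto_pole)
  have E: "mat_tendsto n n E (E (lam l)) (at (lam l))"
    using B by (rule pole_sum_tendsto_regular) (use lam_mu l in auto)
  have "((\<lambda>z. z - lam l) \<longlongrightarrow> lam l - lam l) (at (lam l))" by (intro tendsto_intros)
  then have "mat_tendsto n n (\<lambda>z. (z - lam l) \<cdot>\<^sub>m 1\<^sub>m n) ((lam l - lam l) \<cdot>\<^sub>m 1\<^sub>m n) (at (lam l))"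
    by (rule mat_tendsto_smult) (simp add: mat_tendsto_const)
  also have "(lam l - lam l) \<cdot>\<^sub>m 1\<^sub>m n = 0\<^sub>m n n" by (intro eq_matI) auto
  finally have Z: "mat_tendsto n n (\<lambda>z. (z - lam l) \<cdot>\<^sub>m 1\<^sub>m n) (0\<^sub>m n n) (at (lam l))" .
  have 1: "\<forall>\<^sub>F z in at (lam l). (z - lam l) \<cdot>\<^sub>m F z * E z = (z - lam l) \<cdot>\<^sub>m 1\<^sub>m n"
    using eventually_regular
    by eventually_elim (simp add: mult_smult_assoc_mat[OF pole_sum_carrier pole_sum_carrier] inverse)
  show "A l * E (lam l) = 0\<^sub>m n n"
    using mat_tendsto_cong[OF mat_tendsto_mult[OF F E] 1] Z
    by (rule mat_tendsto_unique) simp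
  have 2: "\<forall>\<^sub>F z in at (lam l). E z * ((z - lam l) \<cdot>\<^sub>m F z) = (z - lam l) \<cdot>\<^sub>m 1\<^sub>m n"
    using eventually_regular
    by eventually_elim (simp add: mult_smult_distrib[OF pole_sum_carrier pole_sum_carrier] inverse)
  show "E (lam l) * A l = 0\<^sub>m n n"
    using mat_tendsto_cong[OF mat_tendsto_mult[OF E F] 2] Z
    by (rule mat_tendsto_unique) simp
qed

text \<open>This is (E(lam_k) - E(z)) / (z - lam_k), up to sign the divided difference of
  \<open>E\<close>. It is written in partial fractions so that its value at \<open>z = lam k\<close>
  is already the continuous extension.\<close>

definition divided_difference :: "nat \<Rightarrow> complex \<Rightarrow> complex mat" where
  "divided_difference k z = mat_sum n (\<lambda>j. (1 / ((lam k - mu j) * (z - mu j))) \<cdot>\<^sub>m B j) {..<N}"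

lemma divided_difference_carrier [simp, intro]: "divided_difference k z \<in> carrier_mat n n"
  by (simp add: divided_difference_def mat_sum_eq_rect_sum)

lemma divided_difference_dim [simp]:
  "dim_row (divided_difference k z) = n" "dim_col (divided_difference k z) = n"
  by (simp_all add: divided_difference_def mat_sum_eq_rect_sum)

lemma divided_difference_index:
  assumes "i < n" "j < n"
  shows "divided_difference k z $$ (i, j) = (\<Sum>p<N. B p $$ (i, j) / ((lam k - mu p) * (z - mu p)))"
proof -
  have "((1 / ((lam k - mu p) * (z - mu p))) \<cdot>\<^sub>m B p) $$ (i, j) = B p $$ (i, j) / ((lam k - mu p) * (z - mu p))"
    if "p < N" for p using B[OF that] assms by auto
  then show ?thesis using assms by (simp add: divided_difference_def mat_sum_eq_rect_sum)
qed

lemma divided_difference_eq: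
  assumes k: "k < N" and z: "\<forall>j<N. z \<noteq> mu j" "z \<noteq> lam k"
  shows "divided_difference k z = (1 / (z - lam k)) \<cdot>\<^sub>m (E (lam k) - E z)"
proof (rule eq_matI)
  fix i j assume "i < dim_row ((1 / (z - lam k)) \<cdot>\<^sub>m (E (lam k) - E z))"
    "j < dim_col ((1 / (z - lam k)) \<cdot>\<^sub>m (E (lam k) - E z))"
  then have ij: "i < n" "j < n" by auto
  have "(1 / (z - lam k)) * ((\<Sum>p<N. B p $$ (i, j) / (lam k - mu p)) - (\<Sum>p<N. B p $$ (i, j) / (z - mu p)))
     = (\<Sum>p<N. B p $$ (i, j) / ((lam k - mu p) * (z - mu p)))"
    unfolding sum_subtractf[symmetric] sum_distrib_left
  proof (intro sum.cong refl)
    fix p assume "p \<in> {..<N}"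
    then have "lam k - mu p \<noteq> 0" "z - mu p \<noteq> 0" "z - lam k \<noteq> 0"
      using lam_mu[OF k, of p] z by auto
    then show "1 / (z - lam k) * (B p $$ (i, j) / (lam k - mu p) - B p $$ (i, j) / (z - mu p))
      = B p $$ (i, j) / ((lam k - mu p) * (z - mu p))"
      by (simp add: divide_simps) (simp add: algebra_simps)
  qed
  then show "divided_difference k z $$ (i, j) = ((1 / (z - lam k)) \<cdot>\<^sub>m (E (lam k) - E z)) $$ (i, j)"
    using ij B by (simp add: divided_difference_index pole_sum_index)
qed auto

text \<open>With S = \<open>divided_difference k\<close>, the assumption V E(lam_k) = 0 gives V S(z)
  = - V E(z) / (z - lam_k), hence V S(z) F(z) = - V / (z - lam_k). Both sides are compared through
  their residues at \<open>lam l\<close>: S is regular there, so the left one is V S(lam_l) A_l, and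
  the right one vanishes unless k = l.\<close>

lemma mult_divided_difference_residue:
  assumes k: "k < N" and l: "l < N" and V: "V \<in> carrier_mat m n" and VE: "V * E (lam k) = 0\<^sub>m m n"
  shows "V * divided_difference k (lam l) * A l = (if k = l then - V else 0\<^sub>m m n)"
proof -
  let ?S = "divided_difference k"
  have F: "mat_tendsto n n (\<lambda>z. (z - lam l) \<cdot>\<^sub>m F z) (A l) (at (lam l))"
    using A inj(1) l by (rule pole_sum_tendsto_pole)
  have S: "mat_tendsto n n ?S (?S (lam l)) (at (lam l))"
  proof (rule mat_tendstoI)
    fix i j assume ij: "i < n" "j < n"
    have "((\<lambda>z. \<Sum>p<N. B p $$ (i, j) / ((lam k - mu p) * (z - mu p)))
       \<longlongrightarrow> (\<Sum>p<N. B p $$ (i, j) / ((lam k - mu p) * (lam l - mu p)))) (at (lam l))"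
      using lam_mu k l by (intro tendsto_intros) auto
    then show "((\<lambda>z. ?S z $$ (i, j)) \<longlongrightarrow> ?S (lam l) $$ (i, j)) (at (lam l))"
      using ij by (simp add: divided_difference_index)
  qed auto
  have "mat_tendsto m n (\<lambda>z. V * ?S z * ((z - lam l) \<cdot>\<^sub>m F z)) (V * ?S (lam l) * A l) (at (lam l))"
    by (intro mat_tendsto_mult[of _ n] mat_tendsto_const V S F)
  moreover have "\<forall>\<^sub>F z in at (lam l). V * ?S z * ((z - lam l) \<cdot>\<^sub>m F z) = ((z - lam l) / (z - lam k)) \<cdot>\<^sub>m (- V)"
    using eventually_regular
  proof eventually_elim
    case (elim z)
    have "V * (E (lam k) - E z) = - (V * E z)"
      using V by (simp add: mult_minus_distrib_mat[OF V pole_sum_carrier pole_sum_carrier] VE)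
        (intro eq_matI, auto)
    then have "V * ?S z = (1 / (z - lam k)) \<cdot>\<^sub>m (- (V * E z))"
      using elim k V by (simp add: divided_difference_eq mult_smult_distrib[OF V minus_carrier_mat[OF pole_sum_carrier]])
    then have "V * ?S z * ((z - lam l) \<cdot>\<^sub>m F z) = (1 / (z - lam k)) \<cdot>\<^sub>m ((z - lam l) \<cdot>\<^sub>m (- (V * E z) * F z))"
      using V by (simp add: mult_smult_assoc_mat[of _ m n _ n] mult_smult_distrib[of _ m n _ n]
        del: uminus_mult_left_mat) (intro eq_matI, auto)
    also have "- (V * E z) * F z = - V"
    proof -
      have "- (V * E z) * F z = - (V * E z * F z)" using V by (subst uminus_mult_left_mat) auto
      also have "V * E z * F z = V" using V elim by (simp add: mult_mat_assoc inverse)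
      finally show ?thesis .
    qed
    finally show ?case using V by (intro eq_matI) auto
  qed
  ultimately have 1: "mat_tendsto m n (\<lambda>z. ((z - lam l) / (z - lam k)) \<cdot>\<^sub>m (- V)) (V * ?S (lam l) * A l) (at (lam l))"
    by (rule mat_tendsto_cong)
  have 2: "mat_tendsto m n (\<lambda>z. ((z - lam l) / (z - lam k)) \<cdot>\<^sub>m (- V))
      ((if lam l = lam k then 1 else 0) \<cdot>\<^sub>m (- V)) (at (lam l))"
    using V by (intro mat_tendsto_smult tendsto_ratio_at_pole mat_tendsto_const) auto
  have "lam l = lam k \<longleftrightarrow> k = l" using inj(1) k l by (auto simp: inj_on_def)
  moreover have "V * ?S (lam l) * A l = (if lam l = lam k then 1 else 0) \<cdot>\<^sub>m (- V)"
    using 1 2 by (rule mat_tendsto_unique) simp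
  ultimately show ?thesis using V by (auto intro!: eq_matI)
qed

text \<open>The case k = l of the residue identity, which writes V explicitly as a multiple of
  \<open>A k\<close>.\<close>

lemma kernel_in_row_space:
  assumes "k < N" "V \<in> carrier_mat m n" "V * E (lam k) = 0\<^sub>m m n"
  obtains X where "X \<in> carrier_mat m n" "V = X * A k"
proof
  show "- (V * divided_difference k (lam k)) \<in> carrier_mat m n" using assms by auto
  have "V = - (V * divided_difference k (lam k) * A k)"
    using mult_divided_difference_residue[OF assms(1,1,2,3)] assms(2) by (auto intro!: eq_matI)
  then show "V = - (V * divided_difference k (lam k)) * A k"
    using assms A[OF assms(1)] by (subst uminus_mult_left_mat) auto
qed

end

section \<open>The inverse of the block Cauchy matrix\<close>

lemma block_sum_mult:
  assumes "X \<in> carrier_mat p n" "Y \<in> carrier_mat n q" "\<And>j. j \<in> I \<Longrightarrow> G j \<in> carrier_mat n n"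
  shows "X * mat_sum n G I * Y = rect_sum p q (\<lambda>j. X * G j * Y) I"
  using assms by (simp add: mat_sum_eq_rect_sum mult_rect_sum[of X p n] rect_sum_mult[of Y n q I _ p])

definition cauchy_block ::
  "(nat \<Rightarrow> complex) \<Rightarrow> (nat \<Rightarrow> complex) \<Rightarrow> (nat \<Rightarrow> complex mat) \<Rightarrow> (nat \<Rightarrow> complex mat)
    \<Rightarrow> nat \<Rightarrow> nat \<Rightarrow> complex mat" where
  "cauchy_block lam mu a b k j = (1 / (lam k - mu j)) \<cdot>\<^sub>m (a k * b j)"

context pole_sum_pair begin

lemma residue_mult_zero_dual:
  assumes l: "l < N"
  shows "B l * F (mu l) = 0\<^sub>m n n" "F (mu l) * B l = 0\<^sub>m n n"
proof -
  interpret d: pole_sum_pair n N "\<lambda>k. (B k)\<^sup>T" "\<lambda>k. (A k)\<^sup>T" mu lam by (rule dual)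
  have "(F (mu l) * B l)\<^sup>T = 0\<^sub>m n n" "(B l * F (mu l))\<^sup>T = 0\<^sub>m n n"
    using d.residue_mult_zero[OF l] B[OF l] A
    by (simp_all add: pole_sum_transpose transpose_mult[of _ n n _ n])
  then show "B l * F (mu l) = 0\<^sub>m n n" "F (mu l) * B l = 0\<^sub>m n n"
    by (metis transpose_transpose zero_transpose_mat)+
qed

text \<open>The transpose of \<open>mult_divided_difference_residue\<close> for the dual pair. The
  sum in the middle is the divided difference of \<open>F\<close> at \<open>mu k\<close> and
  \<open>mu l\<close>, again up to sign; it is symmetric in k and l.\<close>

lemma residue_mult_divided_difference:
  assumes k: "k < N" and l: "l < N" and V: "V \<in> carrier_mat n m" and FV: "F (mu k) * V = 0\<^sub>m n m"
  shows "B l * mat_sum n (\<lambda>j. (1 / ((mu k - lam j) * (mu l - lam j))) \<cdot>\<^sub>m A j) {..<N} * V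
    = (if k = l then - V else 0\<^sub>m n m)"
proof -
  interpret d: pole_sum_pair n N "\<lambda>k. (B k)\<^sup>T" "\<lambda>k. (A k)\<^sup>T" mu lam by (rule dual)
  let ?X = "mat_sum n (\<lambda>j. (1 / ((mu k - lam j) * (mu l - lam j))) \<cdot>\<^sub>m A j) {..<N}"
  have X: "?X \<in> carrier_mat n n" by (simp add: mat_sum_eq_rect_sum)
  have D: "d.divided_difference k (mu l) = ?X\<^sup>T"
  proof (rule eq_matI)
    fix i j assume "i < dim_row (?X\<^sup>T)" "j < dim_col (?X\<^sup>T)"
    then have ij: "i < n" "j < n" using X by auto
    have "(A p)\<^sup>T $$ (i, j) = A p $$ (j, i)" "(c \<cdot>\<^sub>m A p) $$ (j, i) = c * A p $$ (j, i)" if "p < N" for p c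
      using A[OF that] ij by auto
    then show "d.divided_difference k (mu l) $$ (i, j) = ?X\<^sup>T $$ (i, j)"
      using ij X by (simp add: d.divided_difference_index mat_sum_eq_rect_sum)
  qed (use X in auto)
  have VT: "V\<^sup>T \<in> carrier_mat m n" using V by simp
  have "V\<^sup>T * pole_sum n N (\<lambda>k. (A k)\<^sup>T) lam (mu k) = (F (mu k) * V)\<^sup>T"
    using V A by (simp add: pole_sum_transpose transpose_mult[of _ n n _ m])
  then have "V\<^sup>T * pole_sum n N (\<lambda>k. (A k)\<^sup>T) lam (mu k) = 0\<^sub>m m n" by (simp add: FV)
  from d.mult_divided_difference_residue[OF k l VT this]
  have *: "V\<^sup>T * ?X\<^sup>T * (B l)\<^sup>T = (if k = l then - V\<^sup>T else 0\<^sub>m m n)" unfolding D .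
  have "(B l * ?X * V)\<^sup>T = V\<^sup>T * ?X\<^sup>T * (B l)\<^sup>T"
  proof -
    have "(B l * ?X * V)\<^sup>T = V\<^sup>T * (B l * ?X)\<^sup>T"
      using B[OF l] X V by (intro transpose_mult[of _ n n _ m]) auto
    also have "(B l * ?X)\<^sup>T = ?X\<^sup>T * (B l)\<^sup>T" using B[OF l] X by (rule transpose_mult)
    finally show ?thesis using V X B[OF l] by (simp add: mult_mat_assoc)
  qed
  then have "((B l * ?X * V)\<^sup>T)\<^sup>T = (if k = l then - V\<^sup>T else 0\<^sub>m m n)\<^sup>T" using * by simp
  also have "\<dots> = (if k = l then - V else 0\<^sub>m n m)" using V by (auto intro!: eq_matI)
  finally show ?thesis by simp
qed

lemma kernel_in_col_space:
  assumes "k < N" "V \<in> carrier_mat n m" "F (mu k) * V = 0\<^sub>m n m"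
  obtains X where "X \<in> carrier_mat n m" "V = B k * X"
proof
  let ?S = "mat_sum n (\<lambda>j. (1 / ((mu k - lam j) * (mu k - lam j))) \<cdot>\<^sub>m A j) {..<N}"
  have S: "?S \<in> carrier_mat n n" by (simp add: mat_sum_eq_rect_sum)
  then show "- (?S * V) \<in> carrier_mat n m" using assms by auto
  have "V = - (B k * ?S * V)"
    using residue_mult_divided_difference[OF assms(1,1,2,3)] assms(2) by (auto intro!: eq_matI)
  also have "\<dots> = - (B k * (?S * V))" using S B[OF assms(1)] assms(2) by (simp add: mult_mat_assoc)
  finally show "V = B k * - (?S * V)"
    using assms B[OF assms(1)] S by (subst uminus_mult_right_mat) auto
qed

context
  fixes a b P Q :: "nat \<Rightarrow> complex mat" and rA rB :: "nat \<Rightarrow> nat"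
  assumes a: "\<And>k. k < N \<Longrightarrow> has_right_inverse (rA k) n (a k)"
    and P: "\<And>k. k < N \<Longrightarrow> has_left_inverse n (rA k) (P k)"
    and A_eq: "\<And>k. k < N \<Longrightarrow> A k = P k * a k"
    and b: "\<And>k. k < N \<Longrightarrow> has_left_inverse n (rB k) (b k)"
    and Q: "\<And>k. k < N \<Longrightarrow> has_right_inverse (rB k) n (Q k)"
    and B_eq: "\<And>k. k < N \<Longrightarrow> B k = b k * Q k"
begin

lemma factor_carriers:
  assumes "k < N"
  shows "a k \<in> carrier_mat (rA k) n" "P k \<in> carrier_mat n (rA k)"
    "b k \<in> carrier_mat n (rB k)" "Q k \<in> carrier_mat (rB k) n"
  using a[OF assms] b[OF assms] P[OF assms] Q[OF assms]
  by (auto simp: has_left_inverse_def has_right_inverse_def)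

abbreviation "M_block \<equiv> cauchy_block lam mu a b"

definition K_block :: "nat \<Rightarrow> nat \<Rightarrow> complex mat" where
  "K_block j k = (- 1 / (lam k - mu j)) \<cdot>\<^sub>m (Q j * P k)"

lemma M_block_carrier: "k < N \<Longrightarrow> j < N \<Longrightarrow> M_block k j \<in> carrier_mat (rA k) (rB j)"
  using factor_carriers[of k] factor_carriers[of j] by (auto simp: cauchy_block_def)

lemma K_block_carrier: "k < N \<Longrightarrow> j < N \<Longrightarrow> K_block j k \<in> carrier_mat (rB j) (rA k)"
  using factor_carriers[of k] factor_carriers[of j] by (auto simp: K_block_def)

text \<open>As b_j Q_j = B_j, the sum over j is - a_k S P_l with S =
  \<open>divided_difference k (lam l)\<close>. The residue identity for V = a_k evaluates a_k S A_l,
  and a right inverse of a_l reduces A_l = P_l a_l to P_l.\<close>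

lemma M_mult_K:
  assumes k: "k < N" and l: "l < N"
  shows "rect_sum (rA k) (rA l) (\<lambda>j. M_block k j * K_block j l) {..<N}
    = (if k = l then 1\<^sub>m (rA k) else 0\<^sub>m (rA k) (rA l))"
proof -
  note c = factor_carriers[OF k] factor_carriers[OF l]
  obtain R where R: "R \<in> carrier_mat n (rA l)" "a l * R = 1\<^sub>m (rA l)"
    using a[OF l] by (rule has_right_inverseE)
  \<comment> \<open>Cancelling the left-invertible \<open>P k\<close> from A_k E(lam_k) = 0 shows
    that a_k itself satisfies the hypothesis on V in the residue identity.\<close>
  have "P k * (a k * E (lam k)) = 0\<^sub>m n n"
    using residue_mult_zero(1)[OF k] c by (simp add: A_eq k mult_mat_assoc)
  then have aE: "a k * E (lam k) = 0\<^sub>m (rA k) n"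
    using c by (intro left_cancel_zero[OF P[OF k]]) auto
  have "a k * divided_difference k (lam l) * P l = a k * divided_difference k (lam l) * A l * R"
    using c R by (simp add: A_eq l mult_mat_assoc)
  also have "\<dots> = (if k = l then - (1\<^sub>m (rA k)) else 0\<^sub>m (rA k) (rA l))"
    using mult_divided_difference_residue[OF k l c(1) aE] c(1) R by auto
  finally have S: "a k * divided_difference k (lam l) * P l = \<dots>" .
  have "rect_sum (rA k) (rA l) (\<lambda>j. M_block k j * K_block j l) {..<N}
    = - (a k * divided_difference k (lam l) * P l)"
  proof (rule eq_matI)
    fix i i' assume "i < dim_row (- (a k * divided_difference k (lam l) * P l))"
      "i' < dim_col (- (a k * divided_difference k (lam l) * P l))"
    then have ii: "i < rA k" "i' < rA l" using c by auto
    have "(M_block k j * K_block j l) $$ (i, i')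
      = - (a k * ((1 / ((lam k - mu j) * (lam l - mu j))) \<cdot>\<^sub>m B j) * P l) $$ (i, i')" if j: "j < N" for j
    proof -
      note cj = factor_carriers[OF j]
      have "M_block k j * K_block j l
        = (1 / (lam k - mu j)) \<cdot>\<^sub>m ((- 1 / (lam l - mu j)) \<cdot>\<^sub>m (a k * b j * (Q j * P l)))"
        unfolding cauchy_block_def K_block_def using c cj
        by (subst mult_smult_assoc_mat[of _ "rA k" "rB j" _ "rA l"], auto)
      moreover have "a k * ((1 / ((lam k - mu j) * (lam l - mu j))) \<cdot>\<^sub>m B j) * P l
        = (1 / ((lam k - mu j) * (lam l - mu j))) \<cdot>\<^sub>m (a k * b j * (Q j * P l))"
        using c cj B[OF j] by (simp add: B_eq j mult_mat_assoc mult_smult_distrib[of _ "rA k" n _ n]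
            mult_smult_assoc_mat[of _ "rA k" n _ "rA l"])
      ultimately show ?thesis using ii c cj by simp
    qed
    moreover have "(a k * divided_difference k (lam l) * P l) $$ (i, i')
      = (\<Sum>j<N. (a k * ((1 / ((lam k - mu j) * (lam l - mu j))) \<cdot>\<^sub>m B j) * P l) $$ (i, i'))"
      unfolding divided_difference_def using ii c B
      by (subst block_sum_mult[of _ "rA k" n _ "rA l"]) (auto simp del: index_mult_mat)
    ultimately show "rect_sum (rA k) (rA l) (\<lambda>j. M_block k j * K_block j l) {..<N} $$ (i, i')
      = (- (a k * divided_difference k (lam l) * P l)) $$ (i, i')"
      using ii c by (simp add: sum_negf del: index_mult_mat(1))
  qed (use c in auto)
  then show ?thesis unfolding S by (auto intro!: eq_matI)
qed

text \<open>Now P_j a_j = A_j stands in the middle, so the sum is a divided difference of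
  \<open>F\<close>, and the dual residue identity applies to V = b_l. A left inverse of b_k reduces
  B_k = b_k Q_k to Q_k.\<close>

lemma K_mult_M:
  assumes k: "k < N" and l: "l < N"
  shows "rect_sum (rB k) (rB l) (\<lambda>j. K_block k j * M_block j l) {..<N}
    = (if k = l then 1\<^sub>m (rB k) else 0\<^sub>m (rB k) (rB l))"
proof -
  note c = factor_carriers[OF k] factor_carriers[OF l]
  let ?S = "mat_sum n (\<lambda>j. (1 / ((mu l - lam j) * (mu k - lam j))) \<cdot>\<^sub>m A j) {..<N}"
  have Sc: "?S \<in> carrier_mat n n" by (simp add: mat_sum_eq_rect_sum)
  obtain R where R: "R \<in> carrier_mat (rB k) n" "R * b k = 1\<^sub>m (rB k)"
    using b[OF k] by (rule has_left_inverseE)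
  have "F (mu l) * b l * Q l = 0\<^sub>m n n"
    using residue_mult_zero_dual(2)[OF l] c by (simp add: B_eq l mult_mat_assoc)
  then have Fb: "F (mu l) * b l = 0\<^sub>m n (rB l)"
    using c by (intro right_cancel_zero[OF Q[OF l]]) auto
  have "Q k * ?S * b l = R * (B k * ?S * b l)"
    using c R Sc by (simp add: B_eq k mult_mat_assoc mult_mat_cancel)
  also have "\<dots> = (if k = l then - (1\<^sub>m (rB k)) else 0\<^sub>m (rB k) (rB l))"
    using residue_mult_divided_difference[OF l k c(7) Fb] c R by auto
  finally have S: "Q k * ?S * b l = \<dots>" .
  have "rect_sum (rB k) (rB l) (\<lambda>j. K_block k j * M_block j l) {..<N} = - (Q k * ?S * b l)"
  proof (rule eq_matI)
    fix i i' assume "i < dim_row (- (Q k * ?S * b l))" "i' < dim_col (- (Q k * ?S * b l))"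
    then have ii: "i < rB k" "i' < rB l" using c by auto
    have "(K_block k j * M_block j l) $$ (i, i')
      = - (Q k * ((1 / ((mu l - lam j) * (mu k - lam j))) \<cdot>\<^sub>m A j) * b l) $$ (i, i')" if j: "j < N" for j
    proof -
      note cj = factor_carriers[OF j]
      have "K_block k j * M_block j l
        = (- 1 / (lam j - mu k)) \<cdot>\<^sub>m ((1 / (lam j - mu l)) \<cdot>\<^sub>m (Q k * P j * (a j * b l)))"
        unfolding cauchy_block_def K_block_def using c cj
        by (subst mult_smult_assoc_mat[of _ "rB k" "rA j" _ "rB l"], auto)
      moreover have "Q k * ((1 / ((mu l - lam j) * (mu k - lam j))) \<cdot>\<^sub>m A j) * b l
        = (1 / ((mu l - lam j) * (mu k - lam j))) \<cdot>\<^sub>m (Q k * P j * (a j * b l))"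
        using c cj A[OF j] by (simp add: A_eq j mult_mat_assoc mult_smult_distrib[of _ "rB k" n _ n]
            mult_smult_assoc_mat[of _ "rB k" n _ "rB l"])
      moreover have "(mu l - lam j) * (mu k - lam j) = (lam j - mu k) * (lam j - mu l)"
        by (simp add: algebra_simps)
      ultimately show ?thesis using ii c cj by simp
    qed
    moreover have "(Q k * ?S * b l) $$ (i, i')
      = (\<Sum>j<N. (Q k * ((1 / ((mu l - lam j) * (mu k - lam j))) \<cdot>\<^sub>m A j) * b l) $$ (i, i'))"
      using ii c A by (subst block_sum_mult[of _ "rB k" n _ "rB l"]) (auto simp del: index_mult_mat)
    ultimately show "rect_sum (rB k) (rB l) (\<lambda>j. K_block k j * M_block j l) {..<N} $$ (i, i')
      = (- (Q k * ?S * b l)) $$ (i, i')"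
      using ii c by (simp add: sum_negf del: index_mult_mat(1))
  qed (use c in auto)
  then show ?thesis unfolding S by (auto intro!: eq_matI)
qed

lemma block_matrix_inverse:
  "invertible_mat (block_mat N rA rB M_block)"
  "matinv (block_mat N rA rB M_block) = block_mat N rB rA K_block"
proof -
  let ?M = "block_mat N rA rB M_block" and ?K = "block_mat N rB rA K_block"
  have MK: "?M * ?K = 1\<^sub>m (block_start rA N)"
    by (rule block_mat_mult_eq_one[OF M_block_carrier K_block_carrier M_mult_K])
  have KM: "?K * ?M = 1\<^sub>m (block_start rB N)"
    by (rule block_mat_mult_eq_one[OF K_block_carrier M_block_carrier K_mult_M])
  \<comment> \<open>Squareness is a consequence of the two product identities; only now can
    \<open>matinv\<close> and \<open>invertible_mat\<close> be applied.\<close>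
  have eq: "block_start rA N = block_start rB N"
    by (rule two_sided_inverse_dims[OF block_mat_carrier block_mat_carrier MK KM])
  have M: "?M \<in> carrier_mat (block_start rA N) (block_start rA N)"
    and K: "?K \<in> carrier_mat (block_start rA N) (block_start rA N)"
    using block_mat_carrier[of N rA rB M_block] block_mat_carrier[of N rB rA K_block] eq by auto
  show "matinv ?M = ?K" by (rule matinv_eq[OF M K MK])
  show "invertible_mat ?M"
    using M K MK KM unfolding invertible_mat_def inverts_mat_def by (auto simp: eq)
qed

text \<open>Each term b_j K_jk a_k is - B_j A_k / (lam_k - mu_j). Summing over j gives - (E(lam_k) -
  1) A_k, which is A_k because E(lam_k) A_k = 0; summing over k gives B_j (F(mu_j) - 1), which is -
  B_j because B_j F(mu_j) = 0.\<close>

lemma residues_from_blocks: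
  defines "K \<equiv> block rB rA (matinv (block_mat N rA rB M_block))"
  shows "k < N \<Longrightarrow> mat_sum n (\<lambda>j. b j * K j k * a k) {..<N} = A k"
    and "j < N \<Longrightarrow> mat_sum n (\<lambda>k. b j * K j k * a k) {..<N} = - B j"
proof -
  have K: "K j k = K_block j k" if "j < N" "k < N" for j k
    unfolding K_def block_matrix_inverse(2) using that by (simp add: block_block_mat K_block_carrier)
  have bKa: "b j * K j k * a k = (- 1 / (lam k - mu j)) \<cdot>\<^sub>m (B j * A k)" if "j < N" "k < N" for j k
  proof -
    note c = factor_carriers[OF that(1)] factor_carriers[OF that(2)]
    show ?thesis
      using that c by (simp add: K K_block_def A_eq B_eq mult_mat_assoc mult_smult_distrib[of _ n "rB j" _ "rA k"]
        mult_smult_assoc_mat[of _ n "rA k" _ n])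
  qed
  show "mat_sum n (\<lambda>j. b j * K j k * a k) {..<N} = A k" if k: "k < N"
  proof -
    have Ec: "E (lam k) - 1\<^sub>m n = mat_sum n (\<lambda>j. (1 / (lam k - mu j)) \<cdot>\<^sub>m B j) {..<N}"
      by (auto simp: pole_sum_def mat_sum_eq_rect_sum intro!: eq_matI)
    have "mat_sum n (\<lambda>j. b j * K j k * a k) {..<N} = - ((E (lam k) - 1\<^sub>m n) * A k)"
      unfolding Ec mat_sum_eq_rect_sum
      using A[OF k] B k
      by (subst rect_sum_mult[of _ n n]) (auto simp: bKa mult_smult_assoc_mat[of _ n n _ n]
          sum_negf[symmetric] carrier_matD[OF B] intro!: eq_matI sum.cong)
    also have "(E (lam k) - 1\<^sub>m n) * A k = E (lam k) * A k - A k"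
      using A[OF k] by (subst minus_mult_distrib_mat[of _ n n]) auto
    also have "- (E (lam k) * A k - A k) = A k"
      unfolding residue_mult_zero(2)[OF k] using A[OF k] by (auto intro!: eq_matI)
    finally show ?thesis .
  qed
  show "mat_sum n (\<lambda>k. b j * K j k * a k) {..<N} = - B j" if j: "j < N"
  proof -
    have Fc: "F (mu j) - 1\<^sub>m n = mat_sum n (\<lambda>k. (1 / (mu j - lam k)) \<cdot>\<^sub>m A k) {..<N}"
      by (auto simp: pole_sum_def mat_sum_eq_rect_sum intro!: eq_matI)
    have neg: "- (1 / (lam k - mu j)) = 1 / (mu j - lam k)" for k
      using minus_divide_right[of 1 "lam k - mu j"] by simp
    have "mat_sum n (\<lambda>k. b j * K j k * a k) {..<N} = B j * (F (mu j) - 1\<^sub>m n)"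
      unfolding Fc mat_sum_eq_rect_sum
      using A B[OF j] j
      by (subst mult_rect_sum[of _ n n]) (auto simp: bKa neg mult_smult_distrib[of _ n n _ n] intro!: rect_sum_cong)
    also have "\<dots> = B j * F (mu j) - B j"
      using B[OF j] by (subst mult_minus_distrib_mat[of _ n n]) auto
    also have "\<dots> = - B j"
      unfolding residue_mult_zero_dual(1)[OF j] using B[OF j] by (auto intro!: eq_matI)
    finally show ?thesis .
  qed
qed

text \<open>Valid for every z, poles included, since both sides contain the same coefficients
  \<open>1 / (z - lam k)\<close> or \<open>1 / (z - mu j)\<close> and hence the same default value
  of a division by zero.\<close>

lemma pole_sum_from_blocks:
  defines "K \<equiv> block rB rA (matinv (block_mat N rA rB M_block))"
  shows "F z = 1\<^sub>m n + mat_sum n (\<lambda>k. mat_sum n (\<lambda>j.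
      (1 / (z - lam k)) \<cdot>\<^sub>m (b j * K j k * a k)) {..<N}) {..<N}"
    and "E z = 1\<^sub>m n - mat_sum n (\<lambda>k. mat_sum n (\<lambda>j.
      (1 / (z - mu j)) \<cdot>\<^sub>m (b j * K j k * a k)) {..<N}) {..<N}"
proof -
  have c: "dim_row (b j * K j k * a k) = n" "dim_col (b j * K j k * a k) = n" if "j < N" "k < N" for j k
    using factor_carriers[OF that(1)] factor_carriers[OF that(2)] by auto
  have A_ij: "(\<Sum>p<N. (b p * K p k * a k) $$ (i, j)) = A k $$ (i, j)" if "k < N" "i < n" "j < n" for k i j
    using arg_cong[OF residues_from_blocks(1)[OF that(1)], of "\<lambda>X. X $$ (i, j)"] that
    unfolding K_def by (simp add: mat_sum_eq_rect_sum)
  have B_ij: "(\<Sum>k<N. (b p * K p k * a k) $$ (i, j)) = - B p $$ (i, j)" if "p < N" "i < n" "j < n" for p i j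
    using arg_cong[OF residues_from_blocks(2)[OF that(1)], of "\<lambda>X. X $$ (i, j)"] that B[OF that(1)]
    unfolding K_def by (simp add: mat_sum_eq_rect_sum)
  show "F z = 1\<^sub>m n + mat_sum n (\<lambda>k. mat_sum n (\<lambda>j.
      (1 / (z - lam k)) \<cdot>\<^sub>m (b j * K j k * a k)) {..<N}) {..<N}" (is "_ = 1\<^sub>m n + ?R")
  proof (rule eq_matI)
    fix i j assume "i < dim_row (1\<^sub>m n + ?R)" "j < dim_col (1\<^sub>m n + ?R)"
    then have ij: "i < n" "j < n" by (auto simp: mat_sum_eq_rect_sum)
    have "?R $$ (i, j) = (\<Sum>k<N. \<Sum>p<N. (b p * K p k * a k) $$ (i, j) / (z - lam k))"
      using ij c by (simp add: mat_sum_eq_rect_sum del: index_mult_mat)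
    also have "\<dots> = (\<Sum>k<N. A k $$ (i, j) / (z - lam k))"
      by (intro sum.cong refl) (use ij A_ij in \<open>simp add: sum_divide_distrib[symmetric]\<close>)
    finally show "F z $$ (i, j) = (1\<^sub>m n + ?R) $$ (i, j)"
      using ij A by (simp add: pole_sum_index mat_sum_eq_rect_sum)
  qed (auto simp: mat_sum_eq_rect_sum)
  show "E z = 1\<^sub>m n - mat_sum n (\<lambda>k. mat_sum n (\<lambda>j.
      (1 / (z - mu j)) \<cdot>\<^sub>m (b j * K j k * a k)) {..<N}) {..<N}" (is "_ = 1\<^sub>m n - ?R")
  proof (rule eq_matI)
    fix i j assume "i < dim_row (1\<^sub>m n - ?R)" "j < dim_col (1\<^sub>m n - ?R)"
    then have ij: "i < n" "j < n" by (auto simp: mat_sum_eq_rect_sum)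
    have "?R $$ (i, j) = (\<Sum>k<N. \<Sum>p<N. (b p * K p k * a k) $$ (i, j) / (z - mu p))"
      using ij c by (simp add: mat_sum_eq_rect_sum del: index_mult_mat)
    \<comment> \<open>The pole \<open>mu p\<close> does not depend on k, so after the exchange the
      inner sum collapses to - B_p.\<close>
    also have "\<dots> = (\<Sum>p<N. \<Sum>k<N. (b p * K p k * a k) $$ (i, j) / (z - mu p))"
      by (rule sum.swap)
    also have "\<dots> = (\<Sum>p<N. - B p $$ (i, j) / (z - mu p))"
      by (intro sum.cong refl) (use ij B_ij in \<open>simp add: sum_divide_distrib[symmetric]\<close>)
    finally show "E z $$ (i, j) = (1\<^sub>m n - ?R) $$ (i, j)"
      using ij B by (simp add: pole_sum_index mat_sum_eq_rect_sum sum_negf)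
  qed (auto simp: mat_sum_eq_rect_sum)
qed

end

end

section \<open>Derivatives of matrix-valued functions\<close>

text \<open>Matrices of all sizes share one type, so differentiability is entrywise. The size is
  required on a full neighbourhood of \<open>x\<close>, which allows products to be expanded
  entrywise near \<open>x\<close> and at \<open>x\<close>.\<close>

definition has_mat_derivative ::
  "nat \<Rightarrow> nat \<Rightarrow> ('v::real_normed_vector \<Rightarrow> complex mat) \<Rightarrow> ('v \<Rightarrow> complex mat) \<Rightarrow> 'v \<Rightarrow> bool" where
  "has_mat_derivative r c F F' x \<longleftrightarrow>
     (\<forall>h. F' h \<in> carrier_mat r c) \<and> (\<forall>\<^sub>F y in nhds x. F y \<in> carrier_mat r c) \<and>
     (\<forall>i<r. \<forall>j<c. ((\<lambda>y. F y $$ (i, j)) has_derivative (\<lambda>h. F' h $$ (i, j))) (at x))"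

lemma has_mat_derivativeI:
  assumes "\<And>h. F' h \<in> carrier_mat r c" "\<forall>\<^sub>F y in nhds x. F y \<in> carrier_mat r c"
    "\<And>i j. i < r \<Longrightarrow> j < c \<Longrightarrow> ((\<lambda>y. F y $$ (i, j)) has_derivative (\<lambda>h. F' h $$ (i, j))) (at x)"
  shows "has_mat_derivative r c F F' x"
  using assms by (simp add: has_mat_derivative_def)

lemma has_mat_derivativeD:
  assumes "has_mat_derivative r c F F' x"
  shows "F' h \<in> carrier_mat r c" "\<forall>\<^sub>F y in nhds x. F y \<in> carrier_mat r c" "F x \<in> carrier_mat r c"
    "i < r \<Longrightarrow> j < c \<Longrightarrow> ((\<lambda>y. F y $$ (i, j)) has_derivative (\<lambda>h. F' h $$ (i, j))) (at x)"
proof -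
  note * = assms[unfolded has_mat_derivative_def]
  show "F' h \<in> carrier_mat r c" using * by blast
  show "\<forall>\<^sub>F y in nhds x. F y \<in> carrier_mat r c" using * by blast
  then show "F x \<in> carrier_mat r c" by (rule eventually_nhds_x_imp_x)
  show "((\<lambda>y. F y $$ (i, j)) has_derivative (\<lambda>h. F' h $$ (i, j))) (at x)" if "i < r" "j < c"
    using * that by blast
qed

lemma has_derivative_transform_nhds:
  assumes "(f has_derivative f') (at x)" "\<forall>\<^sub>F y in nhds x. f y = g y"
  shows "(g has_derivative f') (at x)"
proof (rule has_derivative_transform_eventually[OF assms(1)])
  show "\<forall>\<^sub>F y in at x. f y = g y"
    using assms(2) filter_leD[OF at_within_le_nhds] by blast
  show "f x = g x" using assms(2) by (rule eventually_nhds_x_imp_x)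
qed simp

lemma has_mat_derivative_cong:
  assumes F: "has_mat_derivative r c F F' x" and FG: "\<forall>\<^sub>F y in nhds x. F y = G y"
  shows "has_mat_derivative r c G F' x"
proof (rule has_mat_derivativeI)
  show "F' h \<in> carrier_mat r c" for h using F by (rule has_mat_derivativeD)
  show "\<forall>\<^sub>F y in nhds x. G y \<in> carrier_mat r c"
    using has_mat_derivativeD(2)[OF F] FG by eventually_elim simp
  fix i j assume "i < r" "j < c"
  then show "((\<lambda>y. G y $$ (i, j)) has_derivative (\<lambda>h. F' h $$ (i, j))) (at x)"
    by (rule has_derivative_transform_nhds[OF has_mat_derivativeD(4)[OF F]])
      (use FG in \<open>auto elim: eventually_mono\<close>)
qed

lemma has_mat_derivative_unique:
  assumes F: "has_mat_derivative r c F F' x" and G: "has_mat_derivative r c F G' x"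
  shows "F' h = G' h"
proof (rule eq_matI)
  fix i j assume "i < dim_row (G' h)" "j < dim_col (G' h)"
  then have "i < r" "j < c" using has_mat_derivativeD(1)[OF G, of h] by auto
  then show "F' h $$ (i, j) = G' h $$ (i, j)"
    using fun_cong[OF has_derivative_unique[OF has_mat_derivativeD(4)[OF F] has_mat_derivativeD(4)[OF G]]]
    by simp
qed (use has_mat_derivativeD(1)[OF F, of h] has_mat_derivativeD(1)[OF G, of h] in auto)

lemma has_mat_derivative_const:
  "A \<in> carrier_mat r c \<Longrightarrow> has_mat_derivative r c (\<lambda>_. A) (\<lambda>_. 0\<^sub>m r c) x"
  by (simp add: has_mat_derivative_def)

lemma has_mat_derivative_transpose:
  assumes F: "has_mat_derivative r c F F' x"
  shows "has_mat_derivative c r (\<lambda>y. (F y)\<^sup>T) (\<lambda>h. (F' h)\<^sup>T) x"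
proof (rule has_mat_derivativeI)
  show "(F' h)\<^sup>T \<in> carrier_mat c r" for h using has_mat_derivativeD(1)[OF F] by simp
  show "\<forall>\<^sub>F y in nhds x. (F y)\<^sup>T \<in> carrier_mat c r"
    using has_mat_derivativeD(2)[OF F] by eventually_elim simp
  fix i j assume ij: "i < c" "j < r"
  have "\<forall>\<^sub>F y in nhds x. F y $$ (j, i) = (F y)\<^sup>T $$ (i, j)"
    using has_mat_derivativeD(2)[OF F] by eventually_elim (use ij in auto)
  moreover have "(F' h)\<^sup>T $$ (i, j) = F' h $$ (j, i)" for h
    using has_mat_derivativeD(1)[OF F, of h] ij by auto
  ultimately show "((\<lambda>y. (F y)\<^sup>T $$ (i, j)) has_derivative (\<lambda>h. (F' h)\<^sup>T $$ (i, j))) (at x)"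
    using has_derivative_transform_nhds[OF has_mat_derivativeD(4)[OF F ij(2,1)]] by simp
qed

lemma has_mat_derivative_mult:
  assumes F: "has_mat_derivative r m F F' x" and G: "has_mat_derivative m c G G' x"
  shows "has_mat_derivative r c (\<lambda>y. F y * G y) (\<lambda>h. F' h * G x + F x * G' h) x"
proof (rule has_mat_derivativeI)
  note F' = has_mat_derivativeD[OF F] and G' = has_mat_derivativeD[OF G]
  show "F' h * G x + F x * G' h \<in> carrier_mat r c" for h using F'(1,3) G'(1,3) by auto
  show "\<forall>\<^sub>F y in nhds x. F y * G y \<in> carrier_mat r c"
    using F'(2) G'(2) by eventually_elim auto
  fix i j assume ij: "i < r" "j < c"
  have "((\<lambda>y. \<Sum>l<m. F y $$ (i, l) * G y $$ (l, j)) has_derivative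
      (\<lambda>h. \<Sum>l<m. F x $$ (i, l) * G' h $$ (l, j) + F' h $$ (i, l) * G x $$ (l, j))) (at x)"
    using ij by (intro has_derivative_sum has_derivative_mult F'(4) G'(4)) auto
  moreover have "(\<Sum>l<m. F x $$ (i, l) * G' h $$ (l, j) + F' h $$ (i, l) * G x $$ (l, j))
      = (F' h * G x + F x * G' h) $$ (i, j)" for h
    using ij F'(1)[of h] F'(3) G'(1)[of h] G'(3)
    by (simp add: scalar_prod_def atLeast0LessThan sum.distrib add.commute)
  moreover have "\<forall>\<^sub>F y in nhds x. (\<Sum>l<m. F y $$ (i, l) * G y $$ (l, j)) = (F y * G y) $$ (i, j)"
    using F'(2) G'(2) by eventually_elim (use ij in \<open>auto simp: scalar_prod_def atLeast0LessThan\<close>)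
  ultimately show "((\<lambda>y. (F y * G y) $$ (i, j)) has_derivative
      (\<lambda>h. (F' h * G x + F x * G' h) $$ (i, j))) (at x)"
    by (simp only: has_derivative_transform_nhds)
qed

lemma has_mat_derivative_compose:
  assumes F: "has_mat_derivative r c F F' (g x)" and g: "(g has_derivative g') (at x)"
  shows "has_mat_derivative r c (\<lambda>y. F (g y)) (\<lambda>h. F' (g' h)) x"
proof (rule has_mat_derivativeI)
  show "F' (g' h) \<in> carrier_mat r c" for h using has_mat_derivativeD(1)[OF F] .
  have "filterlim g (nhds (g x)) (nhds x)"
    using has_derivative_continuous[OF g] by (simp add: isCont_def tendsto_at_iff_tendsto_nhds)
  then show "\<forall>\<^sub>F y in nhds x. F (g y) \<in> carrier_mat r c"
    using has_mat_derivativeD(2)[OF F] by (rule eventually_compose_filterlim[rotated])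
  fix i j assume "i < r" "j < c"
  from diff_chain_at[OF g has_mat_derivativeD(4)[OF F this]]
  show "((\<lambda>y. F (g y) $$ (i, j)) has_derivative (\<lambda>h. F' (g' h) $$ (i, j))) (at x)"
    by (simp add: o_def)
qed

lemma differentiable_prod:
  fixes f :: "'i \<Rightarrow> 'v::real_normed_vector \<Rightarrow> 'a::real_normed_field"
  assumes "\<And>i. i \<in> I \<Longrightarrow> f i differentiable (at x)"
  shows "(\<lambda>y. \<Prod>i\<in>I. f i y) differentiable (at x)"
  using assms by (induction I rule: infinite_finite_induct) auto

lemma det_differentiable:
  fixes F :: "'v::real_normed_vector \<Rightarrow> complex mat"
  assumes F: "\<And>i j. i < n \<Longrightarrow> j < n \<Longrightarrow> (\<lambda>y. F y $$ (i, j)) differentiable (at x)"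
    and c: "\<And>y. F y \<in> carrier_mat n n"
  shows "(\<lambda>y. Determinant.det (F y)) differentiable (at x)"
proof -
  have "(\<lambda>y. \<Sum>p\<in>{p. p permutes {0..<n}}. signof p * (\<Prod>i = 0..<n. F y $$ (i, p i))) differentiable (at x)"
  proof (rule differentiable_sum)
    show "finite {p. p permutes {0..<n}}" by (simp add: finite_permutations)
    show "\<forall>p\<in>{p. p permutes {0..<n}}. (\<lambda>y. signof p * (\<Prod>i = 0..<n. F y $$ (i, p i))) differentiable (at x)"
    proof
      fix p assume p: "p \<in> {p. p permutes {0..<n}}"
      have "(\<lambda>y. \<Prod>i = 0..<n. F y $$ (i, p i)) differentiable (at x)"
      proof (rule differentiable_prod)
        fix i assume i: "i \<in> {0..<n}"
        then have "p i < n" using permutes_in_image[of p "{0..<n}" i] p by simp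
        then show "(\<lambda>y. F y $$ (i, p i)) differentiable (at x)" using i by (intro F) auto
      qed
      then show "(\<lambda>y. signof p * (\<Prod>i = 0..<n. F y $$ (i, p i))) differentiable (at x)"
        by (rule differentiable_mult[OF differentiable_const])
    qed
  qed
  moreover have "(\<lambda>y. Determinant.det (F y))
      = (\<lambda>y. \<Sum>p\<in>{p. p permutes {0..<n}}. signof p * (\<Prod>i = 0..<n. F y $$ (i, p i)))"
    by (rule ext) (rule det_def'[OF c])
  ultimately show ?thesis by simp
qed

text \<open>Near \<open>x\<close> the inverse is the adjugate divided by the determinant, and its
  entries are quotients of polynomials in the entries of \<open>F\<close>. Only existence of a
  derivative is claimed; its value is later extracted by differentiating a product.\<close>

lemma has_mat_derivative_matinv:
  fixes F :: "'v::real_normed_vector \<Rightarrow> complex mat"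
  assumes F: "has_mat_derivative n n F F' x" and inv: "\<forall>\<^sub>F y in nhds x. Determinant.det (F y) \<noteq> 0"
  obtains H' where "has_mat_derivative n n (\<lambda>y. matinv (F y)) H' x"
proof -
  \<comment> \<open>\<open>det_differentiable\<close> asks for the right size at every point,
    whereas \<open>F\<close> has it only near \<open>x\<close>; \<open>X\<close> agrees with
    \<open>F\<close> there and is harmless elsewhere.\<close>
  define X where "X = (\<lambda>y. if F y \<in> carrier_mat n n then F y else 1\<^sub>m n)"
  have X: "X y \<in> carrier_mat n n" for y by (simp add: X_def)
  have FX: "\<forall>\<^sub>F y in nhds x. F y = X y"
    using has_mat_derivativeD(2)[OF F] by eventually_elim (simp add: X_def)
  have X': "has_mat_derivative n n X F' x" by (rule has_mat_derivative_cong[OF F FX])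
  have dX: "(\<lambda>y. X y $$ (i, j)) differentiable (at x)" if "i < n" "j < n" for i j
    using has_mat_derivativeD(4)[OF X' that] by (auto simp: differentiable_def)
  have det0: "Determinant.det (X x) \<noteq> 0"
    using eventually_nhds_x_imp_x[OF inv] eventually_nhds_x_imp_x[OF FX] by simp
  define Y where "Y = (\<lambda>y. (1 / Determinant.det (X y)) \<cdot>\<^sub>m adj_mat (X y))"
  have "(\<lambda>y. Y y $$ (i, j)) differentiable (at x)" if ij: "i < n" "j < n" for i j
  proof -
    have "(\<lambda>y. Determinant.det (mat_delete (X y) j i)) differentiable (at x)"
    proof (rule det_differentiable[of "n - 1"])
      show "mat_delete (X y) j i \<in> carrier_mat (n - 1) (n - 1)" for y
        using X[of y] ij by (simp add: mat_delete_def)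
      fix p q assume pq: "p < n - 1" "q < n - 1"
      have "mat_delete (X y) j i $$ (p, q) = X y $$ (if p < j then p else Suc p, if q < i then q else Suc q)" for y
        using X[of y] ij pq by (simp add: mat_delete_def)
      then show "(\<lambda>y. mat_delete (X y) j i $$ (p, q)) differentiable (at x)"
        using pq by (simp add: dX)
    qed
    moreover have "(\<lambda>y. Determinant.det (X y)) differentiable (at x)"
      by (rule det_differentiable[OF dX X])
    ultimately have "(\<lambda>y. (1 / Determinant.det (X y)) * ((-1) ^ (j + i) * Determinant.det (mat_delete (X y) j i)))
        differentiable (at x)"
      using det0 by (intro differentiable_mult differentiable_divide differentiable_const)
    moreover have "Y y $$ (i, j) = (1 / Determinant.det (X y)) * ((-1) ^ (j + i) * Determinant.det (mat_delete (X y) j i))" for y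
      using X[of y] ij by (simp add: Y_def adj_mat_def cofactor_def)
    ultimately show ?thesis by simp
  qed
  then have "\<forall>i j. \<exists>f'. i < n \<longrightarrow> j < n \<longrightarrow> ((\<lambda>y. Y y $$ (i, j)) has_derivative f') (at x)"
    by (auto simp: differentiable_def)
  then obtain f' where f': "\<And>i j. i < n \<Longrightarrow> j < n \<Longrightarrow> ((\<lambda>y. Y y $$ (i, j)) has_derivative f' i j) (at x)"
    by metis
  have Yc: "Y y \<in> carrier_mat n n" for y using adj_mat(1)[OF X, of y] by (simp add: Y_def)
  have "has_mat_derivative n n Y (\<lambda>h. Matrix.mat n n (\<lambda>(i, j). f' i j h)) x"
    using Yc f' by (intro has_mat_derivativeI) auto
  moreover have "\<forall>\<^sub>F y in nhds x. Y y = matinv (F y)"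
    using FX inv
  proof eventually_elim
    case (elim y)
    have "X y * Y y = 1\<^sub>m n"
      using adj_mat[OF X, of y] X[of y] elim unfolding Y_def
      by (simp add: mult_smult_distrib[of _ n n _ n]) (intro eq_matI, auto)
    then show ?case using matinv_eq[OF X Yc] elim(1) by metis
  qed
  ultimately show thesis by (intro that[OF has_mat_derivative_cong])
qed

lemma has_mat_derivative_zero_imp_constant:
  fixes F :: "'v::real_normed_vector \<Rightarrow> complex mat"
  assumes S: "convex S" "x0 \<in> S" "x \<in> S"
    and F: "\<And>x. x \<in> S \<Longrightarrow> has_mat_derivative r c F (\<lambda>_. 0\<^sub>m r c) x"
  shows "F x = F x0"
proof (rule eq_matI)
  note D = has_mat_derivativeD[OF F]
  have c: "F x \<in> carrier_mat r c" "F x0 \<in> carrier_mat r c" using D(3) S by auto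
  then show "dim_row (F x) = dim_row (F x0)" "dim_col (F x) = dim_col (F x0)" by auto
  fix i j assume "i < dim_row (F x0)" "j < dim_col (F x0)"
  then have ij: "i < r" "j < c" using c by auto
  have "\<exists>d. \<forall>y\<in>S. F y $$ (i, j) = d"
  proof (rule has_derivative_zero_constant[OF S(1)])
    fix y assume "y \<in> S"
    from D(4)[OF this ij] have "((\<lambda>y. F y $$ (i, j)) has_derivative (\<lambda>h. 0)) (at y)"
      using ij by simp
    then show "((\<lambda>y. F y $$ (i, j)) has_derivative (\<lambda>h. 0)) (at y within S)"
      by (rule has_derivative_at_withinI)
  qed
  then show "F x $$ (i, j) = F x0 $$ (i, j)" using S by metis
qed

text \<open>The differential equations are available in the coordinate directions; linearity of the
  derivative carries its vanishing from these to all directions.\<close>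

lemma has_mat_derivative_Basis_zero:
  fixes F :: "'v::euclidean_space \<Rightarrow> complex mat"
  assumes F: "has_mat_derivative r c F F' x" and 0: "\<And>h. h \<in> Basis \<Longrightarrow> F' h = 0\<^sub>m r c"
  shows "has_mat_derivative r c F (\<lambda>_. 0\<^sub>m r c) x"
proof (rule has_mat_derivativeI)
  show "\<forall>\<^sub>F y in nhds x. F y \<in> carrier_mat r c" using F by (rule has_mat_derivativeD)
  fix i j assume ij: "i < r" "j < c"
  note d = has_mat_derivativeD(4)[OF F ij]
  have "(\<lambda>h. F' h $$ (i, j)) = (\<lambda>h. 0)"
    by (rule linear_eq_stdbasis[OF has_derivative_linear[OF d] linear_zero]) (use 0 ij in simp)
  then show "((\<lambda>y. F y $$ (i, j)) has_derivative (\<lambda>h. 0\<^sub>m r c $$ (i, j))) (at x)"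
    using d ij by simp
qed auto

section \<open>Constancy of the row space\<close>

text \<open>For \<open>Q\<close> of full row rank this says that the rows of \<open>Q\<close> form a
  basis of the row space of \<open>G\<close>: full column rank of the coefficient matrix makes the
  two row spaces equal.\<close>

definition has_row_basis :: "nat \<Rightarrow> nat \<Rightarrow> complex mat \<Rightarrow> complex mat \<Rightarrow> bool" where
  "has_row_basis n r G Q \<longleftrightarrow> (\<exists>P. has_left_inverse n r P \<and> G = P * Q)"

text \<open>Near \<open>x0\<close> the rows of \<open>H = (L G R)\<^sup>-\<^sup>1 L G\<close> are a basis of the row space of G, normalized by
  \<open>H R = 1\<close>. The equation \<open>G' = C G\<close> turns into \<open>H' = 0\<close>, whence no continuity of C is required.\<close>

lemma row_space_locally_constant:
  fixes G :: "'v::euclidean_space \<Rightarrow> complex mat"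
  assumes S: "open S" "x0 \<in> S"
    and G: "\<And>x. x \<in> S \<Longrightarrow> has_mat_derivative n m G (G' x) x"
    and ode: "\<And>x h. x \<in> S \<Longrightarrow> h \<in> Basis \<Longrightarrow> \<exists>C\<in>carrier_mat n n. G' x h = C * G x"
    and rank: "\<And>x. x \<in> S \<Longrightarrow> \<exists>Q. has_right_inverse r m Q \<and> has_row_basis n r (G x) Q"
    and Q0: "has_right_inverse r m Q0" "has_row_basis n r (G x0) Q0"
  obtains e where "e > 0" "ball x0 e \<subseteq> S" "\<And>x. x \<in> ball x0 e \<Longrightarrow> has_row_basis n r (G x) Q0"
proof -
  obtain R where R: "Q0 \<in> carrier_mat r m" "R \<in> carrier_mat m r" "Q0 * R = 1\<^sub>m r"
    using Q0(1) by (rule has_right_inverseE)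
  obtain P0 where P0: "has_left_inverse n r P0" "G x0 = P0 * Q0"
    using Q0(2) by (auto simp: has_row_basis_def)
  obtain L where L: "P0 \<in> carrier_mat n r" "L \<in> carrier_mat r n" "L * P0 = 1\<^sub>m r"
    using P0(1) by (rule has_left_inverseE)
  \<comment> \<open>\<open>L\<close> and \<open>R\<close> normalize at \<open>x0\<close>, where
    \<open>X\<close> becomes \<open>Q0\<close> and \<open>Z\<close> becomes 1. Wherever
    \<open>Z\<close> is invertible, the rows of \<open>X\<close> are still a basis of the row space
    of G.\<close>
  define X where "X = (\<lambda>y. L * G y)"
  define Z where "Z = (\<lambda>y. X y * R)"
  define H where "H = (\<lambda>y. matinv (Z y) * X y)"
  have Gc: "G x \<in> carrier_mat n m" if "x \<in> S" for x using G[OF that] by (rule has_mat_derivativeD)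
  have Xc: "X x \<in> carrier_mat r m" if "x \<in> S" for x using Gc[OF that] L by (simp add: X_def)
  have Zc: "Z x \<in> carrier_mat r r" if "x \<in> S" for x using Xc[OF that] R by (simp add: Z_def)
  have dX: "has_mat_derivative r m X (\<lambda>h. L * G' x h) x" if x: "x \<in> S" for x
  proof -
    have "has_mat_derivative r m X (\<lambda>h. 0\<^sub>m r n * G x + L * G' x h) x"
      unfolding X_def by (rule has_mat_derivative_mult[OF has_mat_derivative_const[OF L(2)] G[OF x]])
    moreover have "0\<^sub>m r n * G x + L * G' x h = L * G' x h" for h
      using has_mat_derivativeD[OF G[OF x]] L by (auto intro!: left_add_zero_mat)
    ultimately show ?thesis by simp
  qed
  have dZ: "has_mat_derivative r r Z (\<lambda>h. L * G' x h * R) x" if x: "x \<in> S" for x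
  proof -
    have "has_mat_derivative r r Z (\<lambda>h. L * G' x h * R + X x * 0\<^sub>m m r) x"
      unfolding Z_def by (rule has_mat_derivative_mult[OF dX[OF x] has_mat_derivative_const[OF R(2)]])
    moreover have "L * G' x h * R + X x * 0\<^sub>m m r = L * G' x h * R" for h
      using has_mat_derivativeD[OF G[OF x]] L R Xc[OF x] by (auto intro!: right_add_zero_mat)
    ultimately show ?thesis by simp
  qed
  have X0: "X x0 = Q0" using L R P0 by (simp add: X_def mult_mat_cancel)
  have Z0: "Z x0 = 1\<^sub>m r" using R by (simp add: Z_def X0)
  have nhds: "\<forall>\<^sub>F y in nhds x. y \<in> S" if "x \<in> S" for x
    using S(1) that by (rule eventually_nhds_in_open)
  have evZ: "\<forall>\<^sub>F y in nhds x. Determinant.det (Z y) \<noteq> 0" if x: "x \<in> S" "Determinant.det (Z x) \<noteq> 0" for x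
  proof -
    define Y where "Y = (\<lambda>y. if y \<in> S then Z y else 1\<^sub>m r)"
    have ZY: "\<forall>\<^sub>F y in nhds x. Z y = Y y" using nhds[OF x(1)] by eventually_elim (simp add: Y_def)
    have "has_mat_derivative r r Y (\<lambda>h. L * G' x h * R) x"
      by (rule has_mat_derivative_cong[OF dZ[OF x(1)] ZY])
    then have "(\<lambda>y. Determinant.det (Y y)) differentiable (at x)"
      by (intro det_differentiable[of r])
        (auto simp: Y_def Zc differentiable_def intro: has_mat_derivativeD(4))
    then have "isCont (\<lambda>y. Determinant.det (Y y)) x"
      by (rule differentiable_imp_continuous_within)
    then have "filterlim (\<lambda>y. Determinant.det (Y y)) (nhds (Determinant.det (Y x))) (nhds x)"
      using tendsto_at_iff_tendsto_nhds[of "\<lambda>y. Determinant.det (Y y)" x] by (simp add: isCont_def)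
    then have "\<forall>\<^sub>F y in nhds x. Determinant.det (Y y) \<noteq> 0"
      by (rule tendsto_imp_eventually_ne) (use x in \<open>simp add: Y_def\<close>)
    then show ?thesis using ZY by eventually_elim simp
  qed
  have "\<forall>\<^sub>F y in nhds x0. y \<in> S \<and> Determinant.det (Z y) \<noteq> 0"
    using evZ[OF S(2)] nhds[OF S(2)] by (auto simp: Z0 intro: eventually_conj)
  then obtain e where e: "e > 0" "\<And>y. dist y x0 < e \<Longrightarrow> y \<in> S \<and> Determinant.det (Z y) \<noteq> 0"
    unfolding eventually_nhds_metric by blast
  have inv: "matinv (Z y) \<in> carrier_mat r r" "Z y * matinv (Z y) = 1\<^sub>m r" "matinv (Z y) * Z y = 1\<^sub>m r"
    if y: "y \<in> S" "Determinant.det (Z y) \<noteq> 0" for y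
  proof -
    obtain B where B: "B \<in> carrier_mat r r" "Z y * B = 1\<^sub>m r" "B * Z y = 1\<^sub>m r"
      using det_nonzero_inverse[OF Zc[OF y(1)] y(2)] by blast
    then show "matinv (Z y) \<in> carrier_mat r r" "Z y * matinv (Z y) = 1\<^sub>m r" "matinv (Z y) * Z y = 1\<^sub>m r"
      using matinv_eq[OF Zc[OF y(1)] B(1,2)] by auto
  qed
  \<comment> \<open>For any full rank factorization G = P Q one has Z = (L P) (Q R). Both factors
    are square, so invertibility of Z makes L P invertible with inverse T, and G is recovered from X
    as P T X.\<close>
  have factor: "\<exists>P Q T. has_left_inverse n r P \<and> has_right_inverse r m Q \<and> G x = P * Q
      \<and> T \<in> carrier_mat r r \<and> T * (L * P) = 1\<^sub>m r \<and> (L * P) * T = 1\<^sub>m r \<and> T = Q * R * matinv (Z x)"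
    if x: "x \<in> S" "Determinant.det (Z x) \<noteq> 0" for x
  proof -
    obtain P Q where PQ: "has_left_inverse n r P" "has_right_inverse r m Q" "G x = P * Q"
      using rank[OF x(1)] by (auto simp: has_row_basis_def)
    have c: "P \<in> carrier_mat n r" "Q \<in> carrier_mat r m"
      using PQ by (auto simp: has_left_inverse_def has_right_inverse_def)
    have "(L * P) * (Q * R * matinv (Z x)) = Z x * matinv (Z x)"
      using c L R inv(1)[OF x] by (simp add: Z_def X_def PQ(3) mult_mat_assoc)
    then have 1: "(L * P) * (Q * R * matinv (Z x)) = 1\<^sub>m r" using inv(2)[OF x] by simp
    have Tc: "Q * R * matinv (Z x) \<in> carrier_mat r r" using c R inv(1)[OF x] by auto
    have "(Q * R * matinv (Z x)) * (L * P) = 1\<^sub>m r"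
      by (rule mat_mult_left_right_inverse[OF _ Tc 1]) (use c L in auto)
    then show ?thesis using 1 PQ Tc by blast
  qed
  have dH: "has_mat_derivative r m H (\<lambda>_. 0\<^sub>m r m) x"
    if x: "x \<in> S" "Determinant.det (Z x) \<noteq> 0" for x
  proof -
    obtain W' where W': "has_mat_derivative r r (\<lambda>y. matinv (Z y)) W' x"
      using has_mat_derivative_matinv[OF dZ[OF x(1)] evZ[OF x]] by blast
    obtain H' where H': "has_mat_derivative r m H H' x"
      using has_mat_derivative_mult[OF W' dX[OF x(1)]] unfolding H_def by blast
    have ZH: "\<forall>\<^sub>F y in nhds x. Z y * H y = X y"
      using nhds[OF x(1)] evZ[OF x]
    proof eventually_elim
      case (elim y)
      then show ?case using inv[OF elim] Xc[OF elim(1)] Zc[OF elim(1)]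
        by (simp add: H_def mult_mat_cancel)
    qed
    have Hc: "H x \<in> carrier_mat r m" using H' by (rule has_mat_derivativeD)
    have "H' h = 0\<^sub>m r m" if h: "h \<in> Basis" for h
    proof -
      note X'c = has_mat_derivativeD(1)[OF G[OF x(1)], of h]
      have H'c: "H' h \<in> carrier_mat r m" using H' by (rule has_mat_derivativeD)
      have "has_mat_derivative r m X (\<lambda>h. L * G' x h * R * H x + Z x * H' h) x"
        by (rule has_mat_derivative_cong[OF has_mat_derivative_mult[OF dZ[OF x(1)] H'] ZH])
      then have eq: "L * G' x h = L * G' x h * R * H x + Z x * H' h"
        using has_mat_derivative_unique[OF dX[OF x(1)]] by blast
      obtain C where C: "C \<in> carrier_mat n n" "G' x h = C * G x" using ode[OF x(1) h] by blast
      obtain P Q T where PQ: "has_left_inverse n r P" "has_right_inverse r m Q" "G x = P * Q"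
        and T: "T \<in> carrier_mat r r" "T * (L * P) = 1\<^sub>m r" using factor[OF x] by blast
      have c: "P \<in> carrier_mat n r" "Q \<in> carrier_mat r m"
        using PQ by (auto simp: has_left_inverse_def has_right_inverse_def)
      \<comment> \<open>With this, G' = C G becomes X' = (L C P T) X, and therefore Z' H = X' R H =
        (L C P T) Z H = (L C P T) X = X'. Comparison with X' = Z' H + Z H', obtained from Z H = X,
        leaves Z H' = 0.\<close>
      have GX: "G x = P * T * X x"
        using c L T mult_mat_cancel[OF T(2), of Q] by (simp add: X_def PQ(3) mult_mat_assoc)
      have "L * G' x h * R * H x = L * C * P * T * (Z x * H x)"
        using c L T R C Hc Gc[OF x(1)] Xc[OF x(1)] by (simp add: C(2) GX Z_def mult_mat_assoc)
      also have "Z x * H x = X x" using eventually_nhds_x_imp_x[OF ZH] .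
      also have "L * C * P * T * X x = L * G' x h"
        using c L T R C Hc Gc[OF x(1)] Xc[OF x(1)] by (simp add: C(2) GX mult_mat_assoc)
      finally have "L * G' x h * R * H x = L * G' x h" .
      with eq have "L * G' x h = L * G' x h + Z x * H' h" by simp
      moreover have "Z x * H' h = (L * G' x h + Z x * H' h) - L * G' x h"
        using L X'c Zc[OF x(1)] H'c by (intro eq_matI) auto
      ultimately have "Z x * H' h = L * G' x h - L * G' x h" by simp
      then have "Z x * H' h = 0\<^sub>m r m" using L X'c by auto
      then have "matinv (Z x) * (Z x * H' h) = 0\<^sub>m r m" using inv[OF x] by simp
      then show ?thesis using inv[OF x] Zc[OF x(1)] H'c by (simp add: mult_mat_cancel)
    qed
    then show ?thesis by (rule has_mat_derivative_Basis_zero[OF H'])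
  qed
  have H0: "H x0 = Q0"
    using matinv_eq[of "1\<^sub>m r" r "1\<^sub>m r"] R by (simp add: H_def X0 Z0)
  have "has_row_basis n r (G x) Q0" if x: "x \<in> ball x0 e" for x
  proof -
    have xS: "x \<in> S" "Determinant.det (Z x) \<noteq> 0" using e(2)[of x] x by (auto simp: dist_commute)
    \<comment> \<open>The ball is convex and \<open>Z\<close> is invertible on it, so the vanishing
      derivative makes \<open>H\<close> constant there.\<close>
    have "H x = H x0"
      by (rule has_mat_derivative_zero_imp_constant[of "ball x0 e"])
        (use x e in \<open>auto simp: dist_commute intro!: dH\<close>)
    then have HQ: "H x = Q0" by (simp add: H0)
    obtain P Q T where PQ: "has_left_inverse n r P" "has_right_inverse r m Q" "G x = P * Q"
        and T: "T \<in> carrier_mat r r" "T * (L * P) = 1\<^sub>m r" "T = Q * R * matinv (Z x)"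
      using factor[OF xS] by blast
    have c: "P \<in> carrier_mat n r" "Q \<in> carrier_mat r m"
      using PQ by (auto simp: has_left_inverse_def has_right_inverse_def)
    have QR: "Q * R \<in> carrier_mat r r" using c R by auto
    \<comment> \<open>T = (Q R) Z^-1 is invertible, hence so is Q R, and P (Q R) still has full
      column rank; it is the coefficient matrix of \<open>G x\<close> with respect to
      \<open>Q0\<close>.\<close>
    have "(Q * R) * (matinv (Z x) * (L * P)) = 1\<^sub>m r"
      using T inv[OF xS] c L R by (simp add: mult_mat_assoc)
    then have "has_left_inverse r r (Q * R)"
      by (rule has_left_inverse_square(1)[OF QR, rotated]) (use inv[OF xS] c L in auto)
    then have "has_left_inverse n r (P * (Q * R))" by (rule has_left_inverse_mult[OF PQ(1)])
    moreover have "G x = P * (Q * R) * Q0"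
    proof -
      have "P * (Q * R) * H x = P * (T * (L * P) * Q)"
        using inv[OF xS] c L R by (simp add: H_def X_def T(3) PQ(3) mult_mat_assoc)
      also have "\<dots> = G x" using c by (simp add: T(2) PQ(3))
      finally show ?thesis by (simp add: HQ)
    qed
    ultimately show ?thesis by (auto simp: has_row_basis_def)
  qed
  then show thesis using that e by (metis dist_commute mem_ball subsetI)
qed

text \<open>Two bases \<open>Q\<close>, \<open>Q1\<close> of the row space of \<open>G\<close>
  differ by an invertible square factor, which can be absorbed into the coefficient matrix of
  \<open>G1\<close>. This is the transitivity of sharing a row space.\<close>

lemma has_row_basis_change:
  assumes "has_row_basis n r G Q" "has_row_basis n r G Q1" "has_row_basis n r G1 Q1"
    and Q: "has_right_inverse r m Q" and Q1: "has_right_inverse r m Q1"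
  shows "has_row_basis n r G1 Q"
proof -
  obtain P P1 P2 where P: "has_left_inverse n r P" "G = P * Q" "has_left_inverse n r P1" "G = P1 * Q1"
    "has_left_inverse n r P2" "G1 = P2 * Q1" using assms by (auto simp: has_row_basis_def)
  obtain L where L: "P \<in> carrier_mat n r" "L \<in> carrier_mat r n" "L * P = 1\<^sub>m r" using P(1) by (rule has_left_inverseE)
  obtain L1 where L1: "P1 \<in> carrier_mat n r" "L1 \<in> carrier_mat r n" "L1 * P1 = 1\<^sub>m r" using P(3) by (rule has_left_inverseE)
  have P2: "P2 \<in> carrier_mat n r" using P by (simp add: has_left_inverse_def)
  obtain R1 where R1: "Q1 \<in> carrier_mat r m" "R1 \<in> carrier_mat m r" "Q1 * R1 = 1\<^sub>m r" using Q1 by (rule has_right_inverseE)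
  have Qc: "Q \<in> carrier_mat r m" using Q by (simp add: has_right_inverse_def)
  have 1: "Q1 = (L1 * P) * Q"
  proof -
    have "Q1 = L1 * (P1 * Q1)" using L1 R1 by (simp add: mult_mat_cancel)
    also have "\<dots> = L1 * (P * Q)" using P by simp
    finally show ?thesis using L1 L Qc by (simp add: mult_mat_assoc)
  qed
  have "(L1 * P) * (Q * R1) = 1\<^sub>m r"
    using R1 L L1 Qc by (subst R1(3)[symmetric], subst 1) (simp add: mult_mat_assoc)
  then have "has_left_inverse r r (L1 * P)"
    by (rule has_left_inverse_square(1)[rotated 2]) (use L L1 Qc R1 in auto)
  then have "has_left_inverse n r (P2 * (L1 * P))" by (rule has_left_inverse_mult[OF P(5)])
  moreover have "G1 = P2 * (L1 * P) * Q"
    using P(6) 1 P2 L1 L Qc by (simp add: mult_mat_assoc)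
  ultimately show ?thesis by (auto simp: has_row_basis_def)
qed

text \<open>Having a common row basis is an equivalence relation between points, and by local
  constancy each point has a neighbourhood of equivalent ones. On a connected set all points are
  then equivalent.\<close>

lemma row_space_constant:
  fixes G :: "'v::euclidean_space \<Rightarrow> complex mat"
  assumes S: "open S" "connected S" "S \<noteq> {}"
    and G: "\<And>x. x \<in> S \<Longrightarrow> has_mat_derivative n m G (G' x) x"
    and ode: "\<And>x h. x \<in> S \<Longrightarrow> h \<in> Basis \<Longrightarrow> \<exists>C\<in>carrier_mat n n. G' x h = C * G x"
    and rank: "\<And>x. x \<in> S \<Longrightarrow> \<exists>Q. has_right_inverse r m Q \<and> has_row_basis n r (G x) Q"
  obtains Q where "has_right_inverse r m Q" "\<And>x. x \<in> S \<Longrightarrow> has_row_basis n r (G x) Q"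
proof -
  define R where "R = (\<lambda>x y. \<exists>Q. has_right_inverse r m Q \<and> has_row_basis n r (G x) Q \<and> has_row_basis n r (G y) Q)"
  obtain x0 where x0: "x0 \<in> S" using S by blast
  obtain Q0 where Q0: "has_right_inverse r m Q0" "has_row_basis n r (G x0) Q0" using rank[OF x0] by blast
  have "R x0 x" if x: "x \<in> S" for x
  proof (rule connected_equivalence_relation[OF S(2) x0 x])
    show "R x y \<Longrightarrow> R y x" for x y by (auto simp: R_def)
    show "R x z" if "R x y" "R y z" for x y z
      using that has_row_basis_change unfolding R_def by blast
    fix a assume a: "a \<in> S"
    obtain Q where Q: "has_right_inverse r m Q" "has_row_basis n r (G a) Q" using rank[OF a] by blast
    obtain e where e: "e > 0" "ball a e \<subseteq> S" "\<And>x. x \<in> ball a e \<Longrightarrow> has_row_basis n r (G x) Q"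
      using row_space_locally_constant[OF S(1) a G ode rank Q] by blast
    then show "\<exists>T. openin (top_of_set S) T \<and> a \<in> T \<and> (\<forall>x\<in>T. R a x)"
      by (intro exI[of _ "ball a e"]) (use Q in \<open>auto simp: R_def openin_open_eq[OF S(1)]\<close>)
  qed
  then have "has_row_basis n r (G x) Q0" if "x \<in> S" for x
    using that has_row_basis_change Q0 unfolding R_def by blast
  then show thesis using that Q0 by blast
qed

section \<open>Residues\<close>

text \<open>Absence of a pole in the sense of \<open>is_pole\<close> only says that f does not tend
  to infinity. Since the limit of \<open>(z - p) * f z\<close> exists, a nonzero value of it would
  force exactly that divergence.\<close>

lemma no_pole_residue_zero:
  fixes f :: "'a::real_normed_field \<Rightarrow> 'a"
  assumes lim: "((\<lambda>z. (z - p) * f z) \<longlongrightarrow> r) (at p)" and "\<not> is_pole f p"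
  shows "r = 0"
proof (rule ccontr)
  assume "r \<noteq> 0"
  have "((\<lambda>z. z - p) \<longlongrightarrow> p - p) (at p)" by (intro tendsto_intros)
  then have "filterlim (\<lambda>z. z - p) (at 0) (at p)"
    by (auto simp: filterlim_at intro: eventually_mono[OF eventually_neq_at_within])
  with lim \<open>r \<noteq> 0\<close> have "filterlim (\<lambda>z. (z - p) * f z / (z - p)) at_infinity (at p)"
    by (intro filterlim_divide_at_infinity)
  moreover have "\<forall>\<^sub>F z in at p. (z - p) * f z / (z - p) = f z"
    by (rule eventually_mono[OF eventually_neq_at_within]) auto
  ultimately have "filterlim f at_infinity (at p)"
    using filterlim_cong[OF refl refl] by fast
  then show False using assms(2) by (simp add: is_pole_def)
qed

lemma mat_no_pole_residue_zero:
  assumes T: "mat_tendsto n n (\<lambda>z. (z - p) \<cdot>\<^sub>m T z) R (at p)" and "\<not> mat_pole n T p"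
  shows "R = 0\<^sub>m n n"
proof (rule eq_matI)
  fix i j assume "i < dim_row (0\<^sub>m n n :: complex mat)" "j < dim_col (0\<^sub>m n n :: complex mat)"
  then have ij: "i < n" "j < n" by auto
  have ev: "\<forall>\<^sub>F z in at p. (z - p) \<cdot>\<^sub>m T z \<in> carrier_mat n n"
    and lim: "((\<lambda>z. ((z - p) \<cdot>\<^sub>m T z) $$ (i, j)) \<longlongrightarrow> R $$ (i, j)) (at p)"
    using T ij by (auto simp: mat_tendsto_def)
  have "\<forall>\<^sub>F z in at p. ((z - p) \<cdot>\<^sub>m T z) $$ (i, j) = (z - p) * T z $$ (i, j)"
    using ev
  proof eventually_elim
    case (elim z)
    have "dim_row (T z) = n" "dim_col (T z) = n" using carrier_matD[OF elim] by simp_all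
    then show ?case using ij by simp
  qed
  with lim have "((\<lambda>z. (z - p) * T z $$ (i, j)) \<longlongrightarrow> R $$ (i, j)) (at p)"
    by (rule Lim_transform_eventually)
  moreover have "\<not> is_pole (\<lambda>z. T z $$ (i, j)) p" using assms(2) ij by (auto simp: mat_pole_def)
  ultimately show "R $$ (i, j) = 0\<^sub>m n n $$ (i, j)" using ij by (simp add: no_pole_residue_zero)
qed (use T in \<open>auto simp: mat_tendsto_def\<close>)

lemma mat_regular_at_tendsto:
  assumes "mat_regular_at n F p" "\<And>z. F z \<in> carrier_mat n n"
  shows "mat_tendsto n n F (F p) (at p)"
proof (rule mat_tendstoI)
  fix i j assume "i < n" "j < n"
  then have "isCont (\<lambda>z. F z $$ (i, j)) p"
    using assms(1) by (auto simp: mat_regular_at_def intro: analytic_at_imp_isCont)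
  then show "((\<lambda>z. F z $$ (i, j)) \<longlongrightarrow> F p $$ (i, j)) (at p)" by (simp add: isCont_def)
qed (use assms in auto)

lemma mat_regular_at_no_pole:
  assumes "mat_regular_at n F p"
  shows "\<not> mat_pole n F p"
proof
  assume "mat_pole n F p"
  then obtain i j where ij: "i < n" "j < n" and pole: "is_pole (\<lambda>w. F w $$ (i, j)) p"
    by (auto simp: mat_pole_def)
  have "isCont (\<lambda>z. F z $$ (i, j)) p"
    using assms ij by (auto simp: mat_regular_at_def intro: analytic_at_imp_isCont)
  then show False
    using pole not_tendsto_and_filterlim_at_infinity[of "at p"] by (auto simp: isCont_def is_pole_def)
qed

lemma mat_differentiable_has_mat_derivative:
  assumes "open S" "x \<in> S" "\<And>y. y \<in> S \<Longrightarrow> F y \<in> carrier_mat n n" "mat_differentiable n F x"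
  obtains F' where "has_mat_derivative n n F F' x"
proof
  show "has_mat_derivative n n F
    (\<lambda>h. Matrix.mat n n (\<lambda>(i, j). frechet_derivative (\<lambda>y. F y $$ (i, j)) (at x) h)) x"
  proof (rule has_mat_derivativeI)
    show "\<forall>\<^sub>F y in nhds x. F y \<in> carrier_mat n n"
      using eventually_nhds_in_open[OF assms(1,2)] by eventually_elim (rule assms(3))
    fix i j assume "i < n" "j < n"
    then show "((\<lambda>y. F y $$ (i, j)) has_derivative
      (\<lambda>h. Matrix.mat n n (\<lambda>(i, j). frechet_derivative (\<lambda>y. F y $$ (i, j)) (at x) h) $$ (i, j))) (at x)"
      using assms(4) by (simp add: mat_differentiable_def frechet_derivative_works)
  qed simp
qed

section \<open>Derivatives of pole sums with moving poles\<close>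

lemma mat_total_deriv_eq:
  assumes "has_mat_derivative n n (\<lambda>(y, w). F y w) F' (x, z)"
  shows "mat_total_deriv n L \<nu> F x z = F' (axis \<nu> 1, L \<nu> x z)"
proof (rule eq_matI)
  note c = has_mat_derivativeD(1)[OF assms, of "(axis \<nu> 1, L \<nu> x z)"]
  fix i j assume "i < dim_row (F' (axis \<nu> 1, L \<nu> x z))" "j < dim_col (F' (axis \<nu> 1, L \<nu> x z))"
  then have ij: "i < n" "j < n" using c by auto
  have eq: "(\<lambda>p. (case p of (y, w) \<Rightarrow> F y w) $$ (i, j)) = (\<lambda>(y, w). F y w $$ (i, j))"
    by (auto simp: fun_eq_iff)
  have "(\<lambda>h. F' h $$ (i, j)) = frechet_derivative (\<lambda>(y, w). F y w $$ (i, j)) (at (x, z))"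
    using has_mat_derivativeD(4)[OF assms ij] unfolding eq by (rule frechet_derivative_at)
  then show "mat_total_deriv n L \<nu> F x z $$ (i, j) = F' (axis \<nu> 1, L \<nu> x z) $$ (i, j)"
    using ij by (simp add: mat_total_deriv_def total_deriv_def fun_eq_iff)
qed (use has_mat_derivativeD(1)[OF assms, of "(axis \<nu> 1, L \<nu> x z)"] in \<open>auto simp: mat_total_deriv_def\<close>)

text \<open>The quotient rule for \<open>M + (\<Sum>k. C k / (z - lam k))\<close>; \<open>M'\<close>, \<open>C'\<close>, \<open>lam'\<close> and s are the
  derivatives of \<open>M\<close>, \<open>C\<close>, \<open>lam\<close> and z in one fixed direction.\<close>

definition pole_sum_deriv ::
  "nat \<Rightarrow> nat \<Rightarrow> complex mat \<Rightarrow> (nat \<Rightarrow> complex mat) \<Rightarrow> (nat \<Rightarrow> complex mat) \<Rightarrow> (nat \<Rightarrow> complex)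
    \<Rightarrow> (nat \<Rightarrow> complex) \<Rightarrow> complex \<Rightarrow> complex \<Rightarrow> complex mat" where
  "pole_sum_deriv n N M' C' C lam lam' s z = Matrix.mat n n (\<lambda>(i, j). M' $$ (i, j) +
     (\<Sum>k<N. (C' k $$ (i, j) * (z - lam k) - C k $$ (i, j) * (s - lam' k)) / ((z - lam k) * (z - lam k))))"

text \<open>The poles move with the point, so the formula for \<open>F\<close> is available only off
  the sets w = lam_k(y). As z - lam_k(x) is nonzero and the difference is jointly continuous, the
  formula holds near (x, z), where the quotient rule applies term by term.\<close>

lemma has_mat_derivative_poles:
  fixes F :: "'v::real_normed_vector \<Rightarrow> complex \<Rightarrow> complex mat"
  assumes S: "open S" "x \<in> S"
    and M: "has_mat_derivative n n M M' x"
    and C: "\<And>k. k < N \<Longrightarrow> has_mat_derivative n n (C k) (C' k) x"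
    and lam: "\<And>k. k < N \<Longrightarrow> (lam k has_derivative lam' k) (at x)"
    and z: "\<And>k. k < N \<Longrightarrow> z \<noteq> lam k x"
    and Fc: "\<And>y w. y \<in> S \<Longrightarrow> \<forall>k<N. w \<noteq> lam k y \<Longrightarrow> F y w \<in> carrier_mat n n"
    and F: "\<And>y w i j. y \<in> S \<Longrightarrow> \<forall>k<N. w \<noteq> lam k y \<Longrightarrow> i < n \<Longrightarrow> j < n \<Longrightarrow>
      F y w $$ (i, j) = M y $$ (i, j) + (\<Sum>k<N. C k y $$ (i, j) / (w - lam k y))"
  shows "has_mat_derivative n n (\<lambda>(y, w). F y w)
    (\<lambda>(h, s). pole_sum_deriv n N (M' h) (\<lambda>k. C' k h) (\<lambda>k. C k x) (\<lambda>k. lam k x) (\<lambda>k. lam' k h) s z) (x, z)"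
proof (rule has_mat_derivativeI)
  have fst: "(fst has_derivative fst) (at (x, z))" and snd: "(snd has_derivative snd) (at (x, z))"
    by (auto intro!: derivative_eq_intros)
  have comp: "((\<lambda>p. f (fst p)) has_derivative (\<lambda>p. f' (fst p))) (at (x, z))"
    if "(f has_derivative f') (at x)" for f f' :: "'v \<Rightarrow> complex"
    using diff_chain_at[OF fst, of f f'] that by (simp add: o_def)
  have lam1: "((\<lambda>p. snd p - lam k (fst p)) has_derivative (\<lambda>p. snd p - lam' k (fst p))) (at (x, z))"
    if "k < N" for k
    by (intro has_derivative_diff snd comp lam that)
  have "\<forall>\<^sub>F p in nhds (x, z). snd p - lam k (fst p) \<noteq> 0" if k: "k < N" for k
  proof -
    have "isCont (\<lambda>p. snd p - lam k (fst p)) (x, z)"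
      using has_derivative_continuous[OF lam1[OF k]] .
    then have "((\<lambda>p. snd p - lam k (fst p)) \<longlongrightarrow> z - lam k x) (nhds (x, z))"
      using tendsto_at_iff_tendsto_nhds[of "\<lambda>p. snd p - lam k (fst p)" "(x, z)"] by (simp add: isCont_def)
    then show ?thesis by (rule tendsto_imp_eventually_ne) (use z[OF k] in simp)
  qed
  then have "\<forall>\<^sub>F p in nhds (x, z). \<forall>k\<in>{..<N}. snd p - lam k (fst p) \<noteq> 0"
    by (intro eventually_ball_finite) auto
  moreover have "\<forall>\<^sub>F p in nhds (x, z). p \<in> S \<times> UNIV"
    using S by (intro eventually_nhds_in_open open_Times) auto
  ultimately have ev: "\<forall>\<^sub>F p in nhds (x, z). fst p \<in> S \<and> (\<forall>k<N. snd p \<noteq> lam k (fst p))"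
    by eventually_elim auto
  then show "\<forall>\<^sub>F p in nhds (x, z). (case p of (y, w) \<Rightarrow> F y w) \<in> carrier_mat n n"
    by eventually_elim (auto simp: split_beta intro: Fc)
  fix i j assume ij: "i < n" "j < n"
  have "((\<lambda>p. M (fst p) $$ (i, j) + (\<Sum>k<N. C k (fst p) $$ (i, j) / (snd p - lam k (fst p)))) has_derivative
    (\<lambda>p. M' (fst p) $$ (i, j) + (\<Sum>k<N. (C' k (fst p) $$ (i, j) * (z - lam k x)
      - C k x $$ (i, j) * (snd p - lam' k (fst p))) / ((z - lam k x) * (z - lam k x))))) (at (x, z))"
  proof (intro has_derivative_add has_derivative_sum)
    show "((\<lambda>p. M (fst p) $$ (i, j)) has_derivative (\<lambda>p. M' (fst p) $$ (i, j))) (at (x, z))"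
      by (rule comp) (rule has_mat_derivativeD(4)[OF M ij])
    fix k assume "k \<in> {..<N}"
    then have k: "k < N" by simp
    have Ck: "((\<lambda>p. C k (fst p) $$ (i, j)) has_derivative (\<lambda>p. C' k (fst p) $$ (i, j))) (at (x, z))"
      by (rule comp) (rule has_mat_derivativeD(4)[OF C[OF k] ij])
    show "((\<lambda>p. C k (fst p) $$ (i, j) / (snd p - lam k (fst p))) has_derivative
      (\<lambda>p. (C' k (fst p) $$ (i, j) * (z - lam k x)
      - C k x $$ (i, j) * (snd p - lam' k (fst p))) / ((z - lam k x) * (z - lam k x)))) (at (x, z))"
      using has_derivative_divide'[OF Ck lam1[OF k]] z[OF k] by simp
  qed
  moreover have "\<forall>\<^sub>F p in nhds (x, z). M (fst p) $$ (i, j) + (\<Sum>k<N. C k (fst p) $$ (i, j) / (snd p - lam k (fst p)))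
      = (case p of (y, w) \<Rightarrow> F y w) $$ (i, j)"
    using ev by eventually_elim (use ij in \<open>simp add: split_beta F\<close>)
  ultimately have "((\<lambda>p. (case p of (y, w) \<Rightarrow> F y w) $$ (i, j)) has_derivative
    (\<lambda>p. M' (fst p) $$ (i, j) + (\<Sum>k<N. (C' k (fst p) $$ (i, j) * (z - lam k x)
      - C k x $$ (i, j) * (snd p - lam' k (fst p))) / ((z - lam k x) * (z - lam k x))))) (at (x, z))"
    by (rule has_derivative_transform_nhds)
  moreover have "(case p of (h, s) \<Rightarrow> pole_sum_deriv n N (M' h) (\<lambda>k. C' k h) (\<lambda>k. C k x) (\<lambda>k. lam k x)
      (\<lambda>k. lam' k h) s z) $$ (i, j) = M' (fst p) $$ (i, j) + (\<Sum>k<N. (C' k (fst p) $$ (i, j) * (z - lam k x)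
      - C k x $$ (i, j) * (snd p - lam' k (fst p))) / ((z - lam k x) * (z - lam k x)))" for p
    using ij by (cases p) (simp add: pole_sum_deriv_def)
  ultimately show "((\<lambda>p. (case p of (y, w) \<Rightarrow> F y w) $$ (i, j)) has_derivative
    (\<lambda>p. (case p of (h, s) \<Rightarrow> pole_sum_deriv n N (M' h) (\<lambda>k. C' k h) (\<lambda>k. C k x) (\<lambda>k. lam k x)
      (\<lambda>k. lam' k h) s z) $$ (i, j))) (at (x, z))"
    by (simp only:)
qed (auto simp: pole_sum_deriv_def)

text \<open>The velocities of the poles and of z come from the same field \<open>f\<close>. The
  factor \<open>f z - f (lam k)\<close> thus cancels one of the two factors
  \<open>z - lam k\<close>, and its difference quotient contributes f' to the residue.\<close>

lemma pole_sum_deriv_tendsto_pole: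
  assumes C: "\<And>k. k < N \<Longrightarrow> C k \<in> carrier_mat n n" "\<And>k. k < N \<Longrightarrow> C' k \<in> carrier_mat n n"
    and inj: "inj_on lam {..<N}" and p: "p < N" and f: "(f has_field_derivative f') (at (lam p))"
  shows "mat_tendsto n n (\<lambda>z. (z - lam p) \<cdot>\<^sub>m pole_sum_deriv n N M' C' C lam (\<lambda>k. f (lam k)) (f z) z)
    (C' p - f' \<cdot>\<^sub>m C p) (at (lam p))"
proof (rule mat_tendstoI)
  show "C' p - f' \<cdot>\<^sub>m C p \<in> carrier_mat n n" using C p by (intro minus_carrier_mat) auto
  fix i j assume ij: "i < n" "j < n"
  \<comment> \<open>The limit at \<open>lam p\<close> of the difference quotient of \<open>f\<close>
    between z and \<open>lam k\<close>: a derivative for k = p, an ordinary quotient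
    otherwise.\<close>
  define q where "q k = (if k = p then f' else (f (lam p) - f (lam k)) / (lam p - lam k))" for k
  have eq: "lam p = lam k \<longleftrightarrow> k = p" if "k < N" for k using inj p that by (auto simp: inj_on_def)
  have isc: "isCont f (lam p)" using f by (rule DERIV_isCont)
  have q: "((\<lambda>z. (f z - f (lam k)) / (z - lam k)) \<longlongrightarrow> q k) (at (lam p))" if k: "k < N" for k
  proof (cases "k = p")
    case True
    then show ?thesis using f by (simp add: q_def has_field_derivative_iff)
  next
    case False
    then show ?thesis using isc eq[OF k] unfolding q_def isCont_def
      by (auto intro!: tendsto_intros)
  qed
  have "((\<lambda>z. (z - lam p) * M' $$ (i, j) + (\<Sum>k<N. ((z - lam p) / (z - lam k)) *
      (C' k $$ (i, j) - C k $$ (i, j) * ((f z - f (lam k)) / (z - lam k)))))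
    \<longlongrightarrow> (lam p - lam p) * M' $$ (i, j) + (\<Sum>k<N. (if lam p = lam k then 1 else 0) * (C' k $$ (i, j) - C k $$ (i, j) * q k)))
    (at (lam p))"
    by (intro tendsto_intros tendsto_ratio_at_pole q) auto
  also have "(\<Sum>k<N. (if lam p = lam k then 1 else 0) * (C' k $$ (i, j) - C k $$ (i, j) * q k))
    = (\<Sum>k<N. if k = p then C' k $$ (i, j) - C k $$ (i, j) * q k else 0)"
    by (intro sum.cong refl) (simp add: eq)
  also have "\<dots> = C' p $$ (i, j) - C p $$ (i, j) * f'" using p by (simp add: q_def)
  also have "(lam p - lam p) * M' $$ (i, j) + (C' p $$ (i, j) - C p $$ (i, j) * f') = (C' p - f' \<cdot>\<^sub>m C p) $$ (i, j)"
    using ij C(1)[OF p] C(2)[OF p] by simp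
  finally have lim: "((\<lambda>z. (z - lam p) * M' $$ (i, j) + (\<Sum>k<N. ((z - lam p) / (z - lam k)) *
      (C' k $$ (i, j) - C k $$ (i, j) * ((f z - f (lam k)) / (z - lam k)))))
    \<longlongrightarrow> (C' p - f' \<cdot>\<^sub>m C p) $$ (i, j)) (at (lam p))" .
  have "\<forall>\<^sub>F z in at (lam p). (z - lam p) * M' $$ (i, j) + (\<Sum>k<N. ((z - lam p) / (z - lam k)) *
      (C' k $$ (i, j) - C k $$ (i, j) * ((f z - f (lam k)) / (z - lam k))))
    = ((z - lam p) \<cdot>\<^sub>m pole_sum_deriv n N M' C' C lam (\<lambda>k. f (lam k)) (f z) z) $$ (i, j)"
    using eventually_not_in_finite_range[of N lam]
  proof eventually_elim
    case (elim z)
    have "((z - lam p) / (z - lam k)) * (c' - c * (d / (z - lam k)))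
      = (z - lam p) * ((c' * (z - lam k) - c * d) / ((z - lam k) * (z - lam k)))" if "k < N" for k c c' d
    proof -
      have "z - lam k \<noteq> 0" using elim that by auto
      then show ?thesis by (simp add: field_simps)
    qed
    then show ?case using ij by (simp add: pole_sum_deriv_def distrib_left sum_distrib_left)
  qed
  with lim show "((\<lambda>z. ((z - lam p) \<cdot>\<^sub>m pole_sum_deriv n N M' C' C lam (\<lambda>k. f (lam k)) (f z) z) $$ (i, j))
    \<longlongrightarrow> (C' p - f' \<cdot>\<^sub>m C p) $$ (i, j)) (at (lam p))"
    by (rule Lim_transform_eventually)
qed (simp add: pole_sum_deriv_def)

lemma pole_sum_deriv_tendsto_regular:
  assumes w: "\<And>k. k < N \<Longrightarrow> w \<noteq> lam k" and f: "isCont f w"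
  shows "mat_tendsto n n (\<lambda>z. pole_sum_deriv n N M' C' C lam lam' (f z) z)
    (pole_sum_deriv n N M' C' C lam lam' (f w) w) (at w)"
proof (rule mat_tendstoI)
  fix i j assume ij: "i < n" "j < n"
  have "(f \<longlongrightarrow> f w) (at w)" using f by (simp add: isCont_def)
  then have "((\<lambda>z. M' $$ (i, j) + (\<Sum>k<N. (C' k $$ (i, j) * (z - lam k) - C k $$ (i, j) * (f z - lam' k))
      / ((z - lam k) * (z - lam k)))) \<longlongrightarrow>
    M' $$ (i, j) + (\<Sum>k<N. (C' k $$ (i, j) * (w - lam k) - C k $$ (i, j) * (f w - lam' k))
      / ((w - lam k) * (w - lam k)))) (at w)"
    using w by (intro tendsto_intros) auto
  then show "((\<lambda>z. pole_sum_deriv n N M' C' C lam lam' (f z) z $$ (i, j)) \<longlongrightarrow>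
    pole_sum_deriv n N M' C' C lam lam' (f w) w $$ (i, j)) (at w)"
    using ij by (simp add: pole_sum_deriv_def)
qed (auto simp: pole_sum_deriv_def)

text \<open>Brings \<open>\<N> * F\<close> into the form of a sum of simple poles with residues
  \<open>\<N> * A k\<close>, to which \<open>has_mat_derivative_poles\<close> applies.\<close>

lemma mult_pole_sum_index:
  assumes X: "X \<in> carrier_mat n n" and A: "\<And>k. k < N \<Longrightarrow> A k \<in> carrier_mat n n" and ij: "i < n" "j < n"
  shows "(X * pole_sum n N A lam z) $$ (i, j) = X $$ (i, j) + (\<Sum>k<N. (X * A k) $$ (i, j) / (z - lam k))"
proof -
  have "X * pole_sum n N A lam z = X * 1\<^sub>m n + X * rect_sum n n (\<lambda>k. (1 / (z - lam k)) \<cdot>\<^sub>m A k) {..<N}"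
    unfolding pole_sum_def mat_sum_eq_rect_sum
    by (rule mult_add_distrib_mat[OF X one_carrier_mat rect_sum_carrier])
  also have "\<dots> = X + rect_sum n n (\<lambda>k. (1 / (z - lam k)) \<cdot>\<^sub>m (X * A k)) {..<N}"
    using X A by (subst mult_rect_sum[OF X]) (auto simp: mult_smult_distrib[OF X A] intro!: rect_sum_cong)
  also have "\<dots> $$ (i, j) = X $$ (i, j) + (\<Sum>k<N. ((1 / (z - lam k)) \<cdot>\<^sub>m (X * A k)) $$ (i, j))"
    using ij X by simp
  also have "(\<Sum>k<N. ((1 / (z - lam k)) \<cdot>\<^sub>m (X * A k)) $$ (i, j)) = (\<Sum>k<N. (X * A k) $$ (i, j) / (z - lam k))"
  proof (intro sum.cong refl)
    fix k assume "k \<in> {..<N}"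
    then have "dim_row (A k) = n" "dim_col (A k) = n" using A[of k] by auto
    then show "((1 / (z - lam k)) \<cdot>\<^sub>m (X * A k)) $$ (i, j) = (X * A k) $$ (i, j) / (z - lam k)"
      using ij X by (simp del: index_mult_mat(1))
  qed
  finally show ?thesis .
qed

lemma Basis_axis:
  assumes "h \<in> (Basis :: (real ^ 'm::finite) set)"
  obtains \<nu> where "h = axis \<nu> 1"
  using assms by (auto simp: Basis_vec_def)

section \<open>Darboux matrices\<close>

locale darboux_pair =
  fixes n N :: nat
    and \<Omega> :: "(real ^ 'm::finite) set"
    and W :: "((real ^ 'm) \<times> complex) set"
    and L :: "'m \<Rightarrow> real ^ 'm \<Rightarrow> complex \<Rightarrow> complex"
    and U :: "'m \<Rightarrow> real ^ 'm \<Rightarrow> complex \<Rightarrow> complex mat"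
    and \<Psi> D Dinv :: "real ^ 'm \<Rightarrow> complex \<Rightarrow> complex mat"
    and \<N> :: "real ^ 'm \<Rightarrow> complex mat"
    and A B :: "nat \<Rightarrow> real ^ 'm \<Rightarrow> complex mat"
    and lam mu :: "nat \<Rightarrow> real ^ 'm \<Rightarrow> complex"
    and rA rB :: "nat \<Rightarrow> nat"
  assumes domain: "open \<Omega>" "\<Omega> \<noteq> {}" "connected \<Omega>"
    and U_carrier: "\<And>\<nu> x z. x \<in> \<Omega> \<Longrightarrow> U \<nu> x z \<in> carrier_mat n n"
    and W_open: "open W"
    and U_regular: "\<And>\<nu> x z. (x, z) \<in> W \<Longrightarrow> mat_regular_at n (U \<nu> x) z"
    and L_regular: "\<And>\<nu> x z. (x, z) \<in> W \<Longrightarrow> L \<nu> x analytic_on {z}"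
    and Psi_carrier: "\<And>x z. (x, z) \<in> W \<Longrightarrow> \<Psi> x z \<in> carrier_mat n n"
    and Psi_differentiable:
      "\<And>x z. (x, z) \<in> W \<Longrightarrow> mat_differentiable n (\<lambda>(y, w). \<Psi> y w) (x, z)"
    and Psi_invertible: "\<And>x z. (x, z) \<in> W \<Longrightarrow> invertible_mat (\<Psi> x z)"
    and linear_problem:
      "\<And>\<nu> x z. (x, z) \<in> W \<Longrightarrow> mat_total_deriv n L \<nu> \<Psi> x z = U \<nu> x z * \<Psi> x z"
    and lam_in_W: "\<And>k x. k < N \<Longrightarrow> x \<in> \<Omega> \<Longrightarrow> (x, lam k x) \<in> W"
    and mu_in_W: "\<And>k x. k < N \<Longrightarrow> x \<in> \<Omega> \<Longrightarrow> (x, mu k x) \<in> W"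
    and lam_distinct:
      "\<And>k j x. k < N \<Longrightarrow> j < N \<Longrightarrow> k \<noteq> j \<Longrightarrow> x \<in> \<Omega> \<Longrightarrow> lam k x \<noteq> lam j x"
    and mu_distinct:
      "\<And>k j x. k < N \<Longrightarrow> j < N \<Longrightarrow> k \<noteq> j \<Longrightarrow> x \<in> \<Omega> \<Longrightarrow> mu k x \<noteq> mu j x"
    and lam_mu_distinct: "\<And>k j x. k < N \<Longrightarrow> j < N \<Longrightarrow> x \<in> \<Omega> \<Longrightarrow> lam k x \<noteq> mu j x"
    and lam_differentiable: "\<And>k x. k < N \<Longrightarrow> x \<in> \<Omega> \<Longrightarrow> lam k differentiable (at x)"
    and mu_differentiable: "\<And>k x. k < N \<Longrightarrow> x \<in> \<Omega> \<Longrightarrow> mu k differentiable (at x)"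
    and lam_deriv:
      "\<And>k \<nu> x. k < N \<Longrightarrow> x \<in> \<Omega> \<Longrightarrow> partial_deriv \<nu> (lam k) x = L \<nu> x (lam k x)"
    and mu_deriv:
      "\<And>k \<nu> x. k < N \<Longrightarrow> x \<in> \<Omega> \<Longrightarrow> partial_deriv \<nu> (mu k) x = L \<nu> x (mu k x)"
    and A_carrier: "\<And>k x. k < N \<Longrightarrow> x \<in> \<Omega> \<Longrightarrow> A k x \<in> carrier_mat n n"
    and B_carrier: "\<And>k x. k < N \<Longrightarrow> x \<in> \<Omega> \<Longrightarrow> B k x \<in> carrier_mat n n"
    and A_differentiable: "\<And>k x. k < N \<Longrightarrow> x \<in> \<Omega> \<Longrightarrow> mat_differentiable n (A k) x"
    and B_differentiable: "\<And>k x. k < N \<Longrightarrow> x \<in> \<Omega> \<Longrightarrow> mat_differentiable n (B k) x"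
    and A_rank: "\<And>k x. k < N \<Longrightarrow> x \<in> \<Omega> \<Longrightarrow> vec_space.rank n (A k x) = rA k"
    and B_rank: "\<And>k x. k < N \<Longrightarrow> x \<in> \<Omega> \<Longrightarrow> vec_space.rank n (B k x) = rB k"
    and N_carrier: "\<And>x. x \<in> \<Omega> \<Longrightarrow> \<N> x \<in> carrier_mat n n"
    and N_differentiable: "\<And>x. x \<in> \<Omega> \<Longrightarrow> mat_differentiable n \<N> x"
    and N_det: "\<And>x. x \<in> \<Omega> \<Longrightarrow> Determinant.det (\<N> x) \<noteq> 0"
    and D_form: "\<And>x z. x \<in> \<Omega> \<Longrightarrow> (\<forall>k<N. z \<noteq> lam k x) \<Longrightarrow>
      D x z = \<N> x * pole_sum n N (\<lambda>k. A k x) (\<lambda>k. lam k x) z"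
    and Dinv_form: "\<And>x z. x \<in> \<Omega> \<Longrightarrow> (\<forall>k<N. z \<noteq> mu k x) \<Longrightarrow>
      Dinv x z = pole_sum n N (\<lambda>k. B k x) (\<lambda>k. mu k x) z * matinv (\<N> x)"
    and D_Dinv: "\<And>x z. x \<in> \<Omega> \<Longrightarrow> (\<forall>k<N. z \<noteq> lam k x \<and> z \<noteq> mu k x) \<Longrightarrow>
      inverts_mat (D x z) (Dinv x z) \<and> inverts_mat (Dinv x z) (D x z)"
    and darboux: "\<And>\<nu> x z. x \<in> \<Omega> \<Longrightarrow>
      mat_pole n (transformed n L D Dinv U \<nu> x) z \<longleftrightarrow> mat_pole n (U \<nu> x) z"
begin

section \<open>Pointwise inverses, derivatives and residue equations\<close>

lemma N_inverse:
  assumes "x \<in> \<Omega>"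
  shows "matinv (\<N> x) \<in> carrier_mat n n" "\<N> x * matinv (\<N> x) = 1\<^sub>m n" "matinv (\<N> x) * \<N> x = 1\<^sub>m n"
proof -
  obtain X where X: "X \<in> carrier_mat n n" "\<N> x * X = 1\<^sub>m n" "X * \<N> x = 1\<^sub>m n"
    using det_nonzero_inverse[OF N_carrier[OF assms] N_det[OF assms]] by blast
  have "matinv (\<N> x) = X" by (rule matinv_eq[OF N_carrier[OF assms] X(1,2)])
  then show "matinv (\<N> x) \<in> carrier_mat n n" "\<N> x * matinv (\<N> x) = 1\<^sub>m n" "matinv (\<N> x) * \<N> x = 1\<^sub>m n"
    using X by auto
qed

abbreviation "F x \<equiv> pole_sum n N (\<lambda>k. A k x) (\<lambda>k. lam k x)"
abbreviation "E x \<equiv> pole_sum n N (\<lambda>k. B k x) (\<lambda>k. mu k x)"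

lemma inj: "x \<in> \<Omega> \<Longrightarrow> inj_on (\<lambda>k. lam k x) {..<N}" "x \<in> \<Omega> \<Longrightarrow> inj_on (\<lambda>k. mu k x) {..<N}"
  using lam_distinct mu_distinct by (auto simp: inj_on_def) blast+

lemma pair:
  assumes x: "x \<in> \<Omega>"
  shows "pole_sum_pair n N (\<lambda>k. A k x) (\<lambda>k. B k x) (\<lambda>k. lam k x) (\<lambda>k. mu k x)"
proof
  fix z assume z: "\<forall>k<N. z \<noteq> lam k x \<and> z \<noteq> mu k x"
  note Nx = N_carrier[OF x] N_inverse[OF x]
  have eq: "D x z = \<N> x * F x z" "Dinv x z = E x z * matinv (\<N> x)"
    using z D_form[OF x] Dinv_form[OF x] by auto
  have dims: "dim_row (D x z) = n" "dim_row (Dinv x z) = n" using Nx by (auto simp: eq)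
  then have inv: "D x z * Dinv x z = 1\<^sub>m n" "Dinv x z * D x z = 1\<^sub>m n"
    using D_Dinv[OF x z] by (auto simp: inverts_mat_def)
  have "F x z * E x z = matinv (\<N> x) * (D x z * Dinv x z) * \<N> x"
    using Nx by (simp add: eq mult_mat_assoc mult_mat_cancel[OF Nx(4)])
  then show "F x z * E x z = 1\<^sub>m n" using Nx by (simp add: inv)
  have "E x z * F x z = Dinv x z * D x z"
    using Nx by (simp add: eq mult_mat_assoc mult_mat_cancel[OF Nx(4)])
  then show "E x z * F x z = 1\<^sub>m n" by (simp add: inv)
qed (use A_carrier B_carrier inj lam_mu_distinct x in auto)

lemma spectral_param_deriv:
  assumes "sp differentiable (at x)" "\<And>\<nu>. partial_deriv \<nu> sp x = L \<nu> x (sp x)"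
  obtains sp' where "(sp has_derivative sp') (at x)" "\<And>\<nu>. sp' (axis \<nu> 1) = L \<nu> x (sp x)"
  using assms by (auto simp: frechet_derivative_works partial_deriv_def)

text \<open>Since \<open>sp\<close> follows the field \<open>L\<close>, the derivative of y -> (y,
  sp y) sends \<open>axis \<nu> 1\<close> to the very vector used in \<open>total_deriv\<close>. The
  chain rule thus restricts the linear problem to the graph of \<open>sp\<close>; it is applied to
  \<open>lam k\<close> and \<open>mu k\<close>.\<close>

lemma Psi_along:
  assumes sp: "(x, sp x) \<in> W" "(sp has_derivative sp') (at x)" "\<And>\<nu>. sp' (axis \<nu> 1) = L \<nu> x (sp x)"
  obtains P' where "has_mat_derivative n n (\<lambda>y. \<Psi> y (sp y)) P' x"
    "\<And>\<nu>. P' (axis \<nu> 1) = U \<nu> x (sp x) * \<Psi> x (sp x)"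
proof -
  obtain Q' where Q': "has_mat_derivative n n (\<lambda>(y, w). \<Psi> y w) Q' (x, sp x)"
    using mat_differentiable_has_mat_derivative[OF W_open sp(1) _ Psi_differentiable[OF sp(1)]]
      Psi_carrier by (metis (no_types, lifting) case_prod_conv surj_pair)
  have "((\<lambda>y. (y, sp y)) has_derivative (\<lambda>h. (h, sp' h))) (at x)"
    by (intro has_derivative_Pair has_derivative_ident sp)
  from has_mat_derivative_compose[OF Q' this]
  have "has_mat_derivative n n (\<lambda>y. \<Psi> y (sp y)) (\<lambda>h. Q' (h, sp' h)) x" by simp
  moreover have "Q' (axis \<nu> 1, sp' (axis \<nu> 1)) = U \<nu> x (sp x) * \<Psi> x (sp x)" for \<nu>
    using mat_total_deriv_eq[OF Q', of L \<nu>] linear_problem[OF sp(1), of \<nu>] sp(3) by simp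
  ultimately show thesis by (rule that)
qed

text \<open>The derivatives of \<open>\<N>\<close>, of the residues \<open>\<N> * A k\<close> and of
  the poles are chosen once for all z and all directions, so that limits in z can be taken in the
  resulting formula.\<close>

lemma D_derivative:
  assumes x: "x \<in> \<Omega>"
  shows "\<exists>M' C' lam'. has_mat_derivative n n \<N> M' x \<and>
    (\<forall>k<N. has_mat_derivative n n (\<lambda>y. \<N> y * A k y) (C' k) x) \<and>
    (\<forall>z. (\<forall>k<N. z \<noteq> lam k x) \<longrightarrow> has_mat_derivative n n (\<lambda>(y, w). D y w)
      (\<lambda>(h, s). pole_sum_deriv n N (M' h) (\<lambda>k. C' k h) (\<lambda>k. \<N> x * A k x) (\<lambda>k. lam k x) (\<lambda>k. lam' k h) s z) (x, z)) \<and>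
    (\<forall>\<nu> z. (\<forall>k<N. z \<noteq> lam k x) \<longrightarrow> mat_total_deriv n L \<nu> D x z
      = pole_sum_deriv n N (M' (axis \<nu> 1)) (\<lambda>k. C' k (axis \<nu> 1)) (\<lambda>k. \<N> x * A k x) (\<lambda>k. lam k x)
          (\<lambda>k. L \<nu> x (lam k x)) (L \<nu> x z) z)"
proof -
  obtain M' where M': "has_mat_derivative n n \<N> M' x"
    using mat_differentiable_has_mat_derivative[OF domain(1) x N_carrier N_differentiable[OF x]] by blast
  have "\<exists>C'. has_mat_derivative n n (\<lambda>y. \<N> y * A k y) C' x" if k: "k < N" for k
  proof -
    obtain A' where A': "has_mat_derivative n n (A k) A' x"
      using mat_differentiable_has_mat_derivative[OF domain(1) x A_carrier[OF k] A_differentiable[OF k x]] by blast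
    show ?thesis using has_mat_derivative_mult[OF M' A'] by blast
  qed
  then obtain C' where C': "\<And>k. k < N \<Longrightarrow> has_mat_derivative n n (\<lambda>y. \<N> y * A k y) (C' k) x"
    by metis
  have "\<exists>l'. (lam k has_derivative l') (at x) \<and> (\<forall>\<nu>. l' (axis \<nu> 1) = L \<nu> x (lam k x))" if k: "k < N" for k
    using spectral_param_deriv[OF lam_differentiable[OF k x] lam_deriv[OF k x]] by blast
  then obtain lam' where lam': "\<And>k. k < N \<Longrightarrow> (lam k has_derivative lam' k) (at x)"
    "\<And>k \<nu>. k < N \<Longrightarrow> lam' k (axis \<nu> 1) = L \<nu> x (lam k x)" by metis
  have D': "has_mat_derivative n n (\<lambda>(y, w). D y w)
      (\<lambda>(h, s). pole_sum_deriv n N (M' h) (\<lambda>k. C' k h) (\<lambda>k. \<N> x * A k x) (\<lambda>k. lam k x) (\<lambda>k. lam' k h) s z) (x, z)"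
    if z: "\<forall>k<N. z \<noteq> lam k x" for z
  proof (rule has_mat_derivative_poles[OF domain(1) x M' C' lam'(1)])
    fix y w i j assume y: "y \<in> \<Omega>" and w: "\<forall>k<N. w \<noteq> lam k y"
    show "D y w \<in> carrier_mat n n"
      unfolding D_form[OF y w] using N_carrier[OF y] by auto
    assume ij: "i < n" "j < n"
    show "D y w $$ (i, j) = \<N> y $$ (i, j) + (\<Sum>k<N. (\<N> y * A k y) $$ (i, j) / (w - lam k y))"
      unfolding D_form[OF y w] by (rule mult_pole_sum_index[OF N_carrier[OF y] A_carrier[OF _ y] ij])
  qed (use z in auto)
  have "mat_total_deriv n L \<nu> D x z
      = pole_sum_deriv n N (M' (axis \<nu> 1)) (\<lambda>k. C' k (axis \<nu> 1)) (\<lambda>k. \<N> x * A k x) (\<lambda>k. lam k x)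
          (\<lambda>k. L \<nu> x (lam k x)) (L \<nu> x z) z" if z: "\<forall>k<N. z \<noteq> lam k x" for \<nu> z
    using mat_total_deriv_eq[OF D'[OF z], of L \<nu>] lam'(2) by (simp add: pole_sum_deriv_def)
  with M' C' D' show ?thesis
    by (intro exI[of _ M'] exI[of _ C'] exI[of _ lam']) simp
qed

text \<open>The Darboux property enters here: poles of the transformed matrix are poles of
  \<open>U\<close>, and \<open>U\<close> has none in \<open>W\<close>, which contains all points (x,
  lam_k) and (x, mu_k).\<close>

lemma transformed_regular:
  assumes "x \<in> \<Omega>" "(x, z) \<in> W"
  shows "\<not> mat_pole n (transformed n L D Dinv U \<nu> x) z"
  using darboux[OF assms(1)] mat_regular_at_no_pole[OF U_regular[OF assms(2)]] by simp

text \<open>The derivative of D contains the term \<open>C\<^sub>k (L(z) - L(\<lambda>\<^sub>k)) / (z - \<lambda>\<^sub>k)\<^sup>2\<close> with \<open>C\<^sub>k = \<N> A\<^sub>k\<close>. As L is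
  regular at \<open>\<lambda>\<^sub>k\<close> this is only a simple pole, and its residue, a multiple of \<open>C\<^sub>k\<close>, is annihilated by \<open>E(\<lambda>\<^sub>k)\<close>.\<close>

lemma left_residue:
  assumes x: "x \<in> \<Omega>" and k: "k < N"
    and C1: "has_mat_derivative n n (\<lambda>y. \<N> y * A k y) C1 x"
  obtains X where "X \<in> carrier_mat n n"
    "C1 (axis \<nu> 1) + \<N> x * A k x * U \<nu> x (lam k x) = X * (\<N> x * A k x)"
proof -
  interpret p: pole_sum_pair n N "\<lambda>k. A k x" "\<lambda>k. B k x" "\<lambda>k. lam k x" "\<lambda>k. mu k x" using x by (rule pair)
  obtain M' C' lam' where C'0: "\<forall>k<N. has_mat_derivative n n (\<lambda>y. \<N> y * A k y) (C' k) x"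
    and D1: "\<forall>z. (\<forall>k<N. z \<noteq> lam k x) \<longrightarrow> has_mat_derivative n n (\<lambda>(y, w). D y w)
      (\<lambda>(h, s). pole_sum_deriv n N (M' h) (\<lambda>k. C' k h) (\<lambda>k. \<N> x * A k x) (\<lambda>k. lam k x) (\<lambda>k. lam' k h) s z) (x, z)"
    and D'0: "\<forall>\<nu> z. (\<forall>k<N. z \<noteq> lam k x) \<longrightarrow> mat_total_deriv n L \<nu> D x z
      = pole_sum_deriv n N (M' (axis \<nu> 1)) (\<lambda>k. C' k (axis \<nu> 1)) (\<lambda>k. \<N> x * A k x) (\<lambda>k. lam k x)
          (\<lambda>k. L \<nu> x (lam k x)) (L \<nu> x z) z"
    using D_derivative[OF x] by blast
  note C' = C'0[THEN spec, THEN mp] and D1 = D1[THEN spec, THEN mp] and D' = D'0[THEN spec, THEN spec, THEN mp]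
  note Nx = N_carrier[OF x] N_inverse[OF x] and Ax = A_carrier[OF k x]
  let ?l = "lam k x" and ?Ni = "matinv (\<N> x)" and ?C = "\<N> x * A k x" and ?U = "U \<nu> x (lam k x)"
  have U: "?U \<in> carrier_mat n n" by (rule U_carrier[OF x])
  have C'c: "C' k (axis \<nu> 1) \<in> carrier_mat n n" using C'[OF k] by (rule has_mat_derivativeD)
  have C1c: "C1 (axis \<nu> 1) = C' k (axis \<nu> 1)" by (rule has_mat_derivative_unique[OF C1 C'[OF k]])
  obtain d where d: "(L \<nu> x has_field_derivative d) (at ?l)"
    using analytic_on_imp_differentiable_at[OF L_regular[OF lam_in_W[OF k x]]]
    by (auto simp: field_differentiable_def)
  have lims: "mat_tendsto n n (\<lambda>z. (z - ?l) \<cdot>\<^sub>m pole_sum_deriv n N (M' (axis \<nu> 1)) (\<lambda>k. C' k (axis \<nu> 1))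
      (\<lambda>k. \<N> x * A k x) (\<lambda>k. lam k x) (\<lambda>k. L \<nu> x (lam k x)) (L \<nu> x z) z) (C' k (axis \<nu> 1) - d \<cdot>\<^sub>m ?C) (at ?l)"
    using Nx A_carrier[OF _ x] by (intro pole_sum_deriv_tendsto_pole[OF _ _ inj(1)[OF x] k d])
      (auto intro: has_mat_derivativeD(1)[OF C'])
  have Dl: "mat_tendsto n n (\<lambda>z. \<N> x * ((z - ?l) \<cdot>\<^sub>m F x z)) ?C (at ?l)"
    by (intro mat_tendsto_mult[of _ n] mat_tendsto_const Nx(1))
      (rule pole_sum_tendsto_pole[OF A_carrier[OF _ x] inj(1)[OF x] k])
  have El: "mat_tendsto n n (\<lambda>z. E x z * ?Ni) (E x ?l * ?Ni) (at ?l)"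
    by (intro mat_tendsto_mult[of _ n] mat_tendsto_const Nx(2))
      (rule pole_sum_tendsto_regular[OF B_carrier[OF _ x]], auto simp: lam_mu_distinct k x)
  have Ul: "mat_tendsto n n (U \<nu> x) ?U (at ?l)"
    by (rule mat_regular_at_tendsto[OF U_regular[OF lam_in_W[OF k x]] U_carrier[OF x]])
  \<comment> \<open>The residue of the transformed matrix at lam_k: the first summand comes from the
    derivative of D, the second from D U, both multiplied by the regular value of the inverse of
    D.\<close>
  let ?R = "(C' k (axis \<nu> 1) - d \<cdot>\<^sub>m ?C) * (E x ?l * ?Ni) + ?C * ?U * (E x ?l * ?Ni)"
  have "mat_tendsto n n (\<lambda>z. (z - ?l) \<cdot>\<^sub>m transformed n L D Dinv U \<nu> x z) ?R (at ?l)"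
  proof (rule mat_tendsto_cong[OF mat_tendsto_add[OF mat_tendsto_mult[OF lims El]
          mat_tendsto_mult[OF mat_tendsto_mult[OF Dl Ul] El]]])
    show "\<forall>\<^sub>F z in at ?l. (z - ?l) \<cdot>\<^sub>m pole_sum_deriv n N (M' (axis \<nu> 1)) (\<lambda>k. C' k (axis \<nu> 1))
      (\<lambda>k. \<N> x * A k x) (\<lambda>k. lam k x) (\<lambda>k. L \<nu> x (lam k x)) (L \<nu> x z) z * (E x z * ?Ni)
      + \<N> x * ((z - ?l) \<cdot>\<^sub>m F x z) * U \<nu> x z * (E x z * ?Ni)
      = (z - ?l) \<cdot>\<^sub>m transformed n L D Dinv U \<nu> x z"
      using p.eventually_regular
    proof eventually_elim
      case (elim z)
      then have z: "\<forall>k<N. z \<noteq> lam k x" "\<forall>k<N. z \<noteq> mu k x" by auto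
      let ?D' = "mat_total_deriv n L \<nu> D x z"
      have D'c: "?D' \<in> carrier_mat n n" by (simp add: mat_total_deriv_def)
      have Uz: "U \<nu> x z \<in> carrier_mat n n" by (rule U_carrier[OF x])
      have Ec: "E x z * ?Ni \<in> carrier_mat n n" and Fc: "\<N> x * F x z \<in> carrier_mat n n" using Nx by auto
      have "\<N> x * ((z - ?l) \<cdot>\<^sub>m F x z) = (z - ?l) \<cdot>\<^sub>m (\<N> x * F x z)"
        by (rule mult_smult_distrib[OF Nx(1) pole_sum_carrier])
      then have "\<N> x * ((z - ?l) \<cdot>\<^sub>m F x z) * U \<nu> x z * (E x z * ?Ni)
        = (z - ?l) \<cdot>\<^sub>m (\<N> x * F x z * U \<nu> x z * (E x z * ?Ni))"
        using mult_smult_assoc_mat[OF Fc Uz] mult_smult_assoc_mat[OF mult_carrier_mat[OF Fc Uz] Ec] by simp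
      moreover have "(z - ?l) \<cdot>\<^sub>m ?D' * (E x z * ?Ni) = (z - ?l) \<cdot>\<^sub>m (?D' * (E x z * ?Ni))"
        by (rule mult_smult_assoc_mat[OF D'c Ec])
      ultimately show ?case
        using add_smult_distrib_left_mat[OF mult_carrier_mat[OF D'c Ec]
            mult_carrier_mat[OF mult_carrier_mat[OF Fc Uz] Ec], of "z - ?l"]
        unfolding transformed_def D_form[OF x z(1)] Dinv_form[OF x z(2)] D'[OF z(1), symmetric] by simp
    qed
  qed
  from mat_no_pole_residue_zero[OF this transformed_regular[OF x lam_in_W[OF k x]]]
  have R: "?R = 0\<^sub>m n n" .
  let ?V = "C' k (axis \<nu> 1) + ?C * ?U"
  have CE: "?C * E x ?l = 0\<^sub>m n n"
    using p.residue_mult_zero(1)[OF k] Nx(1) Ax by (simp add: mult_mat_assoc)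
  have Vc: "?V \<in> carrier_mat n n" using C'c Nx(1) Ax U by auto
  have "?R * \<N> x = ?V * E x ?l"
  proof -
    have c: "?C \<in> carrier_mat n n" "d \<cdot>\<^sub>m ?C \<in> carrier_mat n n" "?C * ?U \<in> carrier_mat n n" "E x ?l \<in> carrier_mat n n"
      using Nx Ax U by auto
    have X: "C' k (axis \<nu> 1) - d \<cdot>\<^sub>m ?C \<in> carrier_mat n n" (is "?X \<in> _") by (rule minus_carrier_mat[OF c(2)])
    have EN: "E x ?l * ?Ni \<in> carrier_mat n n" by (rule mult_carrier_mat[OF c(4) Nx(2)])
    have "?X * E x ?l = C' k (axis \<nu> 1) * E x ?l - d \<cdot>\<^sub>m ?C * E x ?l"
      by (rule minus_mult_distrib_mat[OF C'c c(2,4)])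
    also have "d \<cdot>\<^sub>m ?C * E x ?l = d \<cdot>\<^sub>m (?C * E x ?l)" by (rule mult_smult_assoc_mat[OF c(1,4)])
    also have "\<dots> = 0\<^sub>m n n" unfolding CE by (rule smult_zero_mat)
    also have "C' k (axis \<nu> 1) * E x ?l - 0\<^sub>m n n = C' k (axis \<nu> 1) * E x ?l"
      by (rule minus_r_inv_zero[OF mult_carrier_mat[OF C'c c(4)]])
    finally have dC: "?X * E x ?l = C' k (axis \<nu> 1) * E x ?l" .
    have "?R * \<N> x = ?X * (E x ?l * ?Ni) * \<N> x + ?C * ?U * (E x ?l * ?Ni) * \<N> x"
      by (rule add_mult_distrib_mat[OF mult_carrier_mat[OF X EN] mult_carrier_mat[OF c(3) EN] Nx(1)])
    also have "\<dots> = ?X * E x ?l + ?C * ?U * E x ?l"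
      unfolding mult_inverse_cancel_right[OF X c(4) Nx(2,1,4)] mult_inverse_cancel_right[OF c(3,4) Nx(2,1,4)] ..
    also have "\<dots> = ?V * E x ?l"
      unfolding dC by (rule add_mult_distrib_mat[OF C'c c(3,4), symmetric])
    finally show ?thesis .
  qed
  then have "?V * E x ?l = 0\<^sub>m n n" unfolding R using Nx(1) by simp
  then obtain X where X: "X \<in> carrier_mat n n" "?V = X * A k x"
    using p.kernel_in_row_space[OF k Vc] by blast
  \<comment> \<open>The factorization through \<open>A k x\<close> is rewritten as one through
    \<open>\<N> x * A k x\<close>, the matrix being differentiated.\<close>
  have "X * A k x = X * ?Ni * ?C"
    using X Nx Ax by (simp add: mult_mat_assoc mult_mat_cancel[OF Nx(4)])
  then show thesis using that[of "X * ?Ni"] X Nx(2) unfolding C1c by auto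
qed

text \<open>Differentiating \<open>D(\<mu>\<^sub>k) B\<^sub>k = 0\<close> along \<open>\<mu>\<^sub>k\<close> replaces \<open>D,\<^sub>\<nu>(\<mu>\<^sub>k) B\<^sub>k\<close> by \<open>- D(\<mu>\<^sub>k) B\<^sub>k,\<^sub>\<nu>\<close>, so that the derivative of
  \<open>D\<^sup>-\<^sup>1\<close> is not needed.\<close>

lemma right_residue:
  assumes x: "x \<in> \<Omega>" and k: "k < N" and B1: "has_mat_derivative n n (B k) B1 x"
  obtains X where "X \<in> carrier_mat n n"
    "U \<nu> x (mu k x) * B k x - B1 (axis \<nu> 1) = B k x * X"
proof -
  interpret p: pole_sum_pair n N "\<lambda>k. A k x" "\<lambda>k. B k x" "\<lambda>k. lam k x" "\<lambda>k. mu k x" using x by (rule pair)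
  obtain M' C' lam' where C'0: "\<forall>k<N. has_mat_derivative n n (\<lambda>y. \<N> y * A k y) (C' k) x"
    and D1: "\<forall>z. (\<forall>k<N. z \<noteq> lam k x) \<longrightarrow> has_mat_derivative n n (\<lambda>(y, w). D y w)
      (\<lambda>(h, s). pole_sum_deriv n N (M' h) (\<lambda>k. C' k h) (\<lambda>k. \<N> x * A k x) (\<lambda>k. lam k x) (\<lambda>k. lam' k h) s z) (x, z)"
    and D'0: "\<forall>\<nu> z. (\<forall>k<N. z \<noteq> lam k x) \<longrightarrow> mat_total_deriv n L \<nu> D x z
      = pole_sum_deriv n N (M' (axis \<nu> 1)) (\<lambda>k. C' k (axis \<nu> 1)) (\<lambda>k. \<N> x * A k x) (\<lambda>k. lam k x)
          (\<lambda>k. L \<nu> x (lam k x)) (L \<nu> x z) z"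
    using D_derivative[OF x] by blast
  note C' = C'0[THEN spec, THEN mp] and D1 = D1[THEN spec, THEN mp] and D' = D'0[THEN spec, THEN spec, THEN mp]
  note Nx = N_carrier[OF x] N_inverse[OF x] and Bx = B_carrier[OF k x]
  let ?m = "mu k x" and ?Ni = "matinv (\<N> x)" and ?U = "U \<nu> x (mu k x)"
    and ?D' = "mat_total_deriv n L \<nu> D x"
  have m: "\<forall>k<N. ?m \<noteq> lam k x" using lam_mu_distinct k x by metis
  have U: "?U \<in> carrier_mat n n" by (rule U_carrier[OF x])
  have D'c: "?D' z \<in> carrier_mat n n" for z by (simp add: mat_total_deriv_def)
  have isc: "isCont (L \<nu> x) ?m" by (rule analytic_at_imp_isCont[OF L_regular[OF mu_in_W[OF k x]]])
  have ev: "\<forall>\<^sub>F z in at ?m. (\<forall>k<N. z \<noteq> lam k x) \<and> (\<forall>k<N. z \<noteq> mu k x)"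
    using p.eventually_regular by eventually_elim auto
  have Dm': "mat_tendsto n n ?D' (?D' ?m) (at ?m)"
    unfolding D'[OF m]
    by (rule mat_tendsto_cong[OF pole_sum_deriv_tendsto_regular[OF _ isc]])
      (use m ev in \<open>auto elim!: eventually_mono simp: D'\<close>)
  have Dm: "mat_tendsto n n (\<lambda>z. \<N> x * F x z) (\<N> x * F x ?m) (at ?m)"
    by (intro mat_tendsto_mult[of _ n] mat_tendsto_const Nx(1))
      (rule pole_sum_tendsto_regular[OF A_carrier[OF _ x]], use m in auto)
  have Em: "mat_tendsto n n (\<lambda>z. ((z - ?m) \<cdot>\<^sub>m E x z) * ?Ni) (B k x * ?Ni) (at ?m)"
    by (intro mat_tendsto_mult[of _ n] mat_tendsto_const Nx(2))
      (rule pole_sum_tendsto_pole[OF B_carrier[OF _ x] inj(2)[OF x] k])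
  have Um: "mat_tendsto n n (U \<nu> x) ?U (at ?m)"
    by (rule mat_regular_at_tendsto[OF U_regular[OF mu_in_W[OF k x]] U_carrier[OF x]])
  \<comment> \<open>At mu_k both D and its derivative are regular, so the pole comes from the
    inverse of D alone and the residue is \<open>?Q\<close> times
    \<open>B k x * ?Ni\<close>.\<close>
  let ?Q = "?D' ?m + \<N> x * F x ?m * ?U"
  have "mat_tendsto n n (\<lambda>z. (z - ?m) \<cdot>\<^sub>m transformed n L D Dinv U \<nu> x z) (?Q * (B k x * ?Ni)) (at ?m)"
  proof (rule mat_tendsto_cong[OF mat_tendsto_mult[OF mat_tendsto_add[OF Dm' mat_tendsto_mult[OF Dm Um]] Em]])
    show "\<forall>\<^sub>F z in at ?m. (?D' z + \<N> x * F x z * U \<nu> x z) * (((z - ?m) \<cdot>\<^sub>m E x z) * ?Ni)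
      = (z - ?m) \<cdot>\<^sub>m transformed n L D Dinv U \<nu> x z"
      using ev
    proof eventually_elim
      case (elim z)
      have Uz: "U \<nu> x z \<in> carrier_mat n n" by (rule U_carrier[OF x])
      have Ec: "E x z * ?Ni \<in> carrier_mat n n" and Fc: "\<N> x * F x z * U \<nu> x z \<in> carrier_mat n n"
        using Nx Uz by auto
      have "((z - ?m) \<cdot>\<^sub>m E x z) * ?Ni = (z - ?m) \<cdot>\<^sub>m (E x z * ?Ni)"
        by (rule mult_smult_assoc_mat[OF pole_sum_carrier Nx(2)])
      then have "(?D' z + \<N> x * F x z * U \<nu> x z) * (((z - ?m) \<cdot>\<^sub>m E x z) * ?Ni)
        = (z - ?m) \<cdot>\<^sub>m ((?D' z + \<N> x * F x z * U \<nu> x z) * (E x z * ?Ni))"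
        using mult_smult_distrib[OF add_carrier_mat[OF Fc] Ec] by simp
      also have "(?D' z + \<N> x * F x z * U \<nu> x z) * (E x z * ?Ni) = transformed n L D Dinv U \<nu> x z"
        using elim by (simp add: transformed_def D_form[OF x] Dinv_form[OF x] add_mult_distrib_mat[OF D'c Fc Ec])
      finally show ?case .
    qed
  qed
  from mat_no_pole_residue_zero[OF this transformed_regular[OF x mu_in_W[OF k x]]]
  have R: "?Q * (B k x * ?Ni) = 0\<^sub>m n n" .
  have Qc: "?Q \<in> carrier_mat n n" using D'c Nx U by auto
  have "?Q * B k x = ?Q * (B k x * ?Ni) * \<N> x"
    by (rule mult_inverse_cancel_right[OF Qc Bx Nx(2,1,4), symmetric])
  then have QB: "?Q * B k x = 0\<^sub>m n n" unfolding R using Nx(1) by simp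
  obtain mu' where mu': "(mu k has_derivative mu') (at x)" "\<And>\<nu>. mu' (axis \<nu> 1) = L \<nu> x ?m"
    using spectral_param_deriv[OF mu_differentiable[OF k x] mu_deriv[OF k x]] by blast
  have "((\<lambda>y. (y, mu k y)) has_derivative (\<lambda>h. (h, mu' h))) (at x)"
    by (intro has_derivative_Pair has_derivative_ident mu')
  from has_mat_derivative_compose[where g = "\<lambda>y. (y, mu k y)", OF D1[OF m] this]
  obtain T where T: "has_mat_derivative n n (\<lambda>y. D y (mu k y)) T x" "T (axis \<nu> 1) = ?D' ?m"
    using mat_total_deriv_eq[OF D1[OF m], of L \<nu>] mu'(2)[of \<nu>] by auto
  have B1c: "B1 (axis \<nu> 1) \<in> carrier_mat n n" using B1 by (rule has_mat_derivativeD)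
  have Dmm: "D x ?m = \<N> x * F x ?m" by (rule D_form[OF x m])
  \<comment> \<open>F(mu_k) B_k = 0 at every nearby point; along the moving point mu_k the product
    is constantly zero, so its derivative D,nu B_k + D B_k,nu vanishes too.\<close>
  have "\<forall>\<^sub>F y in nhds x. D y (mu k y) * B k y = 0\<^sub>m n n"
    using eventually_nhds_in_open[OF domain(1) x]
  proof eventually_elim
    case (elim y)
    interpret q: pole_sum_pair n N "\<lambda>k. A k y" "\<lambda>k. B k y" "\<lambda>k. lam k y" "\<lambda>k. mu k y" using elim by (rule pair)
    have "\<forall>j<N. mu k y \<noteq> lam j y" using lam_mu_distinct k elim by metis
    then show ?case
      using q.residue_mult_zero_dual(2)[OF k] N_carrier[OF elim] B_carrier[OF k elim]
      by (simp add: D_form[OF elim] mult_mat_assoc)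
  qed
  from has_mat_derivative_unique[OF has_mat_derivative_cong[OF has_mat_derivative_mult[OF T(1) B1] this]
      has_mat_derivative_const[OF zero_carrier_mat]]
  have zero: "?D' ?m * B k x + \<N> x * F x ?m * B1 (axis \<nu> 1) = 0\<^sub>m n n" unfolding T(2)[symmetric] Dmm[symmetric] .
  let ?V = "?U * B k x - B1 (axis \<nu> 1)"
  have Vc: "?V \<in> carrier_mat n n" using U Bx B1c by (intro minus_carrier_mat) auto
  have Fc: "\<N> x * F x ?m \<in> carrier_mat n n" using Nx by auto
  \<comment> \<open>Adding and subtracting D,nu(mu_k) B_k writes D(mu_k) (U B_k - B_k,nu) as the
    vanishing residue \<open>?Q * B k x\<close> minus the vanishing derivative in
    \<open>zero\<close>.\<close>
  have "\<N> x * F x ?m * ?V = \<N> x * F x ?m * (?U * B k x) - \<N> x * F x ?m * B1 (axis \<nu> 1)"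
    by (rule mult_minus_distrib_mat[OF Fc mult_carrier_mat[OF U Bx] B1c])
  also have "\<N> x * F x ?m * (?U * B k x) = \<N> x * F x ?m * ?U * B k x"
    by (rule assoc_mult_mat[OF Fc U Bx, symmetric])
  also have "\<dots> - \<N> x * F x ?m * B1 (axis \<nu> 1)
    = (?D' ?m * B k x + \<N> x * F x ?m * ?U * B k x) - (?D' ?m * B k x + \<N> x * F x ?m * B1 (axis \<nu> 1))"
    by (intro eq_matI) (use Fc D'c[of ?m] U Bx B1c in \<open>auto simp del: index_mult_mat(1)\<close>)
  also have "?D' ?m * B k x + \<N> x * F x ?m * ?U * B k x = ?Q * B k x"
    by (rule add_mult_distrib_mat[OF D'c mult_carrier_mat[OF Fc U] Bx, symmetric])
  finally have "\<N> x * F x ?m * ?V = 0\<^sub>m n n" unfolding zero QB by auto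
  then have "?Ni * (\<N> x * F x ?m * ?V) = 0\<^sub>m n n" using Nx(2) by simp
  moreover have "?Ni * (\<N> x * F x ?m * ?V) = F x ?m * ?V"
    unfolding assoc_mult_mat[OF Nx(1) pole_sum_carrier Vc]
    by (rule mult_mat_cancel[OF Nx(4)]) (use Nx in simp_all)
  ultimately have "F x ?m * ?V = 0\<^sub>m n n" by simp
  then show thesis using p.kernel_in_col_space[OF k Vc] that by blast
qed

section \<open>Constancy of the row and column spaces\<close>

lemma Psi_inverse:
  assumes "(x, z) \<in> W"
  shows "matinv (\<Psi> x z) \<in> carrier_mat n n" "\<Psi> x z * matinv (\<Psi> x z) = 1\<^sub>m n"
    "matinv (\<Psi> x z) * \<Psi> x z = 1\<^sub>m n"
  using matinv_inverse[OF Psi_carrier[OF assms] Psi_invertible[OF assms]] by auto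

text \<open>With C = \<open>\<N> * A k\<close>, the product rule and the linear problem give (C
  Psi),nu = (C,nu + C U) Psi, and \<open>left_residue\<close> writes the bracket as X C.\<close>

lemma left_derivative:
  assumes x: "x \<in> \<Omega>" and k: "k < N"
  shows "\<exists>G'. has_mat_derivative n n (\<lambda>y. \<N> y * A k y * \<Psi> y (lam k y)) G' x \<and>
    (\<forall>\<nu>. \<exists>C\<in>carrier_mat n n. G' (axis \<nu> 1) = C * (\<N> x * A k x * \<Psi> x (lam k x)))"
proof -
  have W: "(x, lam k x) \<in> W" by (rule lam_in_W[OF k x])
  obtain C1 where C1: "has_mat_derivative n n (\<lambda>y. \<N> y * A k y) C1 x"
    using D_derivative[OF x] k by blast
  obtain lam' where lam': "(lam k has_derivative lam') (at x)" "\<And>\<nu>. lam' (axis \<nu> 1) = L \<nu> x (lam k x)"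
    using spectral_param_deriv[OF lam_differentiable[OF k x] lam_deriv[OF k x]] by blast
  obtain P' where P': "has_mat_derivative n n (\<lambda>y. \<Psi> y (lam k y)) P' x"
    "\<And>\<nu>. P' (axis \<nu> 1) = U \<nu> x (lam k x) * \<Psi> x (lam k x)"
    using Psi_along[OF W lam'] by blast
  let ?C = "\<N> x * A k x" and ?P = "\<Psi> x (lam k x)"
  have c: "?C \<in> carrier_mat n n" "?P \<in> carrier_mat n n"
    using N_carrier[OF x] A_carrier[OF k x] Psi_carrier[OF W] by auto
  have "\<exists>C\<in>carrier_mat n n. C1 (axis \<nu> 1) * ?P + ?C * P' (axis \<nu> 1) = C * (?C * ?P)" for \<nu>
  proof -
    have U: "U \<nu> x (lam k x) \<in> carrier_mat n n" by (rule U_carrier[OF x])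
    obtain X where X: "X \<in> carrier_mat n n" "C1 (axis \<nu> 1) + ?C * U \<nu> x (lam k x) = X * ?C"
      using left_residue[OF x k C1] by blast
    have "C1 (axis \<nu> 1) * ?P + ?C * P' (axis \<nu> 1) = C1 (axis \<nu> 1) * ?P + ?C * U \<nu> x (lam k x) * ?P"
      unfolding P'(2) assoc_mult_mat[OF c(1) U c(2)] ..
    also have "\<dots> = X * ?C * ?P"
      unfolding X(2)[symmetric]
      by (rule add_mult_distrib_mat[OF has_mat_derivativeD(1)[OF C1] mult_carrier_mat[OF c(1) U] c(2), symmetric])
    finally show ?thesis using X(1) assoc_mult_mat[OF X(1) c] by auto
  qed
  then show ?thesis using has_mat_derivative_mult[OF C1 P'(1)] by blast
qed

text \<open>For Y = Psi^-1 B, differentiating Psi Y = B gives Psi Y,nu = - (U B - B,nu) = - B X by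
  \<open>right_residue\<close>, hence Y,nu = - Y X. The transpose puts the coefficient on the left,
  as the row space argument requires.\<close>

lemma right_derivative:
  assumes x: "x \<in> \<Omega>" and k: "k < N"
  shows "\<exists>Y'. has_mat_derivative n n (\<lambda>y. (matinv (\<Psi> y (mu k y)) * B k y)\<^sup>T) Y' x \<and>
    (\<forall>\<nu>. \<exists>C\<in>carrier_mat n n. Y' (axis \<nu> 1) = C * (matinv (\<Psi> x (mu k x)) * B k x)\<^sup>T)"
proof -
  have W: "(y, mu k y) \<in> W" if "y \<in> \<Omega>" for y by (rule mu_in_W[OF k that])
  obtain B1 where B1: "has_mat_derivative n n (B k) B1 x"
    using mat_differentiable_has_mat_derivative[OF domain(1) x B_carrier[OF k] B_differentiable[OF k x]] by blast
  obtain mu' where mu': "(mu k has_derivative mu') (at x)" "\<And>\<nu>. mu' (axis \<nu> 1) = L \<nu> x (mu k x)"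
    using spectral_param_deriv[OF mu_differentiable[OF k x] mu_deriv[OF k x]] by blast
  obtain P' where P': "has_mat_derivative n n (\<lambda>y. \<Psi> y (mu k y)) P' x"
    "\<And>\<nu>. P' (axis \<nu> 1) = U \<nu> x (mu k x) * \<Psi> x (mu k x)"
    using Psi_along[OF W[OF x] mu'] by blast
  have near: "\<forall>\<^sub>F y in nhds x. y \<in> \<Omega>" by (rule eventually_nhds_in_open[OF domain(1) x])
  then have "\<forall>\<^sub>F y in nhds x. Determinant.det (\<Psi> y (mu k y)) \<noteq> 0"
    by eventually_elim (intro invertible_det_nonzero[OF Psi_carrier Psi_invertible] W)
  then obtain V' where V': "has_mat_derivative n n (\<lambda>y. matinv (\<Psi> y (mu k y))) V' x"
    using has_mat_derivative_matinv[OF P'(1)] by blast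
  let ?P = "\<Psi> x (mu k x)" and ?Pi = "matinv (\<Psi> x (mu k x))"
  let ?Y = "\<lambda>y. matinv (\<Psi> y (mu k y)) * B k y"
  note Pi = Psi_inverse[OF W[OF x]] and Pc = Psi_carrier[OF W[OF x]] and Bc = B_carrier[OF k x]
  obtain Y' where Y': "has_mat_derivative n n ?Y Y' x"
    using has_mat_derivative_mult[OF V' B1] by blast
  have Yc: "?Y x \<in> carrier_mat n n" using Pi Bc by auto
  have PY: "?P * ?Y x = B k x" by (rule mult_mat_cancel[OF Pi(2)]) (use Pi Pc Bc in simp_all)
  have "\<forall>\<^sub>F y in nhds x. \<Psi> y (mu k y) * ?Y y = B k y"
    using near
  proof eventually_elim
    case (elim y)
    show ?case
      by (rule mult_mat_cancel[OF Psi_inverse(2)[OF W[OF elim]]])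
        (use Psi_inverse(1)[OF W[OF elim]] Psi_carrier[OF W[OF elim]] B_carrier[OF k elim] in simp_all)
  qed
  from has_mat_derivative_unique[OF has_mat_derivative_cong[OF has_mat_derivative_mult[OF P'(1) Y'] this] B1]
  have deriv: "P' h * ?Y x + ?P * Y' h = B1 h" for h .
  have "\<exists>C\<in>carrier_mat n n. (Y' (axis \<nu> 1))\<^sup>T = C * (?Y x)\<^sup>T" for \<nu>
  proof -
    have U: "U \<nu> x (mu k x) \<in> carrier_mat n n" by (rule U_carrier[OF x])
    have Y'c: "Y' (axis \<nu> 1) \<in> carrier_mat n n" by (rule has_mat_derivativeD(1)[OF Y'])
    obtain X where X: "X \<in> carrier_mat n n" "U \<nu> x (mu k x) * B k x - B1 (axis \<nu> 1) = B k x * X"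
      using right_residue[OF x k B1] by blast
    have UB: "P' (axis \<nu> 1) * ?Y x = U \<nu> x (mu k x) * B k x"
      unfolding P'(2) assoc_mult_mat[OF U Pc Yc] PY ..
    have PY': "?P * Y' (axis \<nu> 1) \<in> carrier_mat n n" and UBc: "U \<nu> x (mu k x) * B k x \<in> carrier_mat n n"
      and BX: "B k x * X \<in> carrier_mat n n"
      using Pc Y'c U Bc X by auto
    have "?P * Y' (axis \<nu> 1) = - (B k x * X)"
      unfolding X(2)[symmetric] deriv[of "axis \<nu> 1", symmetric] UB
      by (intro eq_matI) (use PY' UBc in \<open>auto simp del: index_mult_mat(1)\<close>)
    also have "\<dots> = ?P * - (?Y x * X)"
    proof -
      have "?P * - (?Y x * X) = - (?P * (?Y x * X))"
        by (rule uminus_mult_right_mat) (use Pi Pc Bc X(1) in simp)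
      then show ?thesis unfolding assoc_mult_mat[OF Pc Yc X(1), symmetric] PY by simp
    qed
    finally have "?Pi * (?P * Y' (axis \<nu> 1)) = ?Pi * (?P * - (?Y x * X))" by simp
    moreover have "?Pi * (?P * Y' (axis \<nu> 1)) = Y' (axis \<nu> 1)"
      by (rule mult_mat_cancel[OF Pi(3)]) (use Pi Pc Y'c in simp_all)
    moreover have "?Pi * (?P * - (?Y x * X)) = - (?Y x * X)"
      by (rule mult_mat_cancel[OF Pi(3)]) (use Pi Pc Bc in simp_all)
    ultimately have "Y' (axis \<nu> 1) = - (?Y x * X)" by simp
    also have "\<dots> = ?Y x * - X" by (rule uminus_mult_right_mat[symmetric]) (use Bc X(1) in simp)
    finally have "(Y' (axis \<nu> 1))\<^sup>T = (- X)\<^sup>T * (?Y x)\<^sup>T"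
      using transpose_mult[OF Yc uminus_carrier_mat[OF X(1)]] by simp
    moreover have "(- X)\<^sup>T \<in> carrier_mat n n" using X(1) by simp
    ultimately show ?thesis by blast
  qed
  then show ?thesis using has_mat_derivative_transpose[OF Y'] by blast
qed

text \<open>Multiplication by the invertible \<open>\<N>\<close> and Psi(lam_k) preserves the rank,
  so G = \<open>\<N>\<close> A_k Psi(lam_k) has a constant row basis \<open>Q\<close>. Undoing both
  factors leaves the x-dependence of the rows of A_k in Psi(lam_k)^-1.\<close>

lemma left_constant_rows:
  assumes k: "k < N"
  shows "\<exists>Q. has_right_inverse (rA k) n Q \<and> (\<forall>x\<in>\<Omega>. \<exists>P. has_left_inverse n (rA k) P \<and>
    A k x = P * (Q * matinv (\<Psi> x (lam k x))))"
proof -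
  let ?G = "\<lambda>y. \<N> y * A k y * \<Psi> y (lam k y)"
  have W: "(x, lam k x) \<in> W" if "x \<in> \<Omega>" for x by (rule lam_in_W[OF k that])
  have "\<forall>x\<in>\<Omega>. \<exists>G'. has_mat_derivative n n ?G G' x \<and>
      (\<forall>\<nu>. \<exists>C\<in>carrier_mat n n. G' (axis \<nu> 1) = C * ?G x)"
    using left_derivative[OF _ k] by blast
  from bchoice[OF this] obtain G' where
    G'0: "\<forall>x\<in>\<Omega>. has_mat_derivative n n ?G (G' x) x \<and> (\<forall>\<nu>. \<exists>C\<in>carrier_mat n n. G' x (axis \<nu> 1) = C * ?G x)"
    by blast
  have G': "has_mat_derivative n n ?G (G' x) x"
    "\<exists>C\<in>carrier_mat n n. G' x (axis \<nu> 1) = C * ?G x" if "x \<in> \<Omega>" for x \<nu>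
    using G'0 that by blast+
  have rk: "\<exists>Q. has_right_inverse (rA k) n Q \<and> has_row_basis n (rA k) (?G x) Q" if x: "x \<in> \<Omega>" for x
  proof -
    obtain P Q where PQ: "has_left_inverse n (rA k) P" "has_right_inverse (rA k) n Q" "A k x = P * Q"
      using rank_factorization[OF A_carrier[OF k x]] unfolding A_rank[OF k x] by blast
    have c: "P \<in> carrier_mat n (rA k)" "Q \<in> carrier_mat (rA k) n"
      using PQ by (auto simp: has_left_inverse_def has_right_inverse_def)
    have "has_left_inverse n (rA k) (\<N> x * P)"
      by (rule has_left_inverse_mult[OF has_left_inverse_square(1)[OF N_carrier[OF x] N_inverse(1,2)[OF x]] PQ(1)])
    moreover have "has_right_inverse (rA k) n (Q * \<Psi> x (lam k x))"
      by (rule has_right_inverse_mult[OF PQ(2) has_left_inverse_square(2)[OF Psi_carrier[OF W[OF x]] Psi_inverse(1,2)[OF W[OF x]]]])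
    moreover have "?G x = \<N> x * P * (Q * \<Psi> x (lam k x))"
      using c N_carrier[OF x] Psi_carrier[OF W[OF x]] by (simp add: PQ(3) mult_mat_assoc)
    ultimately show ?thesis unfolding has_row_basis_def by blast
  qed
  have ode: "\<exists>C\<in>carrier_mat n n. G' x h = C * ?G x" if x: "x \<in> \<Omega>" and h: "h \<in> Basis" for x h
  proof -
    obtain \<nu> where "h = axis \<nu> 1" using h by (rule Basis_axis)
    then show ?thesis using G'(2)[OF x, of \<nu>] by simp
  qed
  obtain Q where Q: "has_right_inverse (rA k) n Q" "\<And>x. x \<in> \<Omega> \<Longrightarrow> has_row_basis n (rA k) (?G x) Q"
    using row_space_constant[OF domain(1,3,2) G'(1) ode rk] by blast
  have "\<exists>P. has_left_inverse n (rA k) P \<and> A k x = P * (Q * matinv (\<Psi> x (lam k x)))" if x: "x \<in> \<Omega>" for x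
  proof -
    obtain P where P: "has_left_inverse n (rA k) P" "?G x = P * Q"
      using Q(2)[OF x] by (auto simp: has_row_basis_def)
    note Ni = N_inverse[OF x] and Nc = N_carrier[OF x] and Pi = Psi_inverse[OF W[OF x]]
      and Pc = Psi_carrier[OF W[OF x]] and Ac = A_carrier[OF k x]
    have c: "P \<in> carrier_mat n (rA k)" "Q \<in> carrier_mat (rA k) n"
      using P Q by (auto simp: has_left_inverse_def has_right_inverse_def)
    have "A k x = matinv (\<N> x) * (\<N> x * A k x)"
      by (rule mult_mat_cancel[OF Ni(3), symmetric]) (use Ni Nc Ac in simp_all)
    also have "\<N> x * A k x = ?G x * matinv (\<Psi> x (lam k x))"
      using Nc Ac Pc Pi by (simp add: mult_mat_assoc)
    also have "matinv (\<N> x) * \<dots> = matinv (\<N> x) * P * (Q * matinv (\<Psi> x (lam k x)))"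
      unfolding P(2) using Ni c Pi by (simp add: mult_mat_assoc)
    finally show ?thesis
      using has_left_inverse_mult[OF has_left_inverse_square(1)[OF Ni(1) Nc Ni(3)] P(1)] by blast
  qed
  then show ?thesis using Q(1) by blast
qed

text \<open>A constant row basis of the transpose of Psi(mu_k)^-1 B_k is transposed back to a
  constant column basis, and multiplication by Psi(mu_k) recovers B_k.\<close>

lemma right_constant_cols:
  assumes k: "k < N"
  shows "\<exists>b. has_left_inverse n (rB k) b \<and> (\<forall>x\<in>\<Omega>. \<exists>Q. has_right_inverse (rB k) n Q \<and>
    B k x = \<Psi> x (mu k x) * b * Q)"
proof -
  let ?Y = "\<lambda>y. matinv (\<Psi> y (mu k y)) * B k y"
  have W: "(x, mu k x) \<in> W" if "x \<in> \<Omega>" for x by (rule mu_in_W[OF k that])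
  have "\<forall>x\<in>\<Omega>. \<exists>G'. has_mat_derivative n n (\<lambda>y. (?Y y)\<^sup>T) G' x \<and>
      (\<forall>\<nu>. \<exists>C\<in>carrier_mat n n. G' (axis \<nu> 1) = C * (?Y x)\<^sup>T)"
    using right_derivative[OF _ k] by blast
  from bchoice[OF this] obtain G' where
    G'0: "\<forall>x\<in>\<Omega>. has_mat_derivative n n (\<lambda>y. (?Y y)\<^sup>T) (G' x) x \<and>
      (\<forall>\<nu>. \<exists>C\<in>carrier_mat n n. G' x (axis \<nu> 1) = C * (?Y x)\<^sup>T)"
    by blast
  have G': "has_mat_derivative n n (\<lambda>y. (?Y y)\<^sup>T) (G' x) x"
    "\<exists>C\<in>carrier_mat n n. G' x (axis \<nu> 1) = C * (?Y x)\<^sup>T" if "x \<in> \<Omega>" for x \<nu>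
    using G'0 that by blast+
  have rk: "\<exists>Q. has_right_inverse (rB k) n Q \<and> has_row_basis n (rB k) ((?Y x)\<^sup>T) Q" if x: "x \<in> \<Omega>" for x
  proof -
    obtain P Q where PQ: "has_left_inverse n (rB k) P" "has_right_inverse (rB k) n Q" "B k x = P * Q"
      using rank_factorization[OF B_carrier[OF k x]] unfolding B_rank[OF k x] by blast
    have c: "P \<in> carrier_mat n (rB k)" "Q \<in> carrier_mat (rB k) n"
      using PQ by (auto simp: has_left_inverse_def has_right_inverse_def)
    note Pi = Psi_inverse[OF W[OF x]] and Pc = Psi_carrier[OF W[OF x]]
    have l: "has_left_inverse n (rB k) (matinv (\<Psi> x (mu k x)) * P)"
      by (rule has_left_inverse_mult[OF has_left_inverse_square(1)[OF Pi(1) Pc Pi(3)] PQ(1)])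
    have "?Y x = matinv (\<Psi> x (mu k x)) * P * Q"
      using c Pi by (simp add: PQ(3) mult_mat_assoc)
    then have "(?Y x)\<^sup>T = Q\<^sup>T * (matinv (\<Psi> x (mu k x)) * P)\<^sup>T"
      using transpose_mult[OF mult_carrier_mat[OF Pi(1) c(1)] c(2)] by simp
    then show ?thesis
      using has_right_inverse_transpose[OF l] has_left_inverse_transpose[OF PQ(2)]
      unfolding has_row_basis_def by blast
  qed
  have ode: "\<exists>C\<in>carrier_mat n n. G' x h = C * (?Y x)\<^sup>T" if x: "x \<in> \<Omega>" and h: "h \<in> Basis" for x h
  proof -
    obtain \<nu> where "h = axis \<nu> 1" using h by (rule Basis_axis)
    then show ?thesis using G'(2)[OF x, of \<nu>] by simp
  qed
  obtain Q where Q: "has_right_inverse (rB k) n Q" "\<And>x. x \<in> \<Omega> \<Longrightarrow> has_row_basis n (rB k) ((?Y x)\<^sup>T) Q"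
    using row_space_constant[OF domain(1,3,2) G'(1) ode rk] by blast
  have "\<exists>R. has_right_inverse (rB k) n R \<and> B k x = \<Psi> x (mu k x) * Q\<^sup>T * R" if x: "x \<in> \<Omega>" for x
  proof -
    obtain P where P: "has_left_inverse n (rB k) P" "(?Y x)\<^sup>T = P * Q"
      using Q(2)[OF x] by (auto simp: has_row_basis_def)
    note Pi = Psi_inverse[OF W[OF x]] and Pc = Psi_carrier[OF W[OF x]] and Bc = B_carrier[OF k x]
    have c: "P \<in> carrier_mat n (rB k)" "Q \<in> carrier_mat (rB k) n"
      using P Q by (auto simp: has_left_inverse_def has_right_inverse_def)
    have "?Y x = Q\<^sup>T * P\<^sup>T"
      using arg_cong[OF P(2), of transpose_mat] transpose_mult[OF c] by simp
    moreover have "B k x = \<Psi> x (mu k x) * ?Y x"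
      by (rule mult_mat_cancel[OF Pi(2), symmetric]) (use Pi Pc Bc in simp_all)
    ultimately have "B k x = \<Psi> x (mu k x) * Q\<^sup>T * P\<^sup>T"
      using Pc c by (simp add: mult_mat_assoc)
    then show ?thesis using has_right_inverse_transpose[OF P(1)] by blast
  qed
  then show ?thesis using has_left_inverse_transpose[OF Q(1)] by blast
qed

end

theorem corollary5p3:
  fixes n N :: nat
    and \<Omega> :: "(real ^ 'm::finite) set"
    and W :: "((real ^ 'm) \<times> complex) set"
    and L :: "'m \<Rightarrow> real ^ 'm \<Rightarrow> complex \<Rightarrow> complex"
    and U :: "'m \<Rightarrow> real ^ 'm \<Rightarrow> complex \<Rightarrow> complex mat"
    and \<Psi> D Dinv :: "real ^ 'm \<Rightarrow> complex \<Rightarrow> complex mat"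
    and \<N> :: "real ^ 'm \<Rightarrow> complex mat"
    and A B :: "nat \<Rightarrow> real ^ 'm \<Rightarrow> complex mat"
    and lam mu :: "nat \<Rightarrow> real ^ 'm \<Rightarrow> complex"
    and rA rB :: "nat \<Rightarrow> nat"
  assumes domain: "open \<Omega>" "\<Omega> \<noteq> {}" "simply_connected \<Omega>"
    and U_carrier: "\<And>\<nu> x z. x \<in> \<Omega> \<Longrightarrow> U \<nu> x z \<in> carrier_mat n n"
    and U_rational: "\<And>\<nu> x. x \<in> \<Omega> \<Longrightarrow> mat_rational n (U \<nu> x)"
    and L_rational: "\<And>\<nu> x. x \<in> \<Omega> \<Longrightarrow> rational_fun (L \<nu> x)"
    \<comment> \<open>W is the region of all (x, spectral parameter) in which the solution of the linear problem
       is considered.\<close>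
    and W_domain: "open W" "W \<subseteq> \<Omega> \<times> UNIV"
    and U_regular: "\<And>\<nu> x z. (x, z) \<in> W \<Longrightarrow> mat_regular_at n (U \<nu> x) z"
    and L_regular: "\<And>\<nu> x z. (x, z) \<in> W \<Longrightarrow> L \<nu> x analytic_on {z}"
    and Psi_carrier: "\<And>x z. (x, z) \<in> W \<Longrightarrow> \<Psi> x z \<in> carrier_mat n n"
    and Psi_regular: "\<And>x z. (x, z) \<in> W \<Longrightarrow> mat_regular_at n (\<Psi> x) z"
    and Psi_differentiable:
      "\<And>x z. (x, z) \<in> W \<Longrightarrow> mat_differentiable n (\<lambda>(y, w). \<Psi> y w) (x, z)"
    and Psi_invertible: "\<And>x z. (x, z) \<in> W \<Longrightarrow> invertible_mat (\<Psi> x z)"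
    and linear_problem:
      "\<And>\<nu> x z. (x, z) \<in> W \<Longrightarrow> mat_total_deriv n L \<nu> \<Psi> x z = U \<nu> x z * \<Psi> x z"
    and lam_in_W: "\<And>k x. k < N \<Longrightarrow> x \<in> \<Omega> \<Longrightarrow> (x, lam k x) \<in> W"
    and mu_in_W: "\<And>k x. k < N \<Longrightarrow> x \<in> \<Omega> \<Longrightarrow> (x, mu k x) \<in> W"
    and lam_distinct:
      "\<And>k j x. k < N \<Longrightarrow> j < N \<Longrightarrow> k \<noteq> j \<Longrightarrow> x \<in> \<Omega> \<Longrightarrow> lam k x \<noteq> lam j x"
    and mu_distinct:
      "\<And>k j x. k < N \<Longrightarrow> j < N \<Longrightarrow> k \<noteq> j \<Longrightarrow> x \<in> \<Omega> \<Longrightarrow> mu k x \<noteq> mu j x"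
    and lam_mu_distinct: "\<And>k j x. k < N \<Longrightarrow> j < N \<Longrightarrow> x \<in> \<Omega> \<Longrightarrow> lam k x \<noteq> mu j x"
    and lam_differentiable: "\<And>k x. k < N \<Longrightarrow> x \<in> \<Omega> \<Longrightarrow> lam k differentiable (at x)"
    and mu_differentiable: "\<And>k x. k < N \<Longrightarrow> x \<in> \<Omega> \<Longrightarrow> mu k differentiable (at x)"
    and lam_deriv:
      "\<And>k \<nu> x. k < N \<Longrightarrow> x \<in> \<Omega> \<Longrightarrow> partial_deriv \<nu> (lam k) x = L \<nu> x (lam k x)"
    and mu_deriv:
      "\<And>k \<nu> x. k < N \<Longrightarrow> x \<in> \<Omega> \<Longrightarrow> partial_deriv \<nu> (mu k) x = L \<nu> x (mu k x)"
    and A_carrier: "\<And>k x. k < N \<Longrightarrow> x \<in> \<Omega> \<Longrightarrow> A k x \<in> carrier_mat n n"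
    and B_carrier: "\<And>k x. k < N \<Longrightarrow> x \<in> \<Omega> \<Longrightarrow> B k x \<in> carrier_mat n n"
    and A_differentiable: "\<And>k x. k < N \<Longrightarrow> x \<in> \<Omega> \<Longrightarrow> mat_differentiable n (A k) x"
    and B_differentiable: "\<And>k x. k < N \<Longrightarrow> x \<in> \<Omega> \<Longrightarrow> mat_differentiable n (B k) x"
    and A_nonzero: "\<And>k x. k < N \<Longrightarrow> x \<in> \<Omega> \<Longrightarrow> A k x \<noteq> 0\<^sub>m n n"
    and B_nonzero: "\<And>k x. k < N \<Longrightarrow> x \<in> \<Omega> \<Longrightarrow> B k x \<noteq> 0\<^sub>m n n"
    and A_rank: "\<And>k x. k < N \<Longrightarrow> x \<in> \<Omega> \<Longrightarrow> vec_space.rank n (A k x) = rA k"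
    and B_rank: "\<And>k x. k < N \<Longrightarrow> x \<in> \<Omega> \<Longrightarrow> vec_space.rank n (B k x) = rB k"
    and N_carrier: "\<And>x. x \<in> \<Omega> \<Longrightarrow> \<N> x \<in> carrier_mat n n"
    and N_differentiable: "\<And>x. x \<in> \<Omega> \<Longrightarrow> mat_differentiable n \<N> x"
    and N_det: "\<And>x. x \<in> \<Omega> \<Longrightarrow> Determinant.det (\<N> x) \<noteq> 0"
    and D_form: "\<And>x z. x \<in> \<Omega> \<Longrightarrow> (\<forall>k<N. z \<noteq> lam k x) \<Longrightarrow>
      D x z = \<N> x * (1\<^sub>m n + mat_sum n (\<lambda>k. (1 / (z - lam k x)) \<cdot>\<^sub>m A k x) {..<N})"
    and Dinv_form: "\<And>x z. x \<in> \<Omega> \<Longrightarrow> (\<forall>k<N. z \<noteq> mu k x) \<Longrightarrow>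
      Dinv x z = (1\<^sub>m n + mat_sum n (\<lambda>k. (1 / (z - mu k x)) \<cdot>\<^sub>m B k x) {..<N}) * matinv (\<N> x)"
    and D_Dinv: "\<And>x z. x \<in> \<Omega> \<Longrightarrow> (\<forall>k<N. z \<noteq> lam k x \<and> z \<noteq> mu k x) \<Longrightarrow>
      inverts_mat (D x z) (Dinv x z) \<and> inverts_mat (Dinv x z) (D x z)"
    and darboux: "\<And>\<nu> x z. x \<in> \<Omega> \<Longrightarrow>
      mat_pole n (transformed n L D Dinv U \<nu> x) z \<longleftrightarrow> mat_pole n (U \<nu> x) z"
  shows "\<exists>a0 b0 :: nat \<Rightarrow> complex mat.
    (\<forall>k<N. a0 k \<in> carrier_mat (rA k) n \<and> independent_vecs n (rows (a0 k)) \<and>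
           b0 k \<in> carrier_mat n (rB k) \<and> independent_vecs n (cols (b0 k))) \<and>
    (\<forall>x\<in>\<Omega>.
      let a = (\<lambda>k. a0 k * matinv (\<Psi> x (lam k x)));
          b = (\<lambda>k. \<Psi> x (mu k x) * b0 k);
          M = (\<lambda>k j. (1 / (lam k x - mu j x)) \<cdot>\<^sub>m (a k * b j));
          Mhat = block_mat N rA rB M;
          K = block rB rA (matinv Mhat)
      in invertible_mat Mhat \<and>
         (\<forall>z. (\<forall>k<N. z \<noteq> lam k x) \<longrightarrow>
            D x z = \<N> x * (1\<^sub>m n + mat_sum n (\<lambda>k. mat_sum n (\<lambda>j.
              (1 / (z - lam k x)) \<cdot>\<^sub>m (b j * K j k * a k)) {..<N}) {..<N})) \<and>
         (\<forall>z. (\<forall>j<N. z \<noteq> mu j x) \<longrightarrow>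
            Dinv x z = (1\<^sub>m n - mat_sum n (\<lambda>k. mat_sum n (\<lambda>j.
              (1 / (z - mu j x)) \<cdot>\<^sub>m (b j * K j k * a k)) {..<N}) {..<N}) * matinv (\<N> x)))"
proof -
  interpret dp: darboux_pair n N \<Omega> W L U \<Psi> D Dinv \<N> A B lam mu rA rB
    by (unfold_locales, unfold pole_sum_def)
      (fact assms simply_connected_imp_connected[OF domain(3)])+
  have "\<forall>k\<in>{..<N}. \<exists>Q. has_right_inverse (rA k) n Q \<and> (\<forall>x\<in>\<Omega>. \<exists>P. has_left_inverse n (rA k) P \<and>
      A k x = P * (Q * matinv (\<Psi> x (lam k x))))"
    using dp.left_constant_rows by simp
  from bchoice[OF this] obtain a0 where a0: "\<And>k. k < N \<Longrightarrow> has_right_inverse (rA k) n (a0 k)"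
    "\<And>k x. k < N \<Longrightarrow> x \<in> \<Omega> \<Longrightarrow> \<exists>P. has_left_inverse n (rA k) P \<and>
      A k x = P * (a0 k * matinv (\<Psi> x (lam k x)))"
    by auto
  have "\<forall>k\<in>{..<N}. \<exists>b. has_left_inverse n (rB k) b \<and> (\<forall>x\<in>\<Omega>. \<exists>Q. has_right_inverse (rB k) n Q \<and>
      B k x = \<Psi> x (mu k x) * b * Q)"
    using dp.right_constant_cols by simp
  from bchoice[OF this] obtain b0 where b0: "\<And>k. k < N \<Longrightarrow> has_left_inverse n (rB k) (b0 k)"
    "\<And>k x. k < N \<Longrightarrow> x \<in> \<Omega> \<Longrightarrow> \<exists>Q. has_right_inverse (rB k) n Q \<and>
      B k x = \<Psi> x (mu k x) * b0 k * Q"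
    by auto
  show ?thesis
  proof (rule exI[of _ a0], rule exI[of _ b0], intro conjI allI impI ballI)
    fix k assume k: "k < N"
    show "a0 k \<in> carrier_mat (rA k) n" "b0 k \<in> carrier_mat n (rB k)"
      using a0(1)[OF k] b0(1)[OF k] by (auto simp: has_left_inverse_def has_right_inverse_def)
    show "independent_vecs n (rows (a0 k))" by (rule independent_vecs_rows[OF a0(1)[OF k]])
    show "independent_vecs n (cols (b0 k))" by (rule independent_vecs_cols[OF b0(1)[OF k]])
  next
    fix x assume x: "x \<in> \<Omega>"
    define a where "a = (\<lambda>k. a0 k * matinv (\<Psi> x (lam k x)))"
    define b where "b = (\<lambda>k. \<Psi> x (mu k x) * b0 k)"
    \<comment> \<open>\<open>a0\<close> and \<open>b0\<close> were fixed before x. The complementary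
      factors \<open>P\<close> and \<open>Q\<close> may depend on x; they serve to compute an
      inverse that is itself determined by \<open>a\<close> and \<open>b\<close>.\<close>
    obtain P where P: "\<And>k. k < N \<Longrightarrow> has_left_inverse n (rA k) (P k)" "\<And>k. k < N \<Longrightarrow> A k x = P k * a k"
      using a0(2)[OF _ x] unfolding a_def by metis
    obtain Q where Q: "\<And>k. k < N \<Longrightarrow> has_right_inverse (rB k) n (Q k)" "\<And>k. k < N \<Longrightarrow> B k x = b k * Q k"
      using b0(2)[OF _ x] unfolding b_def by metis
    have a: "has_right_inverse (rA k) n (a k)" if k: "k < N" for k
      unfolding a_def
      by (rule has_right_inverse_mult[OF a0(1)[OF k] has_left_inverse_square(2)[OF
            dp.Psi_inverse(1)[OF lam_in_W[OF k x]] Psi_carrier[OF lam_in_W[OF k x]] dp.Psi_inverse(3)[OF lam_in_W[OF k x]]]])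
    have b: "has_left_inverse n (rB k) (b k)" if k: "k < N" for k
      unfolding b_def
      by (rule has_left_inverse_mult[OF has_left_inverse_square(1)[OF
            Psi_carrier[OF mu_in_W[OF k x]] dp.Psi_inverse(1,2)[OF mu_in_W[OF k x]]] b0(1)[OF k]])
    interpret p: pole_sum_pair n N "\<lambda>k. A k x" "\<lambda>k. B k x" "\<lambda>k. lam k x" "\<lambda>k. mu k x" using x by (rule dp.pair)
    have M: "(\<lambda>k j. (1 / (lam k x - mu j x)) \<cdot>\<^sub>m (a k * b j)) = cauchy_block (\<lambda>k. lam k x) (\<lambda>k. mu k x) a b"
      by (simp add: cauchy_block_def fun_eq_iff)
    show "let a = (\<lambda>k. a0 k * matinv (\<Psi> x (lam k x)));
          b = (\<lambda>k. \<Psi> x (mu k x) * b0 k);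
          M = (\<lambda>k j. (1 / (lam k x - mu j x)) \<cdot>\<^sub>m (a k * b j));
          Mhat = block_mat N rA rB M;
          K = block rB rA (matinv Mhat)
      in invertible_mat Mhat \<and>
         (\<forall>z. (\<forall>k<N. z \<noteq> lam k x) \<longrightarrow>
            D x z = \<N> x * (1\<^sub>m n + mat_sum n (\<lambda>k. mat_sum n (\<lambda>j.
              (1 / (z - lam k x)) \<cdot>\<^sub>m (b j * K j k * a k)) {..<N}) {..<N})) \<and>
         (\<forall>z. (\<forall>j<N. z \<noteq> mu j x) \<longrightarrow>
            Dinv x z = (1\<^sub>m n - mat_sum n (\<lambda>k. mat_sum n (\<lambda>j.
              (1 / (z - mu j x)) \<cdot>\<^sub>m (b j * K j k * a k)) {..<N}) {..<N}) * matinv (\<N> x))"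
      unfolding Let_def a_def[symmetric] b_def[symmetric] M
    proof (intro conjI allI impI)
      show "invertible_mat (block_mat N rA rB (cauchy_block (\<lambda>k. lam k x) (\<lambda>k. mu k x) a b))"
        using p.block_matrix_inverse(1)[OF a P b Q] .
    qed (simp_all only: dp.D_form[OF x] dp.Dinv_form[OF x] p.pole_sum_from_blocks[OF a P b Q])
  qed
qed

end
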